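(* Let $x\in\mathbb{R}$ be such that $f(x)\neq 0$. Assume: (i) $K:\mathbb{R}\to\mathbb{R}$ is nonnegative, continuous and bounded, with $\int_{\mathbb{R}}K(z)\,dz=1$, $\int_{\mathbb{R}}zK(z)\,dz=0$ and $\int_{\mathbb{R}}z^2K(z)\,dz<\infty$; (ii) $(\gamma_n)\in\mathcal{GS}(-\alpha)$ with $\alpha\in(\tfrac34,1]$, and the limit of $(n\gamma_n)^{-1}$ as $n\to\infty$ exists; $(h_n)\in\mathcal{GS}(-a)$ with $a\in(\tfrac{1-\alpha}{4},\tfrac{\alpha}{3})$; (iii) $g(s,t)$ is two times continuously differentiable with respect to $s$; for $q'\in\{0,1,2\}$, $s\mapsto\int_{\mathbb{R}}t^{q'} g(s,t)\,dt$ is a bounded function continuous at $s=x$; for $q'\in[2,3]$, $s\mapsto\int_{\mathbb{R}}|t|^{q'} g(s,t)\,dt$ is bounded; for $q'\in\{0,1\}$, $\int_{\mathbb{R}}|t|^{q'}\left|\frac{\partial g}{\partial s}(x,t)\right|dt<\infty$ and $s\mapsto\int_{\mathbb{R}}t^{q'}\frac{\partial^2 g}{\partial s^2}(s,t)\,dt$ is a bounded function continuous at $s=x$; (iv) $\lim_{n\to\infty}n\gamma_n\left(\ln\left(\sum_{k=1}^n\gamma_k\right)\right)^{-1}=\infty$ and $a\in\left(1-\alpha,\tfrac{4\alpha-3}{2}\right)$; (v) $(q_n)\in\mathcal{GS}(-q)$ with $q<\min\left\{1-2a,\tfrac{1+a}{2}\right\}$. 1. If there exists $c\geq0$ such that $nh_n^5\to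 c$, then $$\sqrt{nh_n}\,\bigl(\bar r_n(x)-r(x)\bigr)\xrightarrow{\mathcal{D}}\mathcal{N}\left(c^{\frac12}\frac{1-q}{1-q-2a}m^{(2)}(x),\ \frac{(1-q)^2}{1+a-2q}\,\frac{\mathrm{Var}[Y\mid X=x]}{f(x)}\int_{\mathbb{R}}K^2(z)\,dz\right).$$ 2. If $nh_n^5\to\infty$, then $$\frac{1}{h_n^2}\bigl(\bar r_n(x)-r(x)\bigr)\xrightarrow{\mathbb{P}}\frac{1-q}{1-q-2a}m^{(2)}(x).$$
   Context: $(X,Y),(X_1,Y_1),(X_2,Y_2),\ldots$ are independent, identically distributed pairs of real random variables with joint density $g(s,t)$; $f(s)=\int_{\mathbb{R}}g(s,t)\,dt$ is the density of $X$ and $r(x)=\mathbb{E}(Y\mid X=x)$ (that is, $r(x)=f(x)^{-1}\int_{\mathbb{R}}t\,g(x,t)\,dt$ when $f(x)\neq0$). $K$ is a kernel; the stepsize $(\gamma_n)$ and the bandwidth $(h_n)$ are nonrandom sequences of positive reals going to zero. For $n\ge1$ set $Z_n(x)=h_n^{-1}K\left(\frac{x-X_n}{h_n}\right)$ and $W_n(x)=h_n^{-1}Y_nK\left(\frac{x-X_n}{h_n}\right)$. The generalized Révész estimator is defined by setting $r_0(x)\in\mathbb{R}$ and, for $n\geq1$, $r_n(x)=r_{n-1}(x)+\gamma_n\left[W_n(x)-Z_n(x)r_{n-1}(x)\right]$. Given a nonrandom positive sequence $(q_n)$ with $\sum q_n=\infty$, the averaged Révész estimator is $\bar r_n(x)=\frac{1}{\sum_{k=1}^nq_k}\sum_{k=1}^nq_kr_k(x)$.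 For $\gamma\in\mathbb{R}$, a nonrandom positive sequence $(v_n)_{n\ge1}$ belongs to $\mathcal{GS}(\gamma)$ if $\lim_{n\to\infty}n\left[1-\frac{v_{n-1}}{v_n}\right]=\gamma$. For $f(x)\neq0$, $m^{(2)}(x)=\frac{1}{2f(x)}\left[\int_{\mathbb{R}}t\frac{\partial^2g}{\partial s^2}(x,t)\,dt-r(x)\int_{\mathbb{R}}\frac{\partial^2g}{\partial s^2}(x,t)\,dt\right]\int_{\mathbb{R}}z^2K(z)\,dz$. $\xrightarrow{\mathcal{D}}$ is convergence in distribution, $\xrightarrow{\mathbb{P}}$ convergence in probability, $\mathcal{N}(\mu,\sigma^2)$ the Gaussian distribution with mean $\mu$ and variance $\sigma^2$.
   Formalization: Condition (iii) is supplemented: for q' in {0,1}, t^{q'} ∂²g/∂s²(s,t) is assumed Lebesgue integrable in (s,t) jointly on [x-δ,x+δ]×ℝ for some δ>0; without this the second-order bias expansion, and the statement, can fail. *)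

theory Defs
  imports "HOL-Probability.Probability"
begin

text \<open>Sequences are functions on \<^typ>\<open>nat\<close> of which only the values at indices \<open>n \<ge> 1\<close> are
  meaningful; the term \<open>v 0\<close> enters the limit below only at \<open>n = 1\<close>.\<close>

definition GS :: "real \<Rightarrow> (nat \<Rightarrow> real) set" where
  "GS \<gamma> = {v. (\<forall>n\<ge>1. 0 < v n) \<and> (\<lambda>n. real n * (1 - v (n - 1) / v n)) \<longlonglongrightarrow> \<gamma>}"

text \<open>For a joint density \<open>g\<close> of \<open>(X, Y)\<close>: the density of \<open>X\<close>, and the mean and variance of the
  conditional law of \<open>Y\<close> given \<open>X = x\<close>, i.e. the law with density \<open>t \<mapsto> g x t / marg_dens g x\<close>.
  The latter two are meaningful where \<open>marg_dens g x \<noteq> 0\<close>.\<close>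

definition marg_dens :: "(real \<Rightarrow> real \<Rightarrow> real) \<Rightarrow> real \<Rightarrow> real" where
  "marg_dens g s = (\<integral>t. g s t \<partial>lborel)"

definition cond_mean :: "(real \<Rightarrow> real \<Rightarrow> real) \<Rightarrow> real \<Rightarrow> real" where
  "cond_mean g x = inverse (marg_dens g x) * (\<integral>t. t * g x t \<partial>lborel)"

definition cond_var :: "(real \<Rightarrow> real \<Rightarrow> real) \<Rightarrow> real \<Rightarrow> real" where
  "cond_var g x = inverse (marg_dens g x) * (\<integral>t. (t - cond_mean g x)\<^sup>2 * g x t \<partial>lborel)"

definition ds :: "(real \<Rightarrow> real \<Rightarrow> real) \<Rightarrow> real \<Rightarrow> real \<Rightarrow> real" where
  "ds g s t = deriv (\<lambda>u. g u t) s"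

definition C2_fst :: "(real \<Rightarrow> real \<Rightarrow> real) \<Rightarrow> bool" where
  "C2_fst g \<longleftrightarrow> (\<forall>t. (\<forall>s. (\<lambda>u. g u t) differentiable (at s)) \<and>
                    (\<forall>s. (\<lambda>u. ds g u t) differentiable (at s)) \<and>
                    continuous_on UNIV (\<lambda>s. ds (ds g) s t))"

text \<open>The map \<open>s \<mapsto> \<integral>t. F s t \<partial>lborel\<close> is well defined and bounded. Integrability is
  explicit because the Bochner integral of a non-integrable function is \<open>0\<close>.\<close>

definition bounded_integral :: "(real \<Rightarrow> real \<Rightarrow> real) \<Rightarrow> bool" where
  "bounded_integral F \<longleftrightarrow>
     (\<forall>s. integrable lborel (F s)) \<and> bounded (range (\<lambda>s. \<integral>t. F s t \<partial>lborel))"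

text \<open>Joint integrability on a strip around \<open>x\<close>. For \<open>F s t = t ^ p * ds (ds g) s t\<close> this
  justifies Fubini in the second-order expansion of \<open>s \<mapsto> \<integral>t. t ^ p * g s t \<partial>lborel\<close> at \<open>x\<close>.
  Boundedness of \<open>s \<mapsto> \<integral>t. F s t \<partial>lborel\<close> and its continuity at \<open>x\<close> do not suffice for that:
  with \<open>g s t = (\<Sum>k. G k s * \<eta> k t)\<close>, the \<open>\<eta> k\<close> having disjoint supports, the sum of the
  smooth \<open>G k\<close> can have a kink at \<open>x\<close> while the sum of their second derivatives vanishes
  near \<open>x\<close>.\<close>

definition integrable_near :: "real \<Rightarrow> (real \<Rightarrow> real \<Rightarrow> real) \<Rightarrow> bool" where
  "integrable_near x F \<longleftrightarrow>
     (\<exists>\<delta>>0. set_integrable lborel ({x - \<delta>..x + \<delta>} \<times> UNIV) (\<lambda>(s, t). F s t))"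

definition m2 :: "(real \<Rightarrow> real) \<Rightarrow> (real \<Rightarrow> real \<Rightarrow> real) \<Rightarrow> real \<Rightarrow> real" where
  "m2 K g x = 1 / (2 * marg_dens g x)
     * ((\<integral>t. t * ds (ds g) x t \<partial>lborel) - cond_mean g x * (\<integral>t. ds (ds g) x t \<partial>lborel))
     * (\<integral>z. z\<^sup>2 * K z \<partial>lborel)"

definition Z :: "(real \<Rightarrow> real) \<Rightarrow> (nat \<Rightarrow> real) \<Rightarrow> (nat \<Rightarrow> 'a \<Rightarrow> real) \<Rightarrow> real \<Rightarrow> nat \<Rightarrow> 'a \<Rightarrow> real"
  where "Z K h X x n \<omega> = inverse (h n) * K ((x - X n \<omega>) / h n)"

definition W :: "(real \<Rightarrow> real) \<Rightarrow> (nat \<Rightarrow> real) \<Rightarrow> (nat \<Rightarrow> 'a \<Rightarrow> real) \<Rightarrow> (nat \<Rightarrow> 'a \<Rightarrow> real) \<Rightarrow>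
    real \<Rightarrow> nat \<Rightarrow> 'a \<Rightarrow> real"
  where "W K h X Y x n \<omega> = inverse (h n) * Y n \<omega> * K ((x - X n \<omega>) / h n)"

primrec revesz :: "(real \<Rightarrow> real) \<Rightarrow> (nat \<Rightarrow> real) \<Rightarrow> (nat \<Rightarrow> real) \<Rightarrow> (real \<Rightarrow> real) \<Rightarrow>
    (nat \<Rightarrow> 'a \<Rightarrow> real) \<Rightarrow> (nat \<Rightarrow> 'a \<Rightarrow> real) \<Rightarrow> real \<Rightarrow> nat \<Rightarrow> 'a \<Rightarrow> real" where
  "revesz K h \<gamma> r0 X Y x 0 \<omega> = r0 x"
| "revesz K h \<gamma> r0 X Y x (Suc n) \<omega> = revesz K h \<gamma> r0 X Y x n \<omega>
     + \<gamma> (Suc n) * (W K h X Y x (Suc n) \<omega> - Z K h X x (Suc n) \<omega> * revesz K h \<gamma> r0 X Y x n \<omega>)"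

definition avg_revesz :: "(real \<Rightarrow> real) \<Rightarrow> (nat \<Rightarrow> real) \<Rightarrow> (nat \<Rightarrow> real) \<Rightarrow> (nat \<Rightarrow> real) \<Rightarrow>
    (real \<Rightarrow> real) \<Rightarrow> (nat \<Rightarrow> 'a \<Rightarrow> real) \<Rightarrow> (nat \<Rightarrow> 'a \<Rightarrow> real) \<Rightarrow> real \<Rightarrow> nat \<Rightarrow> 'a \<Rightarrow> real" where
  "avg_revesz K h \<gamma> w r0 X Y x n \<omega> =
     1 / (\<Sum>k=1..n. w k) * (\<Sum>k=1..n. w k * revesz K h \<gamma> r0 X Y x k \<omega>)"

definition conv_in_distribution :: "'a measure \<Rightarrow> (nat \<Rightarrow> 'a \<Rightarrow> real) \<Rightarrow> real measure \<Rightarrow> bool" where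
  "conv_in_distribution M U \<nu> \<longleftrightarrow> weak_conv_m (\<lambda>n. distr M borel (U n)) \<nu>"

definition conv_in_probability :: "'a measure \<Rightarrow> (nat \<Rightarrow> 'a \<Rightarrow> real) \<Rightarrow> real \<Rightarrow> bool" where
  "conv_in_probability M U c \<longleftrightarrow>
     (\<forall>\<epsilon>>0. (\<lambda>n. measure M {\<omega> \<in> space M. \<bar>U n \<omega> - c\<bar> > \<epsilon>}) \<longlonglongrightarrow> 0)"

text \<open>Parametrised by the variance; the degenerate case is the point mass.\<close>

definition gaussian :: "real \<Rightarrow> real \<Rightarrow> real measure" where
  "gaussian \<mu> v =
     (if v = 0 then return borel \<mu> else density lborel (\<lambda>t. ennreal (normal_density \<mu> (sqrt v) t)))"

end

theory Submission
  imports Defs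
begin

text \<open>
  Write \<open>\<Delta> n\<close> for the error \<open>r\<^sub>n(x) - r(x)\<close> of the unaveraged estimator, \<open>V n\<close> for \<open>W\<^sub>n(x) - r(x) Z\<^sub>n(x)\<close>
  and \<open>f\<close> for the density of \<open>X\<close> at \<open>x\<close>. The pairs \<open>(Z n, V n)\<close> are independent, \<open>Z n\<close> has mean close to
  \<open>f\<close>, and the recursion is \<open>\<Delta> n = (1 - \<gamma> n * Z n) * \<Delta> (n - 1) + \<gamma> n * V n\<close>. Solving it for \<open>f * \<Delta> k\<close> gives
  \<open>f * \<Delta> k = V k + (1 / \<gamma> k - f) * (\<Delta> (k - 1) - \<Delta> k) + (f - Z k) * \<Delta> (k - 1)\<close>,
  so that the weighted average of the errors is, up to the factor \<open>f\<close>, the weighted average of the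
  independent variables \<open>V k\<close> plus a remainder.

  The average of the \<open>V k\<close> is responsible for the limits. Its mean is a weighted average of the smoothing
  biases, which are equivalent to \<open>(h k)\<^sup>2 * f * m2\<close>; its variance is a weighted average of terms
  equivalent to a multiple of \<open>1 / h k\<close>; and it is asymptotically normal by Lyapunov's theorem. The
  constants \<open>(1 - q) / (1 - q - 2 * a)\<close> and \<open>(1 - q)\<^sup>2 / (1 + a - 2 * q)\<close> come from one summation
  lemma for regularly varying sequences, \<open>GS_sum\<close>: the sum of \<open>v\<close> up to \<open>n\<close> is equivalent to
  \<open>n * v n / (1 + c)\<close> if \<open>v\<close> belongs to \<open>GS c\<close> and \<open>c > -1\<close>.

  The remainder is negligible in \<open>L\<^sup>1\<close> compared with \<open>1 / sqrt (n * h n) + (h n)\<^sup>2\<close>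
  (\<open>remainder_negligible\<close>). All that is used about \<open>\<Delta>\<close> is the bound of order
  \<open>\<gamma> n / h n + h n ^ 4\<close> for its second moment (\<open>second_moment_\<Delta>_bound\<close>), obtained by squaring the
  recursion. The telescoping part is summed by parts, and the slow variation of the weights
  \<open>w k / \<gamma> k\<close> gains a factor \<open>1 / (n * \<gamma> n)\<close>, which tends to \<open>0\<close>. In \<open>(f - Z k) * \<Delta> (k - 1)\<close> the
  deviation of \<open>f\<close> from the mean of \<open>Z k\<close> is of order \<open>(h k)\<^sup>2\<close> and meets a factor \<open>\<Delta> (k - 1)\<close> that tends to
  \<open>0\<close>, and what is left are martingale increments, whose second moments add up.

  Convergence in \<open>L\<^sup>1\<close> of the remainder passes to convergence in distribution through characteristic
  functions and to convergence in probability through Markov's inequality. The moments of \<open>Z n\<close> and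
  \<open>V n\<close> are convolutions of powers of the kernel with \<open>s \<mapsto> \<integral>t. \<psi> t * g s t\<close>
  (\<open>kernel_expectation\<close>); a Taylor expansion of these functions at \<open>x\<close> under the integral sign
  (\<open>second_order_expansion\<close>) gives the bias.
\<close>

section \<open>Regularly varying sequences\<close>

lemma GS_pos: "v \<in> GS c \<Longrightarrow> 1 \<le> n \<Longrightarrow> 0 < v n"
  by (simp add: GS_def)

lemma GS_limit: "v \<in> GS c \<Longrightarrow> (\<lambda>n. real n * (1 - v (n - 1) / v n)) \<longlonglongrightarrow> c"
  by (simp add: GS_def)

lemma GS_ratio:
  assumes "v \<in> GS c"
  shows "(\<lambda>n. v (n - 1) / v n) \<longlonglongrightarrow> 1"
proof -
  have "(\<lambda>n. 1 - inverse (real n) * (real n * (1 - v (n - 1) / v n))) \<longlonglongrightarrow> 1 - 0 * c"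
    by (intro tendsto_intros GS_limit[OF assms] lim_inverse_n)
  moreover have "eventually (\<lambda>n. 1 - inverse (real n) * (real n * (1 - v (n - 1) / v n))
      = v (n - 1) / v n) sequentially"
    using eventually_gt_at_top[of 0] by eventually_elim (simp add: field_simps)
  ultimately show ?thesis
    by (simp add: tendsto_cong)
qed

lemma GS_mult:
  assumes u: "u \<in> GS c" and v: "v \<in> GS d"
  shows "(\<lambda>n. u n * v n) \<in> GS (c + d)"
proof -
  have "(\<lambda>n. real n * (1 - u (n - 1) / u n) + u (n - 1) / u n * (real n * (1 - v (n - 1) / v n)))
      \<longlonglongrightarrow> c + 1 * d"
    by (intro tendsto_intros GS_limit[OF u] GS_limit[OF v] GS_ratio[OF u])
  then show ?thesis
    using u v by (simp add: GS_def algebra_simps)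
qed

lemma GS_inverse:
  assumes v: "v \<in> GS c"
  shows "(\<lambda>n. inverse (v n)) \<in> GS (- c)"
proof -
  have "(\<lambda>n. - (real n * (1 - v (n - 1) / v n)) / (v (n - 1) / v n)) \<longlonglongrightarrow> - c / 1"
    by (intro tendsto_intros GS_limit[OF v] GS_ratio[OF v]) simp_all
  moreover have "eventually (\<lambda>n. - (real n * (1 - v (n - 1) / v n)) / (v (n - 1) / v n)
      = real n * (1 - inverse (v (n - 1)) / inverse (v n))) sequentially"
    using eventually_ge_at_top[of 2]
  proof eventually_elim
    case (elim n)
    then have "v n > 0" "v (n - 1) > 0"
      using GS_pos[OF v] by auto
    then show ?case
      by (simp add: field_simps)
  qed
  ultimately show ?thesis
    using v by (simp add: GS_def tendsto_cong)
qed

lemma GS_divide: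
  assumes "u \<in> GS c" "v \<in> GS d"
  shows "(\<lambda>n. u n / v n) \<in> GS (c - d)"
  using GS_mult[OF assms(1) GS_inverse[OF assms(2)]] by (simp add: divide_inverse)

lemma GS_power2:
  assumes "v \<in> GS c"
  shows "(\<lambda>n. (v n)\<^sup>2) \<in> GS (2 * c)"
  using GS_mult[OF assms assms] by (simp add: power2_eq_square)

lemma GS_sqrt:
  assumes v: "v \<in> GS c"
  shows "(\<lambda>n. sqrt (v n)) \<in> GS (c / 2)"
proof -
  have "(\<lambda>n. real n * (1 - v (n - 1) / v n) / (1 + sqrt (v (n - 1) / v n))) \<longlonglongrightarrow> c / (1 + sqrt 1)"
    by (intro tendsto_intros GS_limit[OF v] GS_ratio[OF v]) simp_all
  moreover have "eventually (\<lambda>n. real n * (1 - v (n - 1) / v n) / (1 + sqrt (v (n - 1) / v n))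
      = real n * (1 - sqrt (v (n - 1)) / sqrt (v n))) sequentially"
    using eventually_ge_at_top[of 2]
  proof eventually_elim
    case (elim n)
    define y where "y = sqrt (v (n - 1) / v n)"
    from elim have "v n > 0" "v (n - 1) > 0"
      using GS_pos[OF v] by auto
    then have "y > 0" and y2: "v (n - 1) / v n = y\<^sup>2"
      by (auto simp: y_def)
    have "(1 - y\<^sup>2) / (1 + y) = 1 - y"
      using \<open>y > 0\<close> by (simp add: field_simps power2_eq_square)
    moreover have "sqrt (v (n - 1)) / sqrt (v n) = y" "sqrt (v (n - 1) / v n) = y"
      by (simp_all add: y_def real_sqrt_divide)
    ultimately show ?case
      unfolding y2 by (simp add: times_divide_eq_right[symmetric] del: times_divide_eq_right)
  qed
  ultimately show ?thesis
    using v by (simp add: GS_def tendsto_cong)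
qed

lemma GS_real: "real \<in> GS 1"
proof -
  have "eventually (\<lambda>n. real n * (1 - real (n - 1) / real n) = 1) sequentially"
    using eventually_gt_at_top[of 0] by eventually_elim (simp add: field_simps of_nat_diff)
  then show ?thesis
    by (simp add: GS_def tendsto_eventually)
qed

text \<open>The increments satisfy \<open>v n - v (n - 1) \<ge> (c / 2) * v n / n\<close> eventually, so that \<open>v\<close>
  dominates a multiple of the harmonic series.\<close>

lemma GS_tendsto_infinity:
  assumes v: "v \<in> GS c" and "0 < c"
  shows "filterlim v at_top sequentially"
proof -
  have "eventually (\<lambda>n. c / 2 < real n * (1 - v (n - 1) / v n)) sequentially"
    using GS_limit[OF v] \<open>0 < c\<close> by (intro order_tendstoD) auto
  then obtain N where N: "\<And>n. n \<ge> N \<Longrightarrow> c / 2 < real n * (1 - v (n - 1) / v n)"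
    by (auto simp: eventually_sequentially)
  define m where "m = max N 1"
  have increment: "v (n - 1) + (c / 2) * v n / real n \<le> v n" if "n > m" for n
  proof -
    from that have "v n > 0" "n \<ge> N" "n \<ge> 1" "real n > 0"
      using GS_pos[OF v] by (auto simp: m_def)
    then have "c / 2 / real n * v n \<le> (1 - v (n - 1) / v n) * v n"
      using N[of n] by (intro mult_right_mono) (auto simp: field_simps)
    then show ?thesis
      using \<open>v n > 0\<close> by (simp add: left_diff_distrib)
  qed
  have "v m > 0"
    using GS_pos[OF v] by (simp add: m_def)
  have low: "v m + (c / 2) * v m * (harm n - harm m) \<le> v n \<and> v m \<le> v n" if "m \<le> n" for n
    using that
  proof (induction n rule: dec_induct)
    case (step n)
    have "v (Suc n) > 0"
      using GS_pos[OF v] by simp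
    have st: "v n + (c / 2) * v (Suc n) / real (Suc n) \<le> v (Suc n)"
      using increment[of "Suc n"] step by simp
    moreover have "0 \<le> (c / 2) * v (Suc n) / real (Suc n)"
      using \<open>0 < c\<close> \<open>v (Suc n) > 0\<close> by (intro divide_nonneg_nonneg mult_nonneg_nonneg) auto
    ultimately have "v m \<le> v (Suc n)"
      using step by linarith
    then have "(c / 2) * v m / real (Suc n) \<le> (c / 2) * v (Suc n) / real (Suc n)"
      using \<open>0 < c\<close> by (intro divide_right_mono mult_left_mono) auto
    moreover have "(c / 2) * v m * (harm (Suc n) - harm m)
        = (c / 2) * v m * (harm n - harm m) + (c / 2) * v m / real (Suc n)"
      by (simp add: harm_Suc inverse_eq_divide field_simps)
    ultimately show ?case
      using st step.IH \<open>v m \<le> v (Suc n)\<close> by linarith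
  qed simp
  have "filterlim (\<lambda>n. v m + (c / 2) * v m * (- harm m + harm n)) at_top sequentially"
    using \<open>0 < c\<close> \<open>v m > 0\<close>
    by (intro filterlim_tendsto_add_at_top[OF tendsto_const]
        filterlim_tendsto_pos_mult_at_top[OF tendsto_const] harm_at_top) auto
  then show ?thesis
    by (rule filterlim_at_top_mono)
       (rule eventually_mono[OF eventually_ge_at_top[of m]], use low in \<open>simp add: algebra_simps\<close>)
qed

lemma GS_tendsto_zero:
  assumes v: "v \<in> GS c" and "c < 0"
  shows "v \<longlonglongrightarrow> 0"
proof -
  have "filterlim (\<lambda>n. inverse (v n)) at_top sequentially"
    using GS_tendsto_infinity[OF GS_inverse[OF v]] assms by simp
  from tendsto_inverse_0_at_top[OF this] show ?thesis
    by simp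
qed

text \<open>For the summation by parts and for the recursion of the second moments only this relative
  variation of order \<open>1 / n\<close> matters.\<close>

lemma GS_bounded_increments:
  assumes v: "v \<in> GS c"
  obtains A where "A \<ge> 0" "\<And>n. n \<ge> 1 \<Longrightarrow> \<bar>v n - v (n - 1)\<bar> \<le> A * (v n / real n)"
proof -
  from GS_limit[OF v] have "Bseq (\<lambda>n. real n * (1 - v (n - 1) / v n))"
    by (rule convergent_imp_Bseq[OF convergentI])
  then obtain A where A: "A > 0" "\<And>n. \<bar>real n * (1 - v (n - 1) / v n)\<bar> \<le> A"
    by (auto simp: Bseq_def)
  have "\<bar>v n - v (n - 1)\<bar> \<le> A * (v n / real n)" if "n \<ge> 1" for n
  proof -
    have "v n > 0"
      using GS_pos[OF v that] .
    then have "v n - v (n - 1) = (v n / real n) * (real n * (1 - v (n - 1) / v n))"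
      using that by (simp add: field_simps)
    also have "\<bar>\<dots>\<bar> = (v n / real n) * \<bar>real n * (1 - v (n - 1) / v n)\<bar>"
      using \<open>v n > 0\<close> by (simp add: abs_mult)
    also have "\<dots> \<le> (v n / real n) * A"
      using \<open>v n > 0\<close> A(2)[of n] by (intro mult_left_mono) auto
    finally show ?thesis
      by (simp add: mult.commute)
  qed
  with A(1) show ?thesis
    by (intro that[of A]) auto
qed

text \<open>With \<open>b k = B k - B (k - 1)\<close>, the inequality \<open>\<bar>t k - l * b k\<bar> \<le> e * b k\<close> fails for finitely many
  \<open>k\<close> only; these contribute a constant to the sum of the \<open>t k - l * b k\<close>, and the others at most
  \<open>e * B n\<close> up to a constant.\<close>

lemma stolz_cesaro:
  fixes B t :: "nat \<Rightarrow> real"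
  assumes B: "filterlim B at_top sequentially"
    and incr: "eventually (\<lambda>n. B (n - 1) < B n) sequentially"
    and lim: "(\<lambda>n. t n / (B n - B (n - 1))) \<longlonglongrightarrow> l"
  shows "(\<lambda>n. (\<Sum>k=1..n. t k) / B n) \<longlonglongrightarrow> l"
proof (rule LIMSEQ_I)
  fix e :: real
  assume "0 < e"
  define e' where "e' = e / 2"
  have "e' > 0"
    using \<open>0 < e\<close> by (simp add: e'_def)
  have "eventually (\<lambda>n. \<bar>t n / (B n - B (n - 1)) - l\<bar> < e') sequentially"
    using tendstoD[OF lim \<open>e' > 0\<close>] by (simp add: dist_real_def)
  with incr have "eventually (\<lambda>n. \<bar>t n - l * (B n - B (n - 1))\<bar> \<le> e' * (B n - B (n - 1))) sequentially"
  proof eventually_elim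
    case (elim n)
    define d where "d = B n - B (n - 1)"
    have "d > 0"
      using elim by (simp add: d_def)
    have "t n - l * d = d * (t n / d - l)"
      using \<open>d > 0\<close> by (simp add: field_simps)
    then have "\<bar>t n - l * d\<bar> = d * \<bar>t n / d - l\<bar>"
      using \<open>d > 0\<close> by (simp add: abs_mult)
    also have "\<dots> \<le> d * e'"
      using elim(2) \<open>d > 0\<close> by (intro mult_left_mono) (auto simp: d_def)
    finally show ?case
      by (simp add: d_def mult.commute)
  qed
  then obtain N where N: "\<And>n. n \<ge> N \<Longrightarrow> \<bar>t n - l * (B n - B (n - 1))\<bar> \<le> e' * (B n - B (n - 1))"
    by (auto simp: eventually_sequentially)
  define D where "D = \<bar>(\<Sum>k=1..N. t k) - l * B N\<bar> - e' * B N"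
  have main: "\<bar>(\<Sum>k=1..n. t k) - l * B n\<bar> \<le> D + e' * B n" if "N \<le> n" for n
    using that
  proof (induction n rule: dec_induct)
    case (step n)
    have "(\<Sum>k=1..Suc n. t k) - l * B (Suc n)
        = ((\<Sum>k=1..n. t k) - l * B n) + (t (Suc n) - l * (B (Suc n) - B n))"
      by (simp add: algebra_simps)
    also have "\<bar>\<dots>\<bar> \<le> (D + e' * B n) + e' * (B (Suc n) - B n)"
      using step.IH N[of "Suc n"] step.hyps by (intro order_trans[OF abs_triangle_ineq] add_mono) auto
    finally show ?case
      by (simp add: algebra_simps)
  qed (simp add: D_def)
  have "eventually (\<lambda>n. max 1 (2 * \<bar>D\<bar> / e' + 1) \<le> B n) sequentially"
    using B unfolding filterlim_at_top by blast
  then have "eventually (\<lambda>n. \<bar>(\<Sum>k=1..n. t k) / B n - l\<bar> < e) sequentially"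
    using eventually_ge_at_top[of N]
  proof eventually_elim
    case (elim n)
    then have "B n \<ge> 1" "2 * \<bar>D\<bar> / e' < B n"
      by auto
    have "\<bar>(\<Sum>k=1..n. t k) / B n - l\<bar> = \<bar>(\<Sum>k=1..n. t k) - l * B n\<bar> / B n"
      using \<open>B n \<ge> 1\<close> by (subst abs_div_pos) (auto simp: diff_divide_distrib)
    also have "\<dots> \<le> (D + e' * B n) / B n"
      using main[OF elim(2)] \<open>B n \<ge> 1\<close> by (intro divide_right_mono) auto
    also have "\<dots> < e"
      using \<open>2 * \<bar>D\<bar> / e' < B n\<close> \<open>B n \<ge> 1\<close> \<open>e' > 0\<close> \<open>0 < e\<close> by (simp add: field_simps e'_def)
    finally show ?case .
  qed
  then show "\<exists>no. \<forall>n\<ge>no. norm ((\<Sum>k=1..n. t k) / B n - l) < e"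
    by (simp add: eventually_sequentially)
qed

text \<open>The sequence \<open>n * v n\<close> lies in \<open>GS (1 + c)\<close>, so that its increments are equivalent to
  \<open>(1 + c) * v n\<close>; the lemma of Stolz and Cesaro compares them with the summands.\<close>

lemma GS_sum:
  assumes v: "v \<in> GS c" and "-1 < c" and b: "b \<longlonglongrightarrow> l"
  shows "(\<lambda>n. (\<Sum>k=1..n. v k * b k) / (real n * v n)) \<longlonglongrightarrow> l / (1 + c)"
proof (rule stolz_cesaro)
  define B where "B = (\<lambda>n. real n * v n)"
  have GS: "B \<in> GS (1 + c)"
    unfolding B_def by (intro GS_mult GS_real v)
  show "filterlim (\<lambda>n. real n * v n) at_top sequentially"
    using GS_tendsto_infinity[OF GS] \<open>-1 < c\<close> by (simp add: B_def)
  have lim: "(\<lambda>n. real n * (1 - B (n - 1) / B n)) \<longlonglongrightarrow> 1 + c"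
    by (rule GS_limit[OF GS])
  have incr: "B n - B (n - 1) = v n * (real n * (1 - B (n - 1) / B n))" if "n \<ge> 1" for n
    using that GS_pos[OF v that] by (simp add: B_def field_simps)
  have "eventually (\<lambda>n. 0 < real n * (1 - B (n - 1) / B n)) sequentially"
    using lim \<open>-1 < c\<close> by (intro order_tendstoD) auto
  then have "eventually (\<lambda>n. B (n - 1) < B n) sequentially"
    using eventually_ge_at_top[of 1]
  proof eventually_elim
    case (elim n)
    then have "0 < B n - B (n - 1)"
      using GS_pos[OF v, of n] by (subst incr) auto
    then show ?case
      by simp
  qed
  then show "eventually (\<lambda>n. real (n - 1) * v (n - 1) < real n * v n) sequentially"
    by (simp add: B_def)
  have "(\<lambda>n. b n / (real n * (1 - B (n - 1) / B n))) \<longlonglongrightarrow> l / (1 + c)"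
    using \<open>-1 < c\<close> by (intro tendsto_intros b lim) auto
  moreover have "eventually (\<lambda>n. b n / (real n * (1 - B (n - 1) / B n))
      = v n * b n / (B n - B (n - 1))) sequentially"
    using eventually_ge_at_top[of 1]
  proof eventually_elim
    case (elim n)
    then show ?case
      using GS_pos[OF v, of n] by (subst incr) auto
  qed
  ultimately show "(\<lambda>n. v n * b n / (real n * v n - real (n - 1) * v (n - 1))) \<longlonglongrightarrow> l / (1 + c)"
    by (simp add: B_def tendsto_cong)
qed

text \<open>The sums of \<open>w * v\<close> and of \<open>w\<close> are both evaluated by the previous lemma, and the factors
  \<open>n * w n\<close> cancel.\<close>

lemma GS_weighted_average:
  assumes w: "w \<in> GS (- q)" and "q < 1" and v: "v \<in> GS c" and "q < 1 + c" and b: "b \<longlonglongrightarrow> l"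
  shows "(\<lambda>n. (\<Sum>k=1..n. w k * v k * b k) / ((\<Sum>k=1..n. w k) * v n)) \<longlonglongrightarrow> l * ((1 - q) / (1 - q + c))"
proof -
  have 1: "(\<lambda>n. (\<Sum>k=1..n. w k * v k * b k) / (real n * (w n * v n))) \<longlonglongrightarrow> l / (1 + (- q + c))"
    using assms by (intro GS_sum GS_mult) auto
  have 2: "(\<lambda>n. (\<Sum>k=1..n. w k * 1) / (real n * w n)) \<longlonglongrightarrow> 1 / (1 + - q)"
    using assms by (intro GS_sum) auto
  have "(\<lambda>n. ((\<Sum>k=1..n. w k * v k * b k) / (real n * (w n * v n))) / ((\<Sum>k=1..n. w k * 1) / (real n * w n)))
     \<longlonglongrightarrow> (l / (1 + (- q + c))) / (1 / (1 + - q))"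
    using \<open>q < 1\<close> by (intro tendsto_intros 1 2) auto
  moreover have "eventually (\<lambda>n. ((\<Sum>k=1..n. w k * v k * b k) / (real n * (w n * v n))) / ((\<Sum>k=1..n. w k * 1) / (real n * w n))
     = (\<Sum>k=1..n. w k * v k * b k) / ((\<Sum>k=1..n. w k) * v n)) sequentially"
    using eventually_ge_at_top[of 1]
  proof eventually_elim
    case (elim n)
    have "w n \<noteq> 0" "v n \<noteq> 0"
      using GS_pos[OF w elim] GS_pos[OF v elim] by auto
    with elim show ?case
      by (simp add: field_simps)
  qed
  ultimately have "(\<lambda>n. (\<Sum>k=1..n. w k * v k * b k) / ((\<Sum>k=1..n. w k) * v n))
      \<longlonglongrightarrow> (l / (1 + (- q + c))) / (1 / (1 + - q))"
    by (rule Lim_transform_eventually)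
  moreover have "(l / (1 + (- q + c))) / (1 / (1 + - q)) = l * ((1 - q) / (1 - q + c))"
    by (simp add: algebra_simps)
  ultimately show ?thesis
    by (rule tendsto_eq_rhs)
qed

section \<open>Central limit theorem and Slutsky's lemma through characteristic functions\<close>

lemmas integrable_arith = Bochner_Integration.integrable_add Bochner_Integration.integrable_diff
  Bochner_Integration.integrable_sum integrable_mult_right integrable_divide integrable_abs

abbreviation (in prob_space) mean_abs :: "('a \<Rightarrow> real) \<Rightarrow> real" where
  "mean_abs U \<equiv> expectation (\<lambda>\<omega>. \<bar>U \<omega>\<bar>)"

abbreviation (in prob_space) mean_square :: "('a \<Rightarrow> real) \<Rightarrow> real" where
  "mean_square U \<equiv> expectation (\<lambda>\<omega>. (U \<omega>)\<^sup>2)"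

abbreviation (in prob_space) mean_cube :: "('a \<Rightarrow> real) \<Rightarrow> real" where
  "mean_cube U \<equiv> expectation (\<lambda>\<omega>. \<bar>U \<omega>\<bar> ^ 3)"

lemma abs_le_one_plus_square: "\<bar>y\<bar> \<le> 1 + y\<^sup>2" for y :: real
proof -
  have "0 \<le> (\<bar>y\<bar> - 1 / 2)\<^sup>2"
    by simp
  then have "\<bar>y\<bar> \<le> \<bar>y\<bar>\<^sup>2 + 1 / 4"
    by (simp add: power2_diff power_divide)
  then show ?thesis
    by simp
qed

text \<open>Up to a constant, Lyapunov's inequality \<open>\<sigma>^3 \<le> E \<bar>U\<bar>^3\<close> for \<open>\<sigma> = sqrt s\<close>: the bound
  \<open>u\<^sup>2 \<le> d\<^sup>2 + \<bar>u\<bar>^3 / d\<close> is integrated with \<open>d = \<sigma> / 2\<close>.\<close>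

lemma (in prob_space) square_of_second_moment_le:
  fixes U :: "'a \<Rightarrow> real"
  assumes [measurable]: "U \<in> borel_measurable M"
    and int2: "integrable M (\<lambda>\<omega>. (U \<omega>)\<^sup>2)" and int3: "integrable M (\<lambda>\<omega>. \<bar>U \<omega>\<bar> ^ 3)"
  defines "s \<equiv> mean_square U"
  shows "s\<^sup>2 \<le> 3 * (1 + s) * mean_cube U"
proof (cases "s = 0")
  case False
  have "s \<ge> 0"
    by (auto simp: s_def)
  with False have "s > 0"
    by simp
  define d where "d = sqrt s / 2"
  have "d > 0"
    using \<open>s > 0\<close> by (simp add: d_def)
  have pw: "u\<^sup>2 \<le> d\<^sup>2 + \<bar>u\<bar> ^ 3 / d" for u :: real
  proof (cases "\<bar>u\<bar> \<le> d")
    case True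
    then have "\<bar>u\<bar>\<^sup>2 \<le> d\<^sup>2"
      by (intro power_mono) auto
    then show ?thesis
      using \<open>d > 0\<close> by (simp add: add_increasing2)
  next
    case False
    then have "\<bar>u\<bar>\<^sup>2 * d \<le> \<bar>u\<bar>\<^sup>2 * \<bar>u\<bar>"
      by (intro mult_left_mono) auto
    then have "u\<^sup>2 \<le> \<bar>u\<bar> ^ 3 / d"
      using \<open>d > 0\<close> by (simp add: field_simps power3_eq_cube power2_eq_square)
    then show ?thesis
      by (simp add: add_increasing)
  qed
  have "s \<le> expectation (\<lambda>\<omega>. d\<^sup>2 + \<bar>U \<omega>\<bar> ^ 3 / d)"
    unfolding s_def using pw by (intro integral_mono int2 integrable_arith int3) auto
  also have "\<dots> = d\<^sup>2 + mean_cube U / d"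
    using int3 by (simp add: prob_space)
  finally have "(3 / 4) * s * d \<le> mean_cube U"
    using \<open>d > 0\<close> \<open>s > 0\<close> by (simp add: d_def power_divide field_simps)
  moreover have "s\<^sup>2 \<le> 3 * (1 + s) * ((3 / 4) * s * d)"
  proof -
    have s: "s = (sqrt s)\<^sup>2"
      using \<open>s > 0\<close> by simp
    have "s \<le> (1 + s) * sqrt s"
    proof -
      have "sqrt s \<le> 1 + s"
        using abs_le_one_plus_square[of "sqrt s"] \<open>s > 0\<close> by simp
      then have "sqrt s * sqrt s \<le> (1 + s) * sqrt s"
        using \<open>s > 0\<close> by (intro mult_right_mono) auto
      then show ?thesis
        using \<open>s > 0\<close> by simp
    qed
    then have "s * s \<le> ((1 + s) * sqrt s) * s"
      using \<open>s > 0\<close> by (intro mult_right_mono) auto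
    also have "\<dots> \<le> 3 * (1 + s) * ((3 / 4) * s * d)"
      using \<open>s > 0\<close> by (simp add: d_def field_simps)
    finally show ?thesis
      by (simp add: power2_eq_square)
  qed
  moreover have "3 * (1 + s) * ((3 / 4) * s * d) \<le> 3 * (1 + s) * mean_cube U"
    using calculation(1) \<open>s > 0\<close> by (intro mult_left_mono) auto
  ultimately show ?thesis
    by linarith
qed auto

lemma exp_minus_linear_bound:
  fixes y :: real
  assumes "0 \<le> y"
  shows "\<bar>(1 - y) - exp (- y)\<bar> \<le> y\<^sup>2"
proof -
  have "1 + y \<le> exp y" "1 + - y \<le> exp (- y)"
    by (rule exp_ge_add_one_self)+
  then have "exp (- y) \<le> 1 / (1 + y)"
    using assms by (simp add: exp_minus field_simps)
  also have "\<dots> \<le> 1 - y + y\<^sup>2"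
  proof -
    have "(1 - y + y\<^sup>2) * (1 + y) = 1 + y ^ 3"
      by (simp add: power2_eq_square power3_eq_cube algebra_simps)
    moreover have "0 \<le> y ^ 3"
      using assms by simp
    ultimately show ?thesis
      using assms by (subst divide_le_eq) auto
  qed
  finally show ?thesis
    using \<open>1 + - y \<le> exp (- y)\<close> by simp
qed

lemma (in prob_space) integrable_abs_power_mono:
  fixes U :: "'a \<Rightarrow> real"
  assumes [measurable]: "U \<in> borel_measurable M" and "integrable M (\<lambda>\<omega>. \<bar>U \<omega>\<bar> ^ p)" and "k \<le> p"
  shows "integrable M (\<lambda>\<omega>. U \<omega> ^ k)"
proof (rule Bochner_Integration.integrable_bound)
  show "integrable M (\<lambda>\<omega>. 1 + \<bar>U \<omega>\<bar> ^ p)"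
    using assms by simp
  have "\<bar>u\<bar> ^ k \<le> 1 + \<bar>u\<bar> ^ p" for u :: real
  proof (cases "\<bar>u\<bar> \<le> 1")
    case True
    then have "\<bar>u\<bar> ^ k \<le> 1"
      by (simp add: power_le_one)
    then show ?thesis
      by (simp add: add_increasing2)
  next
    case False
    then have "\<bar>u\<bar> ^ k \<le> \<bar>u\<bar> ^ p"
      using \<open>k \<le> p\<close> by (intro power_increasing) auto
    then show ?thesis
      by (simp add: add_increasing)
  qed
  then show "AE \<omega> in M. norm (U \<omega> ^ k) \<le> norm (1 + \<bar>U \<omega>\<bar> ^ p)"
    by (simp add: power_abs)
qed simp

text \<open>Lyapunov's central limit theorem for triangular arrays. Each characteristic function of a summand
  of variance \<open>s\<close> and each \<open>exp (- t\<^sup>2 * s / 2)\<close> is compared with \<open>1 - t\<^sup>2 * s / 2\<close>, and both errors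
  are controlled by the third absolute moment.\<close>

lemma (in prob_space) lyapunov_char:
  fixes \<xi> :: "nat \<Rightarrow> nat \<Rightarrow> 'a \<Rightarrow> real"
  assumes indep: "\<And>n. indep_vars (\<lambda>_. borel) (\<xi> n) {1..n}"
    and int3: "\<And>n k. k \<in> {1..n} \<Longrightarrow> integrable M (\<lambda>\<omega>. \<bar>\<xi> n k \<omega>\<bar> ^ 3)"
    and mean: "\<And>n k. k \<in> {1..n} \<Longrightarrow> expectation (\<xi> n k) = 0"
    and var: "(\<lambda>n. \<Sum>k=1..n. mean_square (\<xi> n k)) \<longlonglongrightarrow> v"
    and third: "(\<lambda>n. \<Sum>k=1..n. mean_cube (\<xi> n k)) \<longlonglongrightarrow> 0"
  shows "(\<lambda>n. char (distr M borel (\<lambda>\<omega>. \<Sum>k=1..n. \<xi> n k \<omega>)) t) \<longlonglongrightarrow> complex_of_real (exp (- (t\<^sup>2 * v / 2)))"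
proof -
  define s where "s n k = mean_square (\<xi> n k)" for n k
  define m where "m n k = mean_cube (\<xi> n k)" for n k
  define S where "S n = (\<Sum>k=1..n. s n k)" for n
  define L where "L n = (\<Sum>k=1..n. m n k)" for n
  have S: "S \<longlonglongrightarrow> v" and L: "L \<longlonglongrightarrow> 0"
    using var third by (simp_all add: S_def[abs_def] L_def[abs_def] s_def m_def)
  have s_nonneg: "0 \<le> s n k" and m_nonneg: "0 \<le> m n k" for n k
    by (auto simp: s_def m_def)
  have term_bound: "cmod (char (distr M borel (\<xi> n k)) t - of_real (exp (- (t\<^sup>2 * s n k / 2))))
      \<le> (\<bar>t\<bar> ^ 3 + t ^ 4 * (1 + S n)) * m n k" if k: "k \<in> {1..n}" for n k
  proof -
    have rv [measurable]: "\<xi> n k \<in> borel_measurable M"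
      using indep[of n] k by (auto simp: indep_vars_def)
    have int: "integrable M (\<lambda>\<omega>. \<xi> n k \<omega> ^ j)" if "j \<le> 3" for j
      using integrable_abs_power_mono[OF rv int3[OF k] that] .
    have int1: "integrable M (\<xi> n k)" and int2: "integrable M (\<lambda>\<omega>. (\<xi> n k \<omega>)\<^sup>2)"
      using int[of 1] int[of 2] by simp_all
    have "cmod (char (distr M borel (\<xi> n k)) t - (1 - t\<^sup>2 * s n k / 2))
      \<le> (t\<^sup>2 / 6) * expectation (\<lambda>\<omega>. min (6 * (\<xi> n k \<omega>)\<^sup>2) (\<bar>t\<bar> * \<bar>\<xi> n k \<omega>\<bar> ^ 3))"
      by (rule char_approx3'[OF rv int1 int2 mean[OF k] _ refl]) (simp add: mean[OF k] s_def)
    also have "expectation (\<lambda>\<omega>. min (6 * (\<xi> n k \<omega>)\<^sup>2) (\<bar>t\<bar> * \<bar>\<xi> n k \<omega>\<bar> ^ 3))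
        \<le> expectation (\<lambda>\<omega>. \<bar>t\<bar> * \<bar>\<xi> n k \<omega>\<bar> ^ 3)"
      by (intro integral_mono integrable_min integrable_mult_right int2 int3[OF k]) auto
    also have "\<dots> = \<bar>t\<bar> * m n k"
      by (simp add: m_def)
    finally have 1: "cmod (char (distr M borel (\<xi> n k)) t - (1 - t\<^sup>2 * s n k / 2))
        \<le> (t\<^sup>2 / 6) * (\<bar>t\<bar> * m n k)"
      by (simp add: mult_left_mono)
    have 1: "cmod (char (distr M borel (\<xi> n k)) t - (1 - t\<^sup>2 * s n k / 2)) \<le> \<bar>t\<bar> ^ 3 * m n k"
    proof -
      have "(t\<^sup>2 / 6) * (\<bar>t\<bar> * m n k) = (\<bar>t\<bar> ^ 3 * m n k) / 6"
        by (simp add: power3_eq_cube power2_eq_square)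
      also have "\<dots> \<le> \<bar>t\<bar> ^ 3 * m n k"
        using m_nonneg[of n k] by simp
      finally show ?thesis
        using 1 by linarith
    qed
    have "(s n k)\<^sup>2 \<le> 3 * (1 + s n k) * m n k"
      unfolding s_def m_def by (rule square_of_second_moment_le[OF rv int2 int3[OF k]])
    also have "\<dots> \<le> 3 * (1 + S n) * m n k"
      using k s_nonneg m_nonneg
      by (intro mult_right_mono mult_left_mono add_left_mono) (auto simp: S_def intro!: member_le_sum)
    finally have sq: "(s n k)\<^sup>2 \<le> 3 * (1 + S n) * m n k" .
    have "cmod (complex_of_real ((1 - t\<^sup>2 * s n k / 2) - exp (- (t\<^sup>2 * s n k / 2)))) \<le> (t\<^sup>2 * s n k / 2)\<^sup>2"
      unfolding norm_of_real by (rule exp_minus_linear_bound) (simp add: s_nonneg)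
    also have "\<dots> = t ^ 4 / 4 * (s n k)\<^sup>2"
      by (simp add: power2_eq_square power4_eq_xxxx)
    also have "\<dots> \<le> t ^ 4 / 4 * (3 * (1 + S n) * m n k)"
      by (intro mult_left_mono sq) auto
    also have "\<dots> \<le> t ^ 4 * (1 + S n) * m n k"
    proof -
      have "0 \<le> t ^ 4 * (1 + S n) * m n k"
        using s_nonneg m_nonneg by (auto simp: S_def intro!: mult_nonneg_nonneg add_nonneg_nonneg sum_nonneg)
      moreover have "t ^ 4 / 4 * (3 * (1 + S n) * m n k) = 3 / 4 * (t ^ 4 * (1 + S n) * m n k)"
        by simp
      ultimately show ?thesis
        by linarith
    qed
    finally have 2: "cmod (complex_of_real ((1 - t\<^sup>2 * s n k / 2) - exp (- (t\<^sup>2 * s n k / 2))))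
        \<le> t ^ 4 * (1 + S n) * m n k" .
    show ?thesis
      using norm_triangle_le[OF add_mono[OF 1 2]] by (simp add: algebra_simps)
  qed
  have "eventually (\<lambda>n. cmod (char (distr M borel (\<lambda>\<omega>. \<Sum>k=1..n. \<xi> n k \<omega>)) t
      - of_real (exp (- (t\<^sup>2 * S n / 2)))) \<le> (\<bar>t\<bar> ^ 3 + t ^ 4 * (1 + S n)) * L n) sequentially"
  proof (rule always_eventually, rule allI)
    fix n
    have "cmod (char (distr M borel (\<lambda>\<omega>. \<Sum>k=1..n. \<xi> n k \<omega>)) t - of_real (exp (- (t\<^sup>2 * S n / 2))))
      = cmod ((\<Prod>k\<in>{1..n}. char (distr M borel (\<xi> n k)) t) - (\<Prod>k\<in>{1..n}. of_real (exp (- (t\<^sup>2 * s n k / 2)))))"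
      unfolding char_distr_sum[OF indep]
      by (simp add: S_def sum_distrib_left sum_divide_distrib flip: exp_sum of_real_prod sum_negf)
    also have "\<dots> \<le> (\<Sum>k\<in>{1..n}. cmod (char (distr M borel (\<xi> n k)) t - of_real (exp (- (t\<^sup>2 * s n k / 2)))))"
    proof (rule norm_prod_diff)
      fix k assume k: "k \<in> {1..n}"
      have "\<xi> n k \<in> borel_measurable M"
        using indep[of n] k by (auto simp: indep_vars_def)
      then show "cmod (char (distr M borel (\<xi> n k)) t) \<le> 1"
        by (intro real_distribution.cmod_char_le_1 real_distribution_distr)
      show "cmod (complex_of_real (exp (- (t\<^sup>2 * s n k / 2)))) \<le> 1"
        using s_nonneg[of n k] by simp
    qed
    also have "\<dots> \<le> (\<Sum>k\<in>{1..n}. (\<bar>t\<bar> ^ 3 + t ^ 4 * (1 + S n)) * m n k)"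
      by (rule sum_mono) (rule term_bound)
    also have "\<dots> = (\<bar>t\<bar> ^ 3 + t ^ 4 * (1 + S n)) * L n"
      by (simp add: L_def sum_distrib_left)
    finally show "cmod (char (distr M borel (\<lambda>\<omega>. \<Sum>k=1..n. \<xi> n k \<omega>)) t
      - of_real (exp (- (t\<^sup>2 * S n / 2)))) \<le> (\<bar>t\<bar> ^ 3 + t ^ 4 * (1 + S n)) * L n" .
  qed
  moreover have "(\<lambda>n. (\<bar>t\<bar> ^ 3 + t ^ 4 * (1 + S n)) * L n) \<longlonglongrightarrow> (\<bar>t\<bar> ^ 3 + t ^ 4 * (1 + v)) * 0"
    by (intro tendsto_intros S L)
  ultimately have "(\<lambda>n. char (distr M borel (\<lambda>\<omega>. \<Sum>k=1..n. \<xi> n k \<omega>)) t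
      - of_real (exp (- (t\<^sup>2 * S n / 2)))) \<longlonglongrightarrow> 0"
    unfolding mult_zero_right by (rule Lim_null_comparison)
  moreover have "(\<lambda>n. complex_of_real (exp (- (t\<^sup>2 * S n / 2)))) \<longlonglongrightarrow> complex_of_real (exp (- (t\<^sup>2 * v / 2)))"
    by (intro tendsto_intros S) auto
  ultimately show ?thesis
    by (rule Lim_transform[rotated])
qed

lemma real_distribution_gaussian: "real_distribution (gaussian \<mu> v)" if "0 \<le> v"
proof (cases "v = 0")
  case True
  then show ?thesis
    by (auto simp: gaussian_def real_distribution_def real_distribution_axioms_def
        intro!: prob_space_return)
next
  case False
  with that show ?thesis
    using prob_space_normal_density[of "sqrt v" \<mu>]
    by (auto simp: gaussian_def real_distribution_def real_distribution_axioms_def)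
qed

lemma char_gaussian:
  assumes "0 \<le> v"
  shows "char (gaussian \<mu> v) t = iexp (t * \<mu>) * complex_of_real (exp (- (t\<^sup>2 * v / 2)))"
proof (cases "v = 0")
  case True
  have "(CLINT x|return borel \<mu>. iexp (t * x)) = iexp (t * \<mu>)"
    by (subst integral_return) auto
  with True show ?thesis
    by (simp add: gaussian_def char_def)
next
  case False
  define \<sigma> where "\<sigma> = sqrt v"
  have "\<sigma> > 0" and v: "v = \<sigma>\<^sup>2"
    using assms False by (simp_all add: \<sigma>_def)
  have dens: "\<sigma> * normal_density \<mu> \<sigma> (\<mu> + \<sigma> * y) = std_normal_density y" for y
    using \<open>\<sigma> > 0\<close> by (simp add: normal_density_def real_sqrt_mult field_simps power_mult_distrib)
  have "char (gaussian \<mu> v) t = (CLINT x|lborel. normal_density \<mu> \<sigma> x *\<^sub>R iexp (t * x))"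
    using False by (simp add: gaussian_def char_def integral_density \<sigma>_def[symmetric] normal_density_nonneg)
  also have "\<dots> = \<bar>\<sigma>\<bar> *\<^sub>R (CLINT y|lborel. normal_density \<mu> \<sigma> (\<mu> + \<sigma> * y) *\<^sub>R iexp (t * (\<mu> + \<sigma> * y)))"
    using \<open>\<sigma> > 0\<close> by (intro lborel_integral_real_affine) simp
  also have "\<dots> = (CLINT y|lborel. std_normal_density y *\<^sub>R (iexp (t * \<mu>) * iexp ((t * \<sigma>) * y)))"
    using \<open>\<sigma> > 0\<close> unfolding dens[symmetric]
    by (simp add: algebra_simps exp_add scaleR_conv_of_real flip: integral_mult_right_zero)
  also have "\<dots> = iexp (t * \<mu>) * (CLINT y|lborel. std_normal_density y *\<^sub>R iexp ((t * \<sigma>) * y))"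
    by (simp flip: integral_mult_right_zero add: scaleR_conv_of_real algebra_simps)
  also have "(CLINT y|lborel. std_normal_density y *\<^sub>R iexp ((t * \<sigma>) * y)) = char std_normal_distribution (t * \<sigma>)"
    by (simp add: char_def integral_density normal_density_nonneg)
  also have "\<dots> = complex_of_real (exp (- (t\<^sup>2 * v / 2)))"
    by (simp add: char_std_normal_distribution v power_mult_distrib)
  finally show ?thesis .
qed

lemma iexp_lipschitz: "cmod (iexp a - iexp b) \<le> \<bar>a - b\<bar>"
proof -
  have "iexp a - iexp b = iexp b * (iexp (a - b) - 1)"
    by (simp add: algebra_simps flip: exp_add)
  then have "cmod (iexp a - iexp b) = cmod (iexp (a - b) - 1)"
    by (simp add: norm_mult)
  also have "\<dots> \<le> \<bar>a - b\<bar>"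
    using iexp_approx1[of "a - b" 0] by simp
  finally show ?thesis .
qed

text \<open>An error that vanishes in \<open>L\<^sup>1\<close> does not change the limit of characteristic functions,
  since \<open>\<lambda>u. iexp (t * u)\<close> is Lipschitz.\<close>

lemma (in prob_space) conv_in_distribution_gaussianI:
  fixes T U :: "nat \<Rightarrow> 'a \<Rightarrow> real"
  assumes T [measurable]: "\<And>n. T n \<in> borel_measurable M" and U [measurable]: "\<And>n. U n \<in> borel_measurable M"
    and "0 \<le> v"
    and T_lim: "\<And>t. (\<lambda>n. char (distr M borel (T n)) t) \<longlonglongrightarrow> complex_of_real (exp (- (t\<^sup>2 * v / 2)))"
    and int: "\<And>n. integrable M (\<lambda>\<omega>. U n \<omega> - T n \<omega>)"
    and err: "(\<lambda>n. expectation (\<lambda>\<omega>. \<bar>U n \<omega> - T n \<omega> - \<mu>\<bar>)) \<longlonglongrightarrow> 0"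
  shows "conv_in_distribution M U (gaussian \<mu> v)"
  unfolding conv_in_distribution_def
proof (rule levy_continuity)
  show "real_distribution (gaussian \<mu> v)"
    by (rule real_distribution_gaussian) fact
  show "real_distribution (distr M borel (U n))" for n
    by (rule real_distribution_distr) fact
  fix t
  have char_eq: "char (distr M borel f) t = (CLINT \<omega>|M. iexp (t * f \<omega>))"
    if [measurable]: "f \<in> borel_measurable M" for f
    by (simp add: char_def integral_distr)
  have int_iexp: "integrable M (\<lambda>\<omega>. iexp (t * f \<omega>))" if [measurable]: "f \<in> borel_measurable M" for f
    by (rule integrable_iexp) auto
  have bound: "cmod (char (distr M borel (U n)) t - iexp (t * \<mu>) * char (distr M borel (T n)) t)
      \<le> \<bar>t\<bar> * expectation (\<lambda>\<omega>. \<bar>U n \<omega> - T n \<omega> - \<mu>\<bar>)" for n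
  proof -
    have "iexp (t * \<mu>) * char (distr M borel (T n)) t = (CLINT \<omega>|M. iexp (t * (T n \<omega> + \<mu>)))"
      by (simp add: char_eq algebra_simps exp_add flip: integral_mult_right_zero)
    then have "char (distr M borel (U n)) t - iexp (t * \<mu>) * char (distr M borel (T n)) t
        = (CLINT \<omega>|M. iexp (t * U n \<omega>) - iexp (t * (T n \<omega> + \<mu>)))"
      by (subst Bochner_Integration.integral_diff) (auto simp: char_eq intro!: int_iexp simp del: of_real_add of_real_mult)
    also have "cmod \<dots> \<le> (\<integral>\<omega>. \<bar>t\<bar> * \<bar>U n \<omega> - T n \<omega> - \<mu>\<bar> \<partial>M)"
    proof (rule order_trans[OF integral_norm_bound integral_mono])
      show "integrable M (\<lambda>\<omega>. cmod (iexp (t * U n \<omega>) - iexp (t * (T n \<omega> + \<mu>))))"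
        by (intro integrable_norm integrable_arith int_iexp) auto
      show "integrable M (\<lambda>\<omega>. \<bar>t\<bar> * \<bar>U n \<omega> - T n \<omega> - \<mu>\<bar>)"
        by (intro integrable_arith int) simp
      show "cmod (iexp (t * U n \<omega>) - iexp (t * (T n \<omega> + \<mu>))) \<le> \<bar>t\<bar> * \<bar>U n \<omega> - T n \<omega> - \<mu>\<bar>" for \<omega>
        using iexp_lipschitz[of "t * U n \<omega>" "t * (T n \<omega> + \<mu>)"]
        by (simp add: abs_mult[symmetric] algebra_simps)
    qed
    finally show ?thesis
      by simp
  qed
  have "(\<lambda>n. char (distr M borel (U n)) t - iexp (t * \<mu>) * char (distr M borel (T n)) t) \<longlonglongrightarrow> 0"
    by (rule Lim_null_comparison[OF always_eventually[OF allI[OF bound]]])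
       (use tendsto_mult_right_zero[OF err] in simp)
  moreover have "(\<lambda>n. iexp (t * \<mu>) * char (distr M borel (T n)) t)
      \<longlonglongrightarrow> iexp (t * \<mu>) * complex_of_real (exp (- (t\<^sup>2 * v / 2)))"
    by (intro tendsto_intros T_lim)
  ultimately show "(\<lambda>n. char (distr M borel (U n)) t) \<longlonglongrightarrow> char (gaussian \<mu> v) t"
    unfolding char_gaussian[OF \<open>0 \<le> v\<close>] by (rule Lim_transform[rotated])
qed

lemma (in prob_space) conv_in_probabilityI:
  fixes U :: "nat \<Rightarrow> 'a \<Rightarrow> real"
  assumes int: "\<And>n. integrable M (U n)"
    and err: "(\<lambda>n. expectation (\<lambda>\<omega>. \<bar>U n \<omega> - c\<bar>)) \<longlonglongrightarrow> 0"
  shows "conv_in_probability M U c"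
  unfolding conv_in_probability_def
proof (intro allI impI)
  fix e :: real assume "0 < e"
  have "prob {\<omega> \<in> space M. \<bar>U n \<omega> - c\<bar> > e} \<le> expectation (\<lambda>\<omega>. \<bar>U n \<omega> - c\<bar>) / e" for n
  proof -
    have [measurable]: "U n \<in> borel_measurable M"
      using int by auto
    have "prob {\<omega> \<in> space M. \<bar>U n \<omega> - c\<bar> > e} \<le> prob {\<omega> \<in> space M. e \<le> \<bar>U n \<omega> - c\<bar>}"
      by (intro finite_measure_mono) auto
    also have "\<dots> \<le> expectation (\<lambda>\<omega>. \<bar>U n \<omega> - c\<bar>) / e"
      using int[of n] \<open>0 < e\<close> by (intro integral_Markov_inequality_measure[where A = "{}"]) auto
    finally show ?thesis .
  qed
  then show "(\<lambda>n. prob {\<omega> \<in> space M. \<bar>U n \<omega> - c\<bar> > e}) \<longlonglongrightarrow> 0"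
    by (intro tendsto_sandwich[OF _ always_eventually[OF allI] tendsto_const tendsto_divide_zero[OF err, of e]])
       auto
qed

section \<open>Sums of products of past and present\<close>

lemma (in prob_space) integrable_mult_of_squares:
  fixes A B :: "'a \<Rightarrow> real"
  assumes [measurable]: "A \<in> borel_measurable M" "B \<in> borel_measurable M"
    and "integrable M (\<lambda>\<omega>. (A \<omega>)\<^sup>2)" "integrable M (\<lambda>\<omega>. (B \<omega>)\<^sup>2)"
  shows "integrable M (\<lambda>\<omega>. A \<omega> * B \<omega>)"
proof (rule Bochner_Integration.integrable_bound)
  show "integrable M (\<lambda>\<omega>. (A \<omega>)\<^sup>2 + (B \<omega>)\<^sup>2)"
    using assms by simp
  have "\<bar>a * b\<bar> \<le> a\<^sup>2 + b\<^sup>2" for a b :: real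
  proof -
    have "0 \<le> (\<bar>a\<bar> - \<bar>b\<bar>)\<^sup>2"
      by simp
    then have "2 * \<bar>a * b\<bar> \<le> a\<^sup>2 + b\<^sup>2"
      by (simp add: power2_diff abs_mult)
    moreover have "0 \<le> \<bar>a * b\<bar>"
      by simp
    ultimately show ?thesis
      by linarith
  qed
  then show "AE \<omega> in M. norm (A \<omega> * B \<omega>) \<le> norm ((A \<omega>)\<^sup>2 + (B \<omega>)\<^sup>2)"
    by simp
qed simp

lemma (in prob_space) abs_expectation_le_sqrt:
  fixes A :: "'a \<Rightarrow> real"
  assumes [measurable]: "A \<in> borel_measurable M" and int2: "integrable M (\<lambda>\<omega>. (A \<omega>)\<^sup>2)"
  shows "mean_abs A \<le> sqrt (mean_square A)"
proof (rule real_le_rsqrt)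
  have int: "integrable M (\<lambda>\<omega>. \<bar>A \<omega>\<bar>)"
    using square_integrable_imp_integrable[OF _ int2] by simp
  have "0 \<le> variance (\<lambda>\<omega>. \<bar>A \<omega>\<bar>)"
    by (rule variance_positive)
  also have "\<dots> = mean_square A - (mean_abs A)\<^sup>2"
    using int int2 by (subst variance_eq) auto
  finally show "(mean_abs A)\<^sup>2 \<le> mean_square A"
    by simp
qed

text \<open>Independence passes to real functions measurable with respect to the generated
  sigma-algebras, without choosing factorisations of them.\<close>

lemma (in prob_space) indep_var_vimage_algebra:
  fixes U W :: "'a \<Rightarrow> real" and P Q :: "'a \<Rightarrow> 'c"
  assumes PQ: "indep_var N P N' Q"
    and U: "U \<in> borel_measurable (vimage_algebra (space M) P N)"
    and W: "W \<in> borel_measurable (vimage_algebra (space M) Q N')"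
  shows "indep_var borel U borel W"
proof -
  have P: "P \<in> measurable M N" and Q: "Q \<in> measurable M N'"
    using PQ by (auto dest: indep_var_rv1 indep_var_rv2)
  have sets: "F -` A \<inter> space M \<in> {R -` B \<inter> space M | B. B \<in> sets L}"
    if F: "F \<in> borel_measurable (vimage_algebra (space M) R L)" and R: "R \<in> measurable M L"
      and "A \<in> sets borel" for F :: "'a \<Rightarrow> real" and R :: "'a \<Rightarrow> 'c" and L and A :: "real set"
    using measurable_sets[OF F \<open>A \<in> sets borel\<close>] measurable_space[OF R]
    by (subst sets_vimage_algebra2[symmetric]) auto
  have rv: "F \<in> borel_measurable M"
    if F: "F \<in> borel_measurable (vimage_algebra (space M) R L)" and R: "R \<in> measurable M L"
    for F :: "'a \<Rightarrow> real" and R :: "'a \<Rightarrow> 'c" and L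
  proof (rule measurableI)
    fix A :: "real set" assume "A \<in> sets borel"
    from sets[OF F R this] R show "F -` A \<inter> space M \<in> events"
      by (auto intro: measurable_sets)
  qed auto
  have subU: "{U -` A \<inter> space M | A. A \<in> sets borel} \<subseteq> {P -` B \<inter> space M | B. B \<in> sets N}"
    and subW: "{W -` A \<inter> space M | A. A \<in> sets borel} \<subseteq> {Q -` B \<inter> space M | B. B \<in> sets N'}"
    using sets[OF U P] sets[OF W Q] by auto
  show ?thesis
    unfolding indep_var_eq
  proof (intro conjI rv[OF U P] rv[OF W Q])
    have "indep_set (sigma_sets (space M) {P -` B \<inter> space M | B. B \<in> sets N})
        (sigma_sets (space M) {Q -` B \<inter> space M | B. B \<in> sets N'})"
      using PQ by (simp add: indep_var_eq)
    then show "indep_set (sigma_sets (space M) {U -` A \<inter> space M |A. A \<in> sets borel})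
        (sigma_sets (space M) {W -` A \<inter> space M |A. A \<in> sets borel})"
      unfolding indep_set_def
      by (rule indep_sets_mono_sets)
         (use sigma_sets_mono'[OF subU] sigma_sets_mono'[OF subW] in \<open>auto split: bool.split\<close>)
  qed
qed

locale independent_pairs = prob_space M for M :: "'a measure" +
  fixes Z V :: "nat \<Rightarrow> 'a \<Rightarrow> real"
  assumes indep: "indep_vars (\<lambda>_. borel) (\<lambda>n \<omega>. (Z n \<omega>, V n \<omega>)) {1..}"
begin

text \<open>The sigma-algebra generated by the pairs of index \<open>1\<close> to \<open>n\<close>, as the pullback under one map
  into a product space, since this is the form in which independence of disjoint blocks is known.\<close>

definition past :: "nat \<Rightarrow> 'a measure" where
  "past n = vimage_algebra (space M) (\<lambda>\<omega>. restrict (\<lambda>i. (Z i \<omega>, V i \<omega>)) {1..n}) (PiM {1..n} (\<lambda>_. borel))"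

lemma space_past [simp]: "space (past n) = space M"
  by (simp add: past_def)

lemma pair_measurable [measurable]: "1 \<le> k \<Longrightarrow> (\<lambda>\<omega>. (Z k \<omega>, V k \<omega>)) \<in> borel_measurable M"
  using indep by (auto simp: indep_vars_def)

lemma Z_measurable [measurable]: "1 \<le> k \<Longrightarrow> Z k \<in> borel_measurable M"
  and V_measurable [measurable]: "1 \<le> k \<Longrightarrow> V k \<in> borel_measurable M"
  using measurable_compose[OF pair_measurable, of k fst borel]
    measurable_compose[OF pair_measurable, of k snd borel]
  by (auto simp flip: borel_prod)

lemma pair_measurable_past:
  assumes "1 \<le> k" "k \<le> n"
  shows "(\<lambda>\<omega>. (Z k \<omega>, V k \<omega>)) \<in> borel_measurable (past n)"
proof -
  have "(\<lambda>\<omega>. restrict (\<lambda>i. (Z i \<omega>, V i \<omega>)) {1..n}) \<in> measurable (past n) (PiM {1..n} (\<lambda>_. borel))"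
    unfolding past_def by (rule measurable_vimage_algebra1) (auto simp: space_PiM)
  from measurable_compose[OF this measurable_component_singleton[of k]] assms show ?thesis
    by simp
qed

lemma Z_measurable_past: "1 \<le> k \<Longrightarrow> k \<le> n \<Longrightarrow> Z k \<in> borel_measurable (past n)"
  and V_measurable_past: "1 \<le> k \<Longrightarrow> k \<le> n \<Longrightarrow> V k \<in> borel_measurable (past n)"
  using measurable_compose[OF pair_measurable_past, of k n fst borel]
    measurable_compose[OF pair_measurable_past, of k n snd borel]
  by (auto simp flip: borel_prod)

lemma indep_past_present:
  fixes U :: "'a \<Rightarrow> real" and \<phi> :: "real \<times> real \<Rightarrow> real"
  assumes U: "U \<in> borel_measurable (past n)" and \<phi>: "\<phi> \<in> borel_measurable borel"
  shows "indep_var borel U borel (\<lambda>\<omega>. \<phi> (Z (Suc n) \<omega>, V (Suc n) \<omega>))"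
proof (rule indep_var_vimage_algebra)
  show "indep_var (PiM {1..n} (\<lambda>_. borel)) (\<lambda>\<omega>. restrict (\<lambda>i. (Z i \<omega>, V i \<omega>)) {1..n})
      (PiM {Suc n} (\<lambda>_. borel)) (\<lambda>\<omega>. restrict (\<lambda>i. (Z i \<omega>, V i \<omega>)) {Suc n})" (is "indep_var _ _ ?N ?Q")
    by (rule indep_var_restrict[OF indep]) auto
  show "U \<in> borel_measurable (vimage_algebra (space M)
      (\<lambda>\<omega>. restrict (\<lambda>i. (Z i \<omega>, V i \<omega>)) {1..n}) (PiM {1..n} (\<lambda>_. borel)))"
    using U by (simp add: past_def)
  have "?Q \<in> measurable (vimage_algebra (space M) ?Q ?N) ?N"
    by (rule measurable_vimage_algebra1) (auto simp: space_PiM)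
  from measurable_compose[OF measurable_compose[OF this measurable_component_singleton[of "Suc n"]] \<phi>]
  show "(\<lambda>\<omega>. \<phi> (Z (Suc n) \<omega>, V (Suc n) \<omega>)) \<in> borel_measurable (vimage_algebra (space M) ?Q ?N)"
    by simp
qed

lemma past_present_product:
  fixes U :: "'a \<Rightarrow> real" and \<phi> :: "real \<times> real \<Rightarrow> real"
  assumes "U \<in> borel_measurable (past n)" "\<phi> \<in> borel_measurable borel"
    and "integrable M U" "integrable M (\<lambda>\<omega>. \<phi> (Z (Suc n) \<omega>, V (Suc n) \<omega>))"
  shows "integrable M (\<lambda>\<omega>. U \<omega> * \<phi> (Z (Suc n) \<omega>, V (Suc n) \<omega>))"
    and "expectation (\<lambda>\<omega>. U \<omega> * \<phi> (Z (Suc n) \<omega>, V (Suc n) \<omega>))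
      = expectation U * expectation (\<lambda>\<omega>. \<phi> (Z (Suc n) \<omega>, V (Suc n) \<omega>))"
  using indep_var_integrable[OF indep_past_present[OF assms(1,2)] assms(3,4)]
    indep_var_lebesgue_integral[OF indep_past_present[OF assms(1,2)] assms(3,4)] by auto

lemma past_imp_measurable: "U \<in> borel_measurable (past n) \<Longrightarrow> U \<in> borel_measurable M"
  for U :: "'a \<Rightarrow> real"
  using indep_past_present[of U n "\<lambda>_. 0"] by (auto dest: indep_var_rv1)

text \<open>Martingale increments are orthogonal: \<open>A k\<close> depends only on the pairs of index at most \<open>k\<close>
  and multiplies a centred function of the pair of index \<open>k + 1\<close>.\<close>

lemma second_moment_martingale:
  fixes A :: "nat \<Rightarrow> 'a \<Rightarrow> real" and \<phi> :: "nat \<Rightarrow> real \<times> real \<Rightarrow> real"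
  assumes A: "\<And>k n. k \<le> n \<Longrightarrow> A k \<in> borel_measurable (past n)"
    and A2: "\<And>k. integrable M (\<lambda>\<omega>. (A k \<omega>)\<^sup>2)"
    and \<phi>: "\<And>k. \<phi> k \<in> borel_measurable borel"
    and \<phi>2: "\<And>k. 1 \<le> k \<Longrightarrow> integrable M (\<lambda>\<omega>. (\<phi> k (Z k \<omega>, V k \<omega>))\<^sup>2)"
    and centred: "\<And>k. 1 \<le> k \<Longrightarrow> expectation (\<lambda>\<omega>. \<phi> k (Z k \<omega>, V k \<omega>)) = 0"
  shows "integrable M (\<lambda>\<omega>. (\<Sum>k=1..n. A (k - 1) \<omega> * \<phi> k (Z k \<omega>, V k \<omega>))\<^sup>2)" (is "?int n")
    and "expectation (\<lambda>\<omega>. (\<Sum>k=1..n. A (k - 1) \<omega> * \<phi> k (Z k \<omega>, V k \<omega>))\<^sup>2)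
      = (\<Sum>k=1..n. mean_square (A (k - 1)) * expectation (\<lambda>\<omega>. (\<phi> k (Z k \<omega>, V k \<omega>))\<^sup>2))"
    (is "?eq n")
proof -
  let ?\<phi> = "\<lambda>k \<omega>. \<phi> k (Z k \<omega>, V k \<omega>)"
  define S where "S n \<omega> = (\<Sum>k=1..n. A (k - 1) \<omega> * ?\<phi> k \<omega>)" for n \<omega>
  have \<phi>_past: "?\<phi> k \<in> borel_measurable (past n)" if "1 \<le> k" "k \<le> n" for k n
    using measurable_compose[OF pair_measurable_past[OF that] \<phi>] .
  have S_past: "S n \<in> borel_measurable (past n)" for n
    unfolding S_def by (intro borel_measurable_sum borel_measurable_times A \<phi>_past) auto
  have [measurable]: "S n \<in> borel_measurable M" "A n \<in> borel_measurable M" for n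
    using S_past A by (auto intro: past_imp_measurable)
  have \<phi>_rv: "?\<phi> (Suc n) \<in> borel_measurable M" for n
    using \<phi>_past[of "Suc n" "Suc n"] by (auto intro: past_imp_measurable)
  have "?int n \<and> ?eq n"
  proof (induction n)
    case (Suc n)
    let ?\<psi> = "?\<phi> (Suc n)"
    from Suc have IH: "integrable M (\<lambda>\<omega>. (S n \<omega>)\<^sup>2)"
      by (simp add: S_def)
    have int_\<psi>: "integrable M ?\<psi>"
      by (rule square_integrable_imp_integrable[OF \<phi>_rv \<phi>2]) simp
    have SA_past: "(\<lambda>\<omega>. S n \<omega> * A n \<omega>) \<in> borel_measurable (past n)"
      by (intro borel_measurable_times S_past A) simp
    have A2_past: "(\<lambda>\<omega>. (A n \<omega>)\<^sup>2) \<in> borel_measurable (past n)"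
      by (intro borel_measurable_power A) simp
    have \<phi>2_meas: "(\<lambda>p. (\<phi> (Suc n) p)\<^sup>2) \<in> borel_measurable borel"
      by (intro borel_measurable_power \<phi>)
    have SA: "integrable M (\<lambda>\<omega>. S n \<omega> * A n \<omega>)"
      by (rule integrable_mult_of_squares[OF _ _ IH A2]) auto
    note cross = past_present_product[OF SA_past \<phi> SA int_\<psi>]
    note square = past_present_product[OF A2_past \<phi>2_meas A2 \<phi>2[of "Suc n", simplified]]
    have expand: "(S (Suc n) \<omega>)\<^sup>2 = (S n \<omega>)\<^sup>2 + 2 * ((S n \<omega> * A n \<omega>) * ?\<psi> \<omega>) + (A n \<omega>)\<^sup>2 * (?\<psi> \<omega>)\<^sup>2" for \<omega>
      by (simp add: S_def power2_eq_square algebra_simps)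
    have "integrable M (\<lambda>\<omega>. (S (Suc n) \<omega>)\<^sup>2)"
      unfolding expand by (intro integrable_arith IH cross square)
    moreover have "mean_square (S (Suc n)) = mean_square (S n)
        + mean_square (A n) * expectation (\<lambda>\<omega>. (?\<psi> \<omega>)\<^sup>2)"
      unfolding expand using IH cross square centred[of "Suc n"]
      by (simp add: Bochner_Integration.integral_add Bochner_Integration.integrable_add)
    ultimately show ?case
      using Suc by (simp add: S_def)
  qed simp
  then show "?int n" "?eq n"
    by auto
qed

end

section \<open>The recursion and its average\<close>

text \<open>The contraction by \<open>1 - c * \<gamma> n\<close> in each step wins against the relative variation of \<open>v\<close>,
  which is of order \<open>1 / n\<close> and hence of smaller order than \<open>\<gamma> n\<close>.\<close>

lemma contraction_bound:
  fixes y v \<gamma> :: "nat \<Rightarrow> real"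
  assumes y: "\<And>n. 0 \<le> y n" and v: "\<And>n. 1 \<le> n \<Longrightarrow> 0 < v n"
    and slow: "\<And>n. 1 \<le> n \<Longrightarrow> v (n - 1) \<le> v n + B * (v n / real n)" and "0 \<le> B"
    and "0 < c" "0 \<le> C"
    and rec: "eventually (\<lambda>n. y n \<le> (1 - c * \<gamma> n) * y (n - 1) + C * \<gamma> n * v n) sequentially"
    and \<gamma>: "\<And>n. 1 \<le> n \<Longrightarrow> 0 < \<gamma> n" "\<gamma> \<longlonglongrightarrow> 0" "filterlim (\<lambda>n. real n * \<gamma> n) at_top sequentially"
  obtains A where "0 \<le> A" "\<And>n. 1 \<le> n \<Longrightarrow> y n \<le> A * v n" "\<And>n. 1 \<le> n \<Longrightarrow> y (n - 1) \<le> A * v n"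
proof -
  have "eventually (\<lambda>n. \<gamma> n < 1 / c) sequentially"
    using \<gamma>(2) \<open>0 < c\<close> by (intro order_tendstoD) auto
  moreover have "eventually (\<lambda>n. 2 * B / c \<le> real n * \<gamma> n) sequentially"
    using \<gamma>(3) unfolding filterlim_at_top by blast
  ultimately have "eventually (\<lambda>n. y n \<le> (1 - c * \<gamma> n) * y (n - 1) + C * \<gamma> n * v n \<and>
      c * \<gamma> n \<le> 1 \<and> B / real n \<le> c / 2 * \<gamma> n \<and> 1 \<le> n) sequentially"
    using rec eventually_ge_at_top[of 1]
  proof eventually_elim
    case (elim n)
    then show ?case
      using \<open>0 < c\<close> by (simp add: field_simps)
  qed
  then obtain N where N: "\<And>n. N \<le> n \<Longrightarrow> y n \<le> (1 - c * \<gamma> n) * y (n - 1) + C * \<gamma> n * v n"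
    "\<And>n. N \<le> n \<Longrightarrow> c * \<gamma> n \<le> 1" "\<And>n. N \<le> n \<Longrightarrow> B / real n \<le> c / 2 * \<gamma> n" "1 \<le> N"
    unfolding eventually_sequentially by blast
  define A where "A = 2 * C / c + (\<Sum>k=1..N. y k / v k)"
  have sum_nonneg: "0 \<le> (\<Sum>k=1..N. y k / v k)"
    using y v by (intro sum_nonneg divide_nonneg_pos) auto
  then have A: "2 * C / c \<le> A" "0 \<le> A"
    using \<open>0 < c\<close> \<open>0 \<le> C\<close> by (simp_all add: A_def)
  have early: "y n \<le> A * v n" if "1 \<le> n" "n \<le> N" for n
  proof -
    have "y n / v n \<le> (\<Sum>k=1..N. y k / v k)"
      using that y v by (intro member_le_sum) (auto intro!: divide_nonneg_pos)
    also have "\<dots> \<le> A"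
      using \<open>0 < c\<close> \<open>0 \<le> C\<close> by (simp add: A_def)
    finally show ?thesis
      using v[OF that(1)] by (simp add: field_simps)
  qed
  have late: "y n \<le> A * v n" if "N \<le> n" for n
    using that
  proof (induction n rule: dec_induct)
    case base
    show ?case
      using early \<open>1 \<le> N\<close> by simp
  next
    case (step n)
    let ?g = "\<gamma> (Suc n)" and ?v = "v (Suc n)"
    have "0 < ?v" "0 < ?g"
      using v[of "Suc n"] \<gamma>(1)[of "Suc n"] by auto
    have "y (Suc n) \<le> (1 - c * ?g) * y n + C * ?g * ?v"
      using N(1)[of "Suc n"] step.hyps by simp
    also have "y n \<le> A * v n"
      by (rule step.IH)
    also have "v n \<le> ?v + B * (?v / real (Suc n))"
      using slow[of "Suc n"] by simp
    also have "B * (?v / real (Suc n)) = B / real (Suc n) * ?v"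
      by simp
    also have "\<dots> \<le> c / 2 * ?g * ?v"
      using N(3)[of "Suc n"] step.hyps \<open>0 < ?v\<close> by (intro mult_right_mono) auto
    finally have "y (Suc n) \<le> (1 - c * ?g) * (A * (?v + c / 2 * ?g * ?v)) + C * ?g * ?v"
      using N(2)[of "Suc n"] step.hyps \<open>0 \<le> A\<close>
      by (simp add: mult_left_mono)
    also have "\<dots> = A * ?v - ((A * c / 2 - C) + A * c\<^sup>2 / 2 * ?g) * ?g * ?v"
      by (simp add: field_simps power2_eq_square)
    also have "\<dots> \<le> A * ?v"
    proof -
      have "C \<le> A * c / 2"
        using A(1) \<open>0 < c\<close> by (simp add: field_simps)
      then have "0 \<le> ((A * c / 2 - C) + A * c\<^sup>2 / 2 * ?g) * ?g * ?v"
        using \<open>0 \<le> A\<close> \<open>0 < ?g\<close> \<open>0 < ?v\<close> by (intro mult_nonneg_nonneg add_nonneg_nonneg) auto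
      then show ?thesis
        by simp
    qed
    finally show ?case .
  qed
  have main: "y n \<le> A * v n" if "1 \<le> n" for n
    using early[OF that] late[of n] by linarith
  define A' where "A' = A * (1 + B) + y 0 / v 1"
  have "0 \<le> y 0 / v 1"
    using y[of 0] v[of 1] by simp
  have "A \<le> A * (1 + B)"
    using \<open>0 \<le> A\<close> \<open>0 \<le> B\<close> by (simp add: algebra_simps)
  show thesis
  proof (rule that[of A'])
    show "0 \<le> A'"
      using \<open>0 \<le> A\<close> \<open>0 \<le> y 0 / v 1\<close> \<open>A \<le> A * (1 + B)\<close> by (simp add: A'_def)
    have "A \<le> A'"
      using \<open>0 \<le> y 0 / v 1\<close> \<open>A \<le> A * (1 + B)\<close> by (simp add: A'_def)
    fix n :: nat assume "1 \<le> n"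
    from \<open>A \<le> A'\<close> show "y n \<le> A' * v n"
      using main[OF \<open>1 \<le> n\<close>] v[OF \<open>1 \<le> n\<close>] by (meson less_imp_le mult_right_mono order_trans)
    show "y (n - 1) \<le> A' * v n"
    proof (cases "n = 1")
      case True
      have "0 \<le> A * (1 + B) * v 1"
        using \<open>0 \<le> A\<close> \<open>0 \<le> B\<close> v[of 1] by simp
      with True v[of 1] show ?thesis
        by (simp add: A'_def algebra_simps)
    next
      case False
      with \<open>1 \<le> n\<close> have "1 \<le> n - 1"
        by simp
      then have "y (n - 1) \<le> A * v (n - 1)"
        by (rule main)
      also have "\<dots> \<le> A * (v n + B * (v n / real n))"
        by (intro mult_left_mono slow) fact+
      also have "\<dots> \<le> A * (v n + B * v n)"
        using v[OF \<open>1 \<le> n\<close>] \<open>1 \<le> n\<close> \<open>0 \<le> A\<close> \<open>0 \<le> B\<close>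
        by (intro mult_left_mono add_left_mono) (auto simp: field_simps)
      also have "\<dots> = A * (1 + B) * v n"
        by (simp add: algebra_simps)
      also have "\<dots> \<le> A' * v n"
        using \<open>0 \<le> y 0 / v 1\<close> v[OF \<open>1 \<le> n\<close>] by (intro mult_right_mono) (auto simp: A'_def)
      finally show ?thesis .
    qed
  qed
qed

text \<open>The probabilistic core, with the estimator reduced to what its analysis needs: \<open>f\<close> is the
  limit of the means of \<open>Z n\<close>, \<open>b\<close> is the coefficient of the bias, \<open>\<tau>\<close> that of the variance, and one
  constant \<open>C\<close> serves for all bounds.\<close>

locale averaged_recursion = independent_pairs M Z V
  for M :: "'a measure" and Z V :: "nat \<Rightarrow> 'a \<Rightarrow> real" +
  fixes \<Delta> :: "nat \<Rightarrow> 'a \<Rightarrow> real" and \<gamma> h w :: "nat \<Rightarrow> real" and d0 f b \<tau> C \<alpha> a q :: real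
  assumes \<Delta>_0: "\<And>\<omega>. \<Delta> 0 \<omega> = d0"
    and \<Delta>_Suc: "\<And>n \<omega>. \<Delta> (Suc n) \<omega> = \<Delta> n \<omega> + \<gamma> (Suc n) * (V (Suc n) \<omega> - Z (Suc n) \<omega> * \<Delta> n \<omega>)"
    and int_Z2: "\<And>n. 1 \<le> n \<Longrightarrow> integrable M (\<lambda>\<omega>. (Z n \<omega>)\<^sup>2)"
    and int_V3: "\<And>n. 1 \<le> n \<Longrightarrow> integrable M (\<lambda>\<omega>. \<bar>V n \<omega>\<bar> ^ 3)"
    and f_pos: "0 < f" and C_nonneg: "0 \<le> C"
    and mean_Z: "\<And>n. 1 \<le> n \<Longrightarrow> \<bar>expectation (Z n) - f\<bar> \<le> C * (h n)\<^sup>2"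
    and second_Z: "\<And>n. 1 \<le> n \<Longrightarrow> mean_square (Z n) \<le> C / h n"
    and third_V: "\<And>n. 1 \<le> n \<Longrightarrow> mean_cube (V n) \<le> C / (h n)\<^sup>2"
    and mean_V: "(\<lambda>n. expectation (V n) / (h n)\<^sup>2) \<longlonglongrightarrow> b"
    and second_V: "(\<lambda>n. h n * mean_square (V n)) \<longlonglongrightarrow> \<tau>"
    and \<gamma>: "\<gamma> \<in> GS (- \<alpha>)" and h: "h \<in> GS (- a)" and w: "w \<in> GS (- q)"
    and \<gamma>_lim: "\<gamma> \<longlonglongrightarrow> 0" and h_lim: "h \<longlonglongrightarrow> 0"
    and n\<gamma>_lim: "filterlim (\<lambda>n. real n * \<gamma> n) at_top sequentially"
    and exponents: "0 < a" "a < \<alpha>" "a < 1" "q < 1 - 2 * a" "q < (1 + a) / 2"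
begin

lemma \<gamma>_pos: "1 \<le> n \<Longrightarrow> 0 < \<gamma> n" and h_pos: "1 \<le> n \<Longrightarrow> 0 < h n" and w_pos: "1 \<le> n \<Longrightarrow> 0 < w n"
  using \<gamma> h w by (auto dest: GS_pos)

lemma int_V2: "1 \<le> n \<Longrightarrow> integrable M (\<lambda>\<omega>. (V n \<omega>)\<^sup>2)"
  by (rule integrable_abs_power_mono[OF V_measurable int_V3]) auto

lemma int_V: "1 \<le> n \<Longrightarrow> integrable M (V n)"
  by (rule square_integrable_imp_integrable[OF V_measurable int_V2])

lemma int_Z: "1 \<le> n \<Longrightarrow> integrable M (Z n)"
  by (rule square_integrable_imp_integrable[OF Z_measurable int_Z2])

lemma mean_V_bound: obtains B where "0 \<le> B" "\<And>n. 1 \<le> n \<Longrightarrow> \<bar>expectation (V n)\<bar> \<le> B * (h n)\<^sup>2"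
proof -
  have "Bseq (\<lambda>n. expectation (V n) / (h n)\<^sup>2)"
    by (rule convergent_imp_Bseq[OF convergentI[OF mean_V]])
  then obtain B where "0 < B" and B: "\<And>n. \<bar>expectation (V n) / (h n)\<^sup>2\<bar> \<le> B"
    by (auto simp: Bseq_def)
  have "\<bar>expectation (V n)\<bar> \<le> B * (h n)\<^sup>2" if "1 \<le> n" for n
    using B[of n] h_pos[OF that] by (simp add: abs_divide pos_divide_le_eq)
  with \<open>0 < B\<close> show ?thesis
    by (intro that[of B]) auto
qed

lemma second_V_bound: obtains B where "0 \<le> B" "\<And>n. 1 \<le> n \<Longrightarrow> mean_square (V n) \<le> B / h n"
proof -
  have "Bseq (\<lambda>n. h n * mean_square (V n))"
    by (rule convergent_imp_Bseq[OF convergentI[OF second_V]])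
  then obtain B where "0 < B" and B: "\<And>n. \<bar>h n * mean_square (V n)\<bar> \<le> B"
    by (auto simp: Bseq_def)
  have "mean_square (V n) \<le> B / h n" if "1 \<le> n" for n
    using abs_le_D1[OF B[of n]] h_pos[OF that] by (simp add: pos_le_divide_eq mult.commute)
  with \<open>0 < B\<close> show ?thesis
    by (intro that[of B]) auto
qed

lemma \<Delta>_past: "k \<le> n \<Longrightarrow> \<Delta> k \<in> borel_measurable (past n)"
proof (induction k)
  case 0
  then show ?case
    by (simp add: \<Delta>_0[abs_def])
next
  case (Suc k)
  then show ?case
    unfolding \<Delta>_Suc[abs_def]
    by (intro borel_measurable_add borel_measurable_times borel_measurable_diff borel_measurable_const
        Z_measurable_past V_measurable_past) auto
qed

lemma \<Delta>_measurable [measurable]: "\<Delta> n \<in> borel_measurable M"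
  using \<Delta>_past by (blast intro: past_imp_measurable)

text \<open>The error \<open>\<Delta> n\<close> is independent of the pair of index \<open>n + 1\<close>, so the square of the recursion
  can be integrated factor by factor.\<close>

lemma second_moment_\<Delta>_step:
  assumes int_\<Delta>: "integrable M (\<lambda>\<omega>. (\<Delta> n \<omega>)\<^sup>2)"
  shows "integrable M (\<lambda>\<omega>. (\<Delta> (Suc n) \<omega>)\<^sup>2)"
    and "mean_square (\<Delta> (Suc n))
      = (1 - 2 * \<gamma> (Suc n) * expectation (Z (Suc n)) + (\<gamma> (Suc n))\<^sup>2 * mean_square (Z (Suc n)))
          * mean_square (\<Delta> n)
        + 2 * \<gamma> (Suc n) * (expectation (V (Suc n)) - \<gamma> (Suc n) * expectation (\<lambda>\<omega>. Z (Suc n) \<omega> * V (Suc n) \<omega>))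
          * expectation (\<Delta> n)
        + (\<gamma> (Suc n))\<^sup>2 * mean_square (V (Suc n))"
proof -
  let ?g = "\<gamma> (Suc n)" and ?Z = "Z (Suc n)" and ?V = "V (Suc n)"
  have [measurable]: "?Z \<in> borel_measurable M" "?V \<in> borel_measurable M"
    by simp_all
  define \<phi> where "\<phi> = (\<lambda>p :: real \<times> real. (1 - ?g * fst p)\<^sup>2)"
  define \<psi> where "\<psi> = (\<lambda>p :: real \<times> real. (1 - ?g * fst p) * snd p)"
  have \<phi>: "\<phi> \<in> borel_measurable borel" and \<psi>: "\<psi> \<in> borel_measurable borel"
    unfolding \<phi>_def \<psi>_def by (intro borel_measurable_continuous_onI continuous_intros)+
  have ints: "integrable M ?Z" "integrable M ?V" "integrable M (\<lambda>\<omega>. (?Z \<omega>)\<^sup>2)" "integrable M (\<lambda>\<omega>. (?V \<omega>)\<^sup>2)"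
    by (simp_all add: int_Z int_V int_Z2 int_V2)
  have int_ZV: "integrable M (\<lambda>\<omega>. ?Z \<omega> * ?V \<omega>)"
    by (intro integrable_mult_of_squares ints) auto
  have \<phi>_eq: "\<phi> (?Z \<omega>, ?V \<omega>) = 1 - 2 * ?g * ?Z \<omega> + ?g\<^sup>2 * (?Z \<omega>)\<^sup>2" for \<omega>
    by (simp add: \<phi>_def power2_eq_square algebra_simps)
  have \<psi>_eq: "\<psi> (?Z \<omega>, ?V \<omega>) = ?V \<omega> - ?g * (?Z \<omega> * ?V \<omega>)" for \<omega>
    by (simp add: \<psi>_def algebra_simps)
  have int_\<phi>: "integrable M (\<lambda>\<omega>. \<phi> (?Z \<omega>, ?V \<omega>))" and int_\<psi>: "integrable M (\<lambda>\<omega>. \<psi> (?Z \<omega>, ?V \<omega>))"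
    unfolding \<phi>_eq \<psi>_eq using ints int_ZV by auto
  have E_\<phi>: "expectation (\<lambda>\<omega>. \<phi> (?Z \<omega>, ?V \<omega>)) = 1 - 2 * ?g * expectation ?Z + ?g\<^sup>2 * expectation (\<lambda>\<omega>. (?Z \<omega>)\<^sup>2)"
    and E_\<psi>: "expectation (\<lambda>\<omega>. \<psi> (?Z \<omega>, ?V \<omega>)) = expectation ?V - ?g * expectation (\<lambda>\<omega>. ?Z \<omega> * ?V \<omega>)"
    unfolding \<phi>_eq \<psi>_eq using ints int_ZV by (simp_all add: prob_space)
  have \<Delta>2_past: "(\<lambda>\<omega>. (\<Delta> n \<omega>)\<^sup>2) \<in> borel_measurable (past n)"
    by (intro borel_measurable_power \<Delta>_past) simp
  have int1: "integrable M (\<Delta> n)"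
    by (rule square_integrable_imp_integrable[OF _ int_\<Delta>]) simp
  note sq = past_present_product[OF \<Delta>2_past \<phi> int_\<Delta> int_\<phi>]
  note cr = past_present_product[OF \<Delta>_past \<psi> int1 int_\<psi>, OF order_refl]
  have expand: "(\<Delta> (Suc n) \<omega>)\<^sup>2 = (\<Delta> n \<omega>)\<^sup>2 * \<phi> (?Z \<omega>, ?V \<omega>) + 2 * ?g * (\<Delta> n \<omega> * \<psi> (?Z \<omega>, ?V \<omega>)) + ?g\<^sup>2 * (?V \<omega>)\<^sup>2" for \<omega>
    by (simp add: \<Delta>_Suc \<phi>_def \<psi>_def power2_eq_square algebra_simps)
  show "integrable M (\<lambda>\<omega>. (\<Delta> (Suc n) \<omega>)\<^sup>2)"
    unfolding expand by (intro integrable_arith sq cr ints)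
  show "mean_square (\<Delta> (Suc n))
      = (1 - 2 * \<gamma> (Suc n) * expectation (Z (Suc n)) + (\<gamma> (Suc n))\<^sup>2 * mean_square (Z (Suc n)))
          * mean_square (\<Delta> n)
        + 2 * \<gamma> (Suc n) * (expectation (V (Suc n)) - \<gamma> (Suc n) * expectation (\<lambda>\<omega>. Z (Suc n) \<omega> * V (Suc n) \<omega>))
          * expectation (\<Delta> n)
        + (\<gamma> (Suc n))\<^sup>2 * mean_square (V (Suc n))"
    unfolding expand E_\<phi>[symmetric] E_\<psi>[symmetric] using sq cr ints by simp
qed

lemma int_\<Delta>2: "integrable M (\<lambda>\<omega>. (\<Delta> n \<omega>)\<^sup>2)"
  by (induction n) (simp_all add: \<Delta>_0 second_moment_\<Delta>_step)

lemma int_\<Delta>: "integrable M (\<Delta> n)"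
  by (rule square_integrable_imp_integrable[OF _ int_\<Delta>2]) simp

lemma \<gamma>_over_h_lim: "(\<lambda>n. \<gamma> n / h n) \<longlonglongrightarrow> 0"
  by (rule GS_tendsto_zero[OF GS_divide[OF \<gamma> h]]) (use exponents in simp)

text \<open>The variance of the noise contributes \<open>\<gamma> n / h n\<close>. Its mean, of order \<open>(h n)\<^sup>2\<close>, enters through
  the product with the mean of \<open>\<Delta> (n - 1)\<close>; part of the contraction absorbs the latter, and the
  squared bias \<open>h n ^ 4\<close> is left.\<close>

lemma second_moment_\<Delta>_bound:
  obtains A where "0 \<le> A"
    "\<And>n. 1 \<le> n \<Longrightarrow> mean_square (\<Delta> n) \<le> A * (\<gamma> n / h n + h n ^ 4)"
    "\<And>n. 1 \<le> n \<Longrightarrow> mean_square (\<Delta> (n - 1)) \<le> A * (\<gamma> n / h n + h n ^ 4)"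
proof -
  define e where "e n = mean_square (\<Delta> n)" for n
  define v where "v n = \<gamma> n / h n + h n ^ 4" for n
  obtain B1 where B1: "0 \<le> B1" "\<And>n. 1 \<le> n \<Longrightarrow> \<bar>expectation (V n)\<bar> \<le> B1 * (h n)\<^sup>2"
    using mean_V_bound by blast
  obtain B2 where B2: "0 \<le> B2" "\<And>n. 1 \<le> n \<Longrightarrow> mean_square (V n) \<le> B2 / h n"
    using second_V_bound by blast
  define C1 where "C1 = (C + B2) / 2"
  have "0 \<le> C1"
    using C_nonneg B2 by (simp add: C1_def)
  have mixed: "\<bar>expectation (\<lambda>\<omega>. Z n \<omega> * V n \<omega>)\<bar> \<le> C1 / h n" if "1 \<le> n" for n
  proof -
    have "\<bar>expectation (\<lambda>\<omega>. Z n \<omega> * V n \<omega>)\<bar> \<le> expectation (\<lambda>\<omega>. \<bar>Z n \<omega> * V n \<omega>\<bar>)"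
      by (rule integral_abs_bound)
    also have "\<dots> \<le> expectation (\<lambda>\<omega>. ((Z n \<omega>)\<^sup>2 + (V n \<omega>)\<^sup>2) / 2)"
    proof (rule integral_mono)
      show "integrable M (\<lambda>\<omega>. \<bar>Z n \<omega> * V n \<omega>\<bar>)"
        using that by (intro integrable_abs integrable_mult_of_squares int_Z2 int_V2) auto
      show "integrable M (\<lambda>\<omega>. ((Z n \<omega>)\<^sup>2 + (V n \<omega>)\<^sup>2) / 2)"
        using that int_Z2 int_V2 by simp
      fix \<omega>
      have "0 \<le> (\<bar>Z n \<omega>\<bar> - \<bar>V n \<omega>\<bar>)\<^sup>2"
        by simp
      then show "\<bar>Z n \<omega> * V n \<omega>\<bar> \<le> ((Z n \<omega>)\<^sup>2 + (V n \<omega>)\<^sup>2) / 2"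
        by (simp add: power2_diff abs_mult)
    qed
    also have "\<dots> \<le> C1 / h n"
      using that int_Z2 int_V2 second_Z[OF that] B2(2)[OF that]
      by (simp add: C1_def add_divide_distrib)
    finally show ?thesis .
  qed
  define C2 where "C2 = 4 / f * (B1\<^sup>2 + C1\<^sup>2) + B2"
  have "0 \<le> C2"
    using f_pos B2 by (simp add: C2_def)
  have h2_lim: "(\<lambda>n. 2 * C * (h n)\<^sup>2 + C * (\<gamma> n / h n)) \<longlonglongrightarrow> 2 * C * 0\<^sup>2 + C * 0"
    by (intro tendsto_intros h_lim \<gamma>_over_h_lim)
  have "eventually (\<lambda>n. 2 * C * (h n)\<^sup>2 + C * (\<gamma> n / h n) < f / 2) sequentially"
    using h2_lim f_pos by (intro order_tendstoD) auto
  moreover have "eventually (\<lambda>n. \<gamma> n / h n < 1) sequentially"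
    using \<gamma>_over_h_lim by (intro order_tendstoD) auto
  ultimately have rec: "eventually (\<lambda>n. e n \<le> (1 - f * \<gamma> n) * e (n - 1) + C2 * \<gamma> n * v n) sequentially"
    using eventually_ge_at_top[of 1]
  proof eventually_elim
    case (elim n)
    let ?g = "\<gamma> n" and ?h = "h n"
    have pos: "0 < ?g" "0 < ?h"
      using elim \<gamma>_pos h_pos by auto
    obtain m where n: "n = Suc m"
      using elim(3) by (cases n) auto
    define \<mu> where "\<mu> = expectation (V n) - ?g * expectation (\<lambda>\<omega>. Z n \<omega> * V n \<omega>)"
    define ED where "ED = expectation (\<Delta> (n - 1))"
    define \<rho> where "\<rho> = 1 - 2 * ?g * expectation (Z n) + ?g\<^sup>2 * mean_square (Z n)"
    have e_nonneg: "0 \<le> e (n - 1)"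
      by (simp add: e_def)
    have "\<rho> \<le> 1 - 3 / 2 * f * ?g"
    proof -
      have "?g * (f - C * ?h\<^sup>2) \<le> ?g * expectation (Z n)"
        using mean_Z[OF elim(3)] pos by (intro mult_left_mono) auto
      then have "?g * f - ?g * (C * ?h\<^sup>2) \<le> ?g * expectation (Z n)"
        by (simp add: right_diff_distrib)
      moreover have "?g\<^sup>2 * mean_square (Z n) \<le> ?g\<^sup>2 * (C / ?h)"
        by (intro mult_left_mono second_Z elim) auto
      moreover have "?g\<^sup>2 * (C / ?h) = ?g * (C * (?g / ?h))"
        by (simp add: power2_eq_square)
      moreover have "?g * (2 * C * ?h\<^sup>2 + C * (?g / ?h)) \<le> ?g * (f / 2)"
        using elim pos by (intro mult_left_mono) auto
      then have "2 * (?g * (C * ?h\<^sup>2)) + ?g * (C * (?g / ?h)) \<le> ?g * f / 2"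
        by (simp add: distrib_left mult.assoc mult.left_commute[of 2])
      moreover have "\<rho> = 1 - 2 * (?g * expectation (Z n)) + ?g\<^sup>2 * mean_square (Z n)"
        "1 - 3 / 2 * f * ?g = 1 - 3 / 2 * (?g * f)"
        by (simp_all add: \<rho>_def)
      ultimately show ?thesis
        by linarith
    qed
    then have 1: "\<rho> * e (n - 1) \<le> (1 - 3 / 2 * f * ?g) * e (n - 1)"
      by (intro mult_right_mono e_nonneg)
    have ED: "ED\<^sup>2 \<le> e (n - 1)"
      using variance_positive[of "\<Delta> (n - 1)"] unfolding variance_eq[OF int_\<Delta> int_\<Delta>2] ED_def e_def
      by linarith
    have \<mu>: "\<mu>\<^sup>2 \<le> 2 * B1\<^sup>2 * ?h ^ 4 + 2 * C1\<^sup>2 * (?g / ?h)"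
    proof -
      have "\<bar>\<mu>\<bar> \<le> \<bar>expectation (V n)\<bar> + \<bar>?g * expectation (\<lambda>\<omega>. Z n \<omega> * V n \<omega>)\<bar>"
        unfolding \<mu>_def by (rule abs_triangle_ineq4)
      also have "\<bar>?g * expectation (\<lambda>\<omega>. Z n \<omega> * V n \<omega>)\<bar> \<le> ?g * (C1 / ?h)"
        using mixed[OF elim(3)] pos by (simp only: abs_mult abs_of_pos mult_left_mono less_imp_le)
      finally have "\<bar>\<mu>\<bar> \<le> B1 * ?h\<^sup>2 + C1 * (?g / ?h)"
        using B1(2)[OF elim(3)] by (simp add: mult.commute)
      then have "\<mu>\<^sup>2 \<le> (B1 * ?h\<^sup>2 + C1 * (?g / ?h))\<^sup>2"
        by (metis abs_ge_zero power2_abs power_mono)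
      also have "\<dots> \<le> 2 * (B1 * ?h\<^sup>2)\<^sup>2 + 2 * (C1 * (?g / ?h))\<^sup>2"
        using sum_squares_bound[of "B1 * ?h\<^sup>2" "C1 * (?g / ?h)"] by (simp add: power2_sum)
      also have "(C1 * (?g / ?h))\<^sup>2 = C1\<^sup>2 * ((?g / ?h) * (?g / ?h))"
        by (simp add: power2_eq_square)
      also have "(?g / ?h) * (?g / ?h) \<le> (?g / ?h) * 1"
        using elim pos by (intro mult_left_mono) auto
      finally show ?thesis
        by (simp add: power_mult_distrib mult_left_mono)
    qed
    \<comment> \<open>Young's inequality with weights chosen so that \<open>f / 2\<close> of the available \<open>3 * f / 2\<close> is spent.\<close>
    have 2: "2 * ?g * \<mu> * ED \<le> f / 2 * ?g * e (n - 1) + ?g * (4 / f * (B1\<^sup>2 * ?h ^ 4 + C1\<^sup>2 * (?g / ?h)))"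
    proof -
      have "0 \<le> (f / 2 * ED - \<mu>)\<^sup>2"
        by simp
      then have "2 * \<mu> * ED \<le> f / 2 * ED\<^sup>2 + 2 / f * \<mu>\<^sup>2"
        using f_pos by (simp add: power2_diff field_simps power2_eq_square)
      also have "\<dots> \<le> f / 2 * e (n - 1) + 2 / f * (2 * B1\<^sup>2 * ?h ^ 4 + 2 * C1\<^sup>2 * (?g / ?h))"
        using f_pos by (intro add_mono mult_left_mono ED \<mu>) auto
      finally have "?g * (2 * \<mu> * ED) \<le> ?g * (f / 2 * e (n - 1) + 2 / f * (2 * B1\<^sup>2 * ?h ^ 4 + 2 * C1\<^sup>2 * (?g / ?h)))"
        using pos by (intro mult_left_mono) auto
      then show ?thesis
        by (simp add: algebra_simps)
    qed
    have 3: "?g\<^sup>2 * mean_square (V n) \<le> ?g\<^sup>2 * (B2 / ?h)"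
      by (intro mult_left_mono B2 elim) auto
    have "e n = \<rho> * e (n - 1) + 2 * ?g * \<mu> * ED + ?g\<^sup>2 * mean_square (V n)"
      using second_moment_\<Delta>_step(2)[OF int_\<Delta>2, of m]
      by (simp add: n e_def \<rho>_def \<mu>_def ED_def)
    also have "\<dots> \<le> (1 - 3 / 2 * f * ?g) * e (n - 1)
        + (f / 2 * ?g * e (n - 1) + ?g * (4 / f * (B1\<^sup>2 * ?h ^ 4 + C1\<^sup>2 * (?g / ?h)))) + ?g\<^sup>2 * (B2 / ?h)"
      by (intro add_mono 1 2 3)
    also have "\<dots> = (1 - f * ?g) * e (n - 1)
        + ?g * (4 / f * (B1\<^sup>2 * ?h ^ 4 + C1\<^sup>2 * (?g / ?h)) + B2 * (?g / ?h))"
      by (simp add: algebra_simps power2_eq_square)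
    also have "\<dots> \<le> (1 - f * ?g) * e (n - 1) + ?g * (C2 * v n)"
    proof (intro add_left_mono mult_left_mono)
      have "0 \<le> 4 / f * B1\<^sup>2 * (?g / ?h)" "0 \<le> 4 / f * C1\<^sup>2 * ?h ^ 4" "0 \<le> B2 * ?h ^ 4"
        using f_pos pos B2(1) by simp_all
      moreover have expand: "(F * (u + u') + B2) * (G + H)
          = (F * (u * H + u' * G) + B2 * G) + (F * u * G + F * u' * H + B2 * H)" for F u u' G H
        by (simp add: algebra_simps)
      ultimately show "4 / f * (B1\<^sup>2 * ?h ^ 4 + C1\<^sup>2 * (?g / ?h)) + B2 * (?g / ?h) \<le> C2 * v n"
        unfolding C2_def v_def expand by linarith
    qed (use pos in simp)
    finally show ?case
      by (simp add: mult.commute mult.left_commute)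
  qed
  have h4: "(\<lambda>n. h n ^ 4) \<in> GS (- a + - a + (- a + - a))"
    using GS_mult[OF GS_mult[OF h h] GS_mult[OF h h]] by (simp add: power4_eq_xxxx mult.assoc)
  obtain A1 where A1: "0 \<le> A1" "\<And>n. 1 \<le> n \<Longrightarrow> \<bar>\<gamma> n / h n - \<gamma> (n - 1) / h (n - 1)\<bar> \<le> A1 * (\<gamma> n / h n / real n)"
    using GS_bounded_increments[OF GS_divide[OF \<gamma> h]] by blast
  obtain A2 where A2: "0 \<le> A2" "\<And>n. 1 \<le> n \<Longrightarrow> \<bar>h n ^ 4 - h (n - 1) ^ 4\<bar> \<le> A2 * (h n ^ 4 / real n)"
    using GS_bounded_increments[OF h4] by blast
  have slow: "v (n - 1) \<le> v n + (A1 + A2) * (v n / real n)" if "1 \<le> n" for n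
  proof -
    have pos: "0 < \<gamma> n" "0 < h n"
      using that \<gamma>_pos h_pos by auto
    have "v (n - 1) \<le> v n + (A1 * (\<gamma> n / h n / real n) + A2 * (h n ^ 4 / real n))"
      using A1(2)[OF that] A2(2)[OF that] unfolding v_def by linarith
    also have "A1 * (\<gamma> n / h n / real n) \<le> A1 * (v n / real n)"
      using pos by (intro mult_left_mono divide_right_mono A1) (auto simp: v_def)
    also have "A2 * (h n ^ 4 / real n) \<le> A2 * (v n / real n)"
      using pos by (intro mult_left_mono divide_right_mono A2) (auto simp: v_def)
    finally show ?thesis
      by (simp only: distrib_right)
  qed
  show thesis
  proof (rule contraction_bound[of e v "A1 + A2" f C2 \<gamma>])
    show "0 \<le> e n" for n
      by (simp add: e_def)
    show "0 < v n" if "1 \<le> n" for n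
      using \<gamma>_pos[OF that] h_pos[OF that] by (simp add: v_def add_pos_pos)
    fix A assume "0 \<le> A" "\<And>n. 1 \<le> n \<Longrightarrow> e n \<le> A * v n" "\<And>n. 1 \<le> n \<Longrightarrow> e (n - 1) \<le> A * v n"
    then show thesis
      unfolding e_def v_def by (rule that)
  qed (use slow rec \<open>0 \<le> C2\<close> A1(1) A2(1) f_pos \<gamma>_pos \<gamma>_lim n\<gamma>_lim in auto)
qed

end

section \<open>Remainder terms of the average\<close>

lemma abel_summation:
  fixes u d :: "nat \<Rightarrow> real"
  assumes "1 \<le> n"
  shows "(\<Sum>k=1..n. u k * (d (k - 1) - d k))
    = u 1 * d 0 - u n * d n + (\<Sum>k=2..n. (u k - u (k - 1)) * d (k - 1))"
  using assms
proof (induction n rule: dec_induct)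
  case (step n)
  then have "{2..Suc n} = insert (Suc n) {2..n}" "Suc n \<notin> {2..n}"
    by auto
  with step.IH show ?case
    by (simp add: algebra_simps)
qed (simp add: algebra_simps)

context averaged_recursion
begin

definition Q :: "nat \<Rightarrow> real" where
  "Q n = (\<Sum>k=1..n. w k)"

text \<open>The order of the standard deviation of the averaged estimator.\<close>

definition noise_size :: "nat \<Rightarrow> real" where
  "noise_size n = inverse (sqrt (real n * h n))"

text \<open>The order of standard deviation and bias together.\<close>

definition error_size :: "nat \<Rightarrow> real" where
  "error_size n = noise_size n + (h n)\<^sup>2"

lemma q_less_1: "q < 1"
  using exponents by linarith

lemma Q_pos: "1 \<le> n \<Longrightarrow> 0 < Q n"
  unfolding Q_def by (rule sum_pos) (auto intro: w_pos)

lemma noise_size_GS: "noise_size \<in> GS (- ((1 - a) / 2))"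
  using GS_inverse[OF GS_sqrt[OF GS_mult[OF GS_real h]]] by (simp add: noise_size_def[abs_def])

lemma h2_GS: "(\<lambda>n. (h n)\<^sup>2) \<in> GS (- 2 * a)"
  using GS_power2[OF h] by simp

lemma noise_size_pos: "1 \<le> n \<Longrightarrow> 0 < noise_size n"
  using noise_size_GS by (rule GS_pos)

lemma noise_size_lim: "noise_size \<longlonglongrightarrow> 0"
  by (rule GS_tendsto_zero[OF noise_size_GS]) (use exponents in simp)

lemma Q_lim: "(\<lambda>n. Q n / (real n * w n)) \<longlonglongrightarrow> 1 / (1 - q)"
  using GS_sum[OF w _ tendsto_const[of 1]] q_less_1 by (simp add: Q_def)

lemma Q_lim': "(\<lambda>n. real n * w n / Q n) \<longlonglongrightarrow> 1 - q"
  using tendsto_inverse[OF Q_lim] q_less_1 by simp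

lemma weighted_average_lim:
  assumes "v \<in> GS c" "q < 1 + c" "y \<longlonglongrightarrow> l"
  shows "(\<lambda>n. (\<Sum>k=1..n. w k * v k * y k) / (Q n * v n)) \<longlonglongrightarrow> l * ((1 - q) / (1 - q + c))"
  unfolding Q_def by (rule GS_weighted_average[OF w q_less_1 assms])

text \<open>Since \<open>f \<Delta>\<^sub>k = V\<^sub>k + (\<Delta>\<^bsub>k-1\<^esub> - \<Delta>\<^sub>k) (1 / \<gamma>\<^sub>k - f) + (f - Z\<^sub>k) \<Delta>\<^bsub>k-1\<^esub>\<close>, the weighted sum of the
  errors is that of the \<open>V\<^sub>k\<close>, divided by \<open>f\<close>, up to the remainder below.\<close>

definition remainder :: "nat \<Rightarrow> 'a \<Rightarrow> real" where
  "remainder n \<omega> = f * (\<Sum>k=1..n. w k * \<Delta> k \<omega>) - (\<Sum>k=1..n. w k * V k \<omega>)"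

definition telescoping_part :: "nat \<Rightarrow> 'a \<Rightarrow> real" where
  "telescoping_part n \<omega> = (\<Sum>k=1..n. w k * (1 / \<gamma> k - f) * (\<Delta> (k - 1) \<omega> - \<Delta> k \<omega>))"

definition bias_part :: "nat \<Rightarrow> 'a \<Rightarrow> real" where
  "bias_part n \<omega> = (\<Sum>k=1..n. w k * (f - expectation (Z k)) * \<Delta> (k - 1) \<omega>)"

definition martingale_part :: "nat \<Rightarrow> 'a \<Rightarrow> real" where
  "martingale_part n \<omega> = (\<Sum>k=1..n. \<Delta> (k - 1) \<omega> * (w k * (expectation (Z k) - Z k \<omega>)))"

lemma remainder_decomposition:
  "remainder n \<omega> = telescoping_part n \<omega> + bias_part n \<omega> + martingale_part n \<omega>"
proof -
  have "f * (w k * \<Delta> k \<omega>) - w k * V k \<omega> = w k * (1 / \<gamma> k - f) * (\<Delta> (k - 1) \<omega> - \<Delta> k \<omega>)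
      + w k * (f - expectation (Z k)) * \<Delta> (k - 1) \<omega> + \<Delta> (k - 1) \<omega> * (w k * (expectation (Z k) - Z k \<omega>))"
    if "k \<in> {1..n}" for k
  proof -
    from that obtain m where k: "k = Suc m"
      by (cases k) auto
    have "\<gamma> k > 0"
      using that \<gamma>_pos by simp
    then have "(1 / \<gamma> k - f) * (\<Delta> m \<omega> - \<Delta> k \<omega>) = (Z k \<omega> * \<Delta> m \<omega> - V k \<omega>) - f * (\<Delta> m \<omega> - \<Delta> k \<omega>)"
      by (simp add: k \<Delta>_Suc field_simps)
    then have "w k * (1 / \<gamma> k - f) * (\<Delta> m \<omega> - \<Delta> k \<omega>)
        = w k * ((Z k \<omega> * \<Delta> m \<omega> - V k \<omega>) - f * (\<Delta> m \<omega> - \<Delta> k \<omega>))"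
      by (simp only: mult.assoc)
    then show ?thesis
      by (simp add: k algebra_simps)
  qed
  then show ?thesis
    by (simp add: remainder_def telescoping_part_def bias_part_def martingale_part_def
        sum_distrib_left flip: sum_subtractf sum.distrib)
qed

text \<open>The order of the \<open>L\<^sup>2\<close> norm of \<open>\<Delta> n\<close>.\<close>

definition \<Delta>_size :: "nat \<Rightarrow> real" where
  "\<Delta>_size n = sqrt (\<gamma> n / h n) + (h n)\<^sup>2"

lemma \<Delta>_size_pos: "1 \<le> n \<Longrightarrow> 0 < \<Delta>_size n"
  using \<gamma>_pos[of n] h_pos[of n] by (auto simp: \<Delta>_size_def intro!: add_pos_pos)

lemma \<Delta>_size_lim: "\<Delta>_size \<longlonglongrightarrow> 0"
proof -
  have "(\<lambda>n. sqrt (\<gamma> n / h n) + (h n)\<^sup>2) \<longlonglongrightarrow> sqrt 0 + 0\<^sup>2"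
    by (intro tendsto_intros \<gamma>_over_h_lim h_lim)
  then show ?thesis
    by (simp add: \<Delta>_size_def[abs_def])
qed

lemma abs_moment_\<Delta>_bound:
  obtains A where "0 \<le> A"
    "\<And>n. 1 \<le> n \<Longrightarrow> mean_abs (\<Delta> n) \<le> A * \<Delta>_size n"
    "\<And>n. 1 \<le> n \<Longrightarrow> mean_abs (\<Delta> (n - 1)) \<le> A * \<Delta>_size n"
proof -
  obtain A where A: "0 \<le> A"
    "\<And>n. 1 \<le> n \<Longrightarrow> mean_square (\<Delta> n) \<le> A * (\<gamma> n / h n + h n ^ 4)"
    "\<And>n. 1 \<le> n \<Longrightarrow> mean_square (\<Delta> (n - 1)) \<le> A * (\<gamma> n / h n + h n ^ 4)"
    using second_moment_\<Delta>_bound by blast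
  have sqrt_bound: "sqrt (A * (\<gamma> n / h n + h n ^ 4)) \<le> sqrt A * \<Delta>_size n" if "1 \<le> n" for n
  proof -
    have "sqrt (\<gamma> n / h n + h n ^ 4) \<le> sqrt (\<gamma> n / h n) + sqrt (h n ^ 4)"
      using \<gamma>_pos[OF that] h_pos[OF that] by (intro sqrt_add_le_add_sqrt) auto
    also have "sqrt (h n ^ 4) = (h n)\<^sup>2"
      by (rule real_sqrt_unique) (auto simp: power_mult[symmetric])
    finally show ?thesis
      using A(1) by (simp add: real_sqrt_mult \<Delta>_size_def mult_left_mono)
  qed
  have "mean_abs (\<Delta> m) \<le> sqrt A * \<Delta>_size n"
    if "1 \<le> n" "mean_square (\<Delta> m) \<le> A * (\<gamma> n / h n + h n ^ 4)" for m n
  proof -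
    have "mean_abs (\<Delta> m) \<le> sqrt (mean_square (\<Delta> m))"
      by (rule abs_expectation_le_sqrt[OF _ int_\<Delta>2]) simp
    also have "\<dots> \<le> sqrt (A * (\<gamma> n / h n + h n ^ 4))"
      using that by (intro real_sqrt_le_mono)
    also have "\<dots> \<le> sqrt A * \<Delta>_size n"
      by (rule sqrt_bound) fact
    finally show ?thesis .
  qed
  with A show thesis
    by (intro that[of "sqrt A"]) auto
qed

lemma int_Sum_\<Delta>: "integrable M (\<lambda>\<omega>. \<bar>\<Sum>k\<in>I. c k * \<Delta> (j k) \<omega>\<bar>)"
  by (intro integrable_arith int_\<Delta>)

lemma abs_moment_Sum_\<Delta>:
  "expectation (\<lambda>\<omega>. \<bar>\<Sum>k\<in>I. c k * \<Delta> (j k) \<omega>\<bar>) \<le> (\<Sum>k\<in>I. \<bar>c k\<bar> * mean_abs (\<Delta> (j k)))"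
proof -
  have "expectation (\<lambda>\<omega>. \<bar>\<Sum>k\<in>I. c k * \<Delta> (j k) \<omega>\<bar>) \<le> expectation (\<lambda>\<omega>. \<Sum>k\<in>I. \<bar>c k\<bar> * \<bar>\<Delta> (j k) \<omega>\<bar>)"
    by (intro integral_mono int_Sum_\<Delta> integrable_arith int_\<Delta>)
       (auto intro!: order_trans[OF sum_abs] sum_mono simp: abs_mult)
  also have "\<dots> = (\<Sum>k\<in>I. \<bar>c k\<bar> * mean_abs (\<Delta> (j k)))"
    by (subst Bochner_Integration.integral_sum) (auto intro!: integrable_mult_right integrable_abs int_\<Delta>)
  finally show ?thesis .
qed

text \<open>The factor by which averaging reduces the noise.\<close>

definition n\<gamma>_size :: "nat \<Rightarrow> real" where
  "n\<gamma>_size n = inverse (sqrt (real n * \<gamma> n))"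

lemma n\<gamma>_size_lim: "n\<gamma>_size \<longlonglongrightarrow> 0"
  unfolding n\<gamma>_size_def
  by (intro tendsto_inverse_0_at_top filterlim_compose[OF sqrt_at_top] n\<gamma>_lim)

text \<open>Division by \<open>n * \<gamma> n\<close> turns the error \<open>sqrt (\<gamma> n / h n)\<close> of the unaveraged estimator into
  \<open>1 / sqrt (n * h n)\<close>, the one of the averaged estimator, with the vanishing factor
  \<open>1 / sqrt (n * \<gamma> n)\<close> to spare.\<close>

lemma \<Delta>_size_eq:
  assumes "1 \<le> n"
  shows "w n / \<gamma> n / real n * \<Delta>_size n = w n * (noise_size n * n\<gamma>_size n + (h n)\<^sup>2 * (n\<gamma>_size n)\<^sup>2)"
proof -
  have pos: "0 < real n" "0 < \<gamma> n" "0 < h n"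
    using assms \<gamma>_pos h_pos by auto
  have "sqrt (\<gamma> n / h n) / (\<gamma> n * real n) = noise_size n * n\<gamma>_size n"
  proof -
    have "sqrt (\<gamma> n) * sqrt (\<gamma> n) = \<gamma> n" "sqrt (real n) * sqrt (real n) = real n"
      using pos by simp_all
    then have "sqrt (\<gamma> n) / (\<gamma> n * real n) = inverse (sqrt (\<gamma> n)) * inverse (sqrt (real n) * sqrt (real n))"
      using pos by (simp add: field_simps)
    then show ?thesis
      using pos by (simp add: noise_size_def n\<gamma>_size_def real_sqrt_divide real_sqrt_mult field_simps)
  qed
  moreover have "(h n)\<^sup>2 / (\<gamma> n * real n) = (h n)\<^sup>2 * (n\<gamma>_size n)\<^sup>2"
    using pos by (simp add: n\<gamma>_size_def power_inverse divide_inverse mult.commute)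
  moreover have "w n / \<gamma> n / real n * \<Delta>_size n
      = w n * (sqrt (\<gamma> n / h n) / (\<gamma> n * real n) + (h n)\<^sup>2 / (\<gamma> n * real n))"
    by (simp add: \<Delta>_size_def add_divide_distrib[symmetric])
  ultimately show ?thesis
    by simp
qed

end

context averaged_recursion
begin

lemma error_size_ge: "1 \<le> n \<Longrightarrow> noise_size n \<le> error_size n" "1 \<le> n \<Longrightarrow> (h n)\<^sup>2 \<le> error_size n"
  using noise_size_pos[of n] by (simp_all add: error_size_def)

lemma error_size_pos: "1 \<le> n \<Longrightarrow> 0 < error_size n"
  using noise_size_pos[of n] error_size_ge(1)[of n] by linarith

text \<open>Summation by parts moves the differences from \<open>\<Delta>\<close> to the weights \<open>w k * (1 / \<gamma> k - f)\<close>, whose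
  relative variation is of order \<open>1 / k\<close>.\<close>

lemma telescoping_bound:
  obtains B where "0 \<le> B" "\<And>n. 1 \<le> n \<Longrightarrow> mean_abs (telescoping_part n)
    \<le> B * (1 + w n / \<gamma> n * \<Delta>_size n + (\<Sum>k=1..n. w k / \<gamma> k / real k * \<Delta>_size k))"
proof -
  define u where "u k = w k * (1 / \<gamma> k - f)" for k
  have u_eq: "u k = w k / \<gamma> k - f * w k" for k
    by (simp add: u_def algebra_simps)
  obtain A where A: "0 \<le> A" "\<And>n. 1 \<le> n \<Longrightarrow> mean_abs (\<Delta> n) \<le> A * \<Delta>_size n"
    "\<And>n. 1 \<le> n \<Longrightarrow> mean_abs (\<Delta> (n - 1)) \<le> A * \<Delta>_size n"
    using abs_moment_\<Delta>_bound by blast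
  obtain G where G: "0 < G" "\<And>n. \<bar>\<gamma> n\<bar> \<le> G"
    using convergent_imp_Bseq[OF convergentI[OF \<gamma>_lim]] by (auto simp: Bseq_def)
  have w_le: "w k \<le> G * (w k / \<gamma> k)" if "1 \<le> k" for k
    using mult_right_mono[OF abs_le_D1[OF G(2)[of k]], of "w k / \<gamma> k"] w_pos[OF that] \<gamma>_pos[OF that] by simp
  obtain B1 where B1: "0 \<le> B1" "\<And>n. 1 \<le> n \<Longrightarrow> \<bar>w n / \<gamma> n - w (n - 1) / \<gamma> (n - 1)\<bar> \<le> B1 * (w n / \<gamma> n / real n)"
    using GS_bounded_increments[OF GS_divide[OF w \<gamma>]] by blast
  obtain B2 where B2: "0 \<le> B2" "\<And>n. 1 \<le> n \<Longrightarrow> \<bar>w n - w (n - 1)\<bar> \<le> B2 * (w n / real n)"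
    using GS_bounded_increments[OF w] by blast
  define U1 where "U1 = 1 + f * G"
  define U2 where "U2 = B1 + f * (B2 * G)"
  have U: "0 \<le> U1" "0 \<le> U2"
    using f_pos G(1) B1(1) B2(1) by (simp_all add: U1_def U2_def)
  have u_bound: "\<bar>u k\<bar> \<le> U1 * (w k / \<gamma> k)" if "1 \<le> k" for k
  proof -
    have "\<bar>u k\<bar> \<le> w k / \<gamma> k + f * w k"
      unfolding u_eq using abs_triangle_ineq4[of "w k / \<gamma> k" "f * w k"] w_pos[OF that] \<gamma>_pos[OF that] f_pos by simp
    also have "f * w k \<le> f * (G * (w k / \<gamma> k))"
      using w_le[OF that] f_pos by (intro mult_left_mono) auto
    finally show ?thesis
      by (simp only: U1_def distrib_right mult_1 mult.assoc)
  qed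
  have u_incr: "\<bar>u k - u (k - 1)\<bar> \<le> U2 * (w k / \<gamma> k / real k)" if "1 \<le> k" for k
  proof -
    have "u k - u (k - 1) = (w k / \<gamma> k - w (k - 1) / \<gamma> (k - 1)) - f * (w k - w (k - 1))"
      by (simp add: u_eq algebra_simps)
    then have "\<bar>u k - u (k - 1)\<bar> \<le> \<bar>w k / \<gamma> k - w (k - 1) / \<gamma> (k - 1)\<bar> + f * \<bar>w k - w (k - 1)\<bar>"
      using abs_triangle_ineq4[of "w k / \<gamma> k - w (k - 1) / \<gamma> (k - 1)" "f * (w k - w (k - 1))"] f_pos
      by (simp add: abs_mult)
    also have "\<dots> \<le> B1 * (w k / \<gamma> k / real k) + f * (B2 * (w k / real k))"
      using f_pos by (intro add_mono B1 B2 that mult_left_mono) auto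
    also have "w k / real k \<le> G * (w k / \<gamma> k) / real k"
      using w_le[OF that] by (intro divide_right_mono) auto
    finally have "\<bar>u k - u (k - 1)\<bar> \<le> B1 * (w k / \<gamma> k / real k) + f * (B2 * (G * (w k / \<gamma> k) / real k))"
      using f_pos B2(1) by (simp add: mult_left_mono)
    also have "\<dots> = U2 * (w k / \<gamma> k / real k)"
      by (simp add: U2_def distrib_right add_divide_distrib)
    finally show ?thesis .
  qed
  define B where "B = \<bar>u 1 * d0\<bar> + U1 * A + U2 * A"
  have B: "\<bar>u 1 * d0\<bar> \<le> B" "U1 * A \<le> B" "U2 * A \<le> B" "0 \<le> B"
    using U A(1) by (simp_all add: B_def)
  have "mean_abs (telescoping_part n)
    \<le> B * (1 + w n / \<gamma> n * \<Delta>_size n + (\<Sum>k=1..n. w k / \<gamma> k / real k * \<Delta>_size k))" if n: "1 \<le> n" for n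
  proof -
    define S where "S \<omega> = (\<Sum>k=2..n. (u k - u (k - 1)) * \<Delta> (k - 1) \<omega>)" for \<omega>
    have p_pos: "0 \<le> w k / \<gamma> k" if "1 \<le> k" for k
      using w_pos[OF that] \<gamma>_pos[OF that] by simp
    have term_nonneg: "0 \<le> w k / \<gamma> k / real k * \<Delta>_size k" if "1 \<le> k" for k
      by (intro mult_nonneg_nonneg divide_nonneg_nonneg[OF p_pos] less_imp_le[OF \<Delta>_size_pos] that) simp
    have "telescoping_part n \<omega> = u 1 * d0 - u n * \<Delta> n \<omega> + S \<omega>" for \<omega>
      using abel_summation[OF n, of u "\<lambda>k. \<Delta> k \<omega>"]
      by (simp add: telescoping_part_def u_def[symmetric] \<Delta>_0 S_def)
    then have "\<bar>telescoping_part n \<omega>\<bar> \<le> \<bar>u 1 * d0\<bar> + \<bar>u n\<bar> * \<bar>\<Delta> n \<omega>\<bar> + \<bar>S \<omega>\<bar>" for \<omega>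
      unfolding abs_mult[of "u n", symmetric] by (smt (verit) abs_triangle_ineq abs_triangle_ineq4)
    then have "mean_abs (telescoping_part n)
        \<le> expectation (\<lambda>\<omega>. \<bar>u 1 * d0\<bar> + \<bar>u n\<bar> * \<bar>\<Delta> n \<omega>\<bar> + \<bar>S \<omega>\<bar>)"
      unfolding telescoping_part_def S_def using int_Sum_\<Delta>
      by (intro integral_mono integrable_arith int_\<Delta>) auto
    also have "\<dots> = \<bar>u 1 * d0\<bar> + \<bar>u n\<bar> * mean_abs (\<Delta> n) + mean_abs S"
      using int_\<Delta> int_Sum_\<Delta>[where I = "{2..n}" and j = "\<lambda>k. k - 1" and c = "\<lambda>k. u k - u (k - 1)"]
      by (simp add: prob_space S_def)
    also have "\<bar>u 1 * d0\<bar> + \<bar>u n\<bar> * mean_abs (\<Delta> n) + mean_abs S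
        \<le> B * 1 + B * (w n / \<gamma> n * \<Delta>_size n) + B * (\<Sum>k=1..n. w k / \<gamma> k / real k * \<Delta>_size k)"
    proof (intro add_mono)
      show "\<bar>u 1 * d0\<bar> \<le> B * 1"
        using B by simp
      have "\<bar>u n\<bar> * mean_abs (\<Delta> n) \<le> (U1 * (w n / \<gamma> n)) * (A * \<Delta>_size n)"
        by (intro mult_mono u_bound A(2) n mult_nonneg_nonneg U p_pos) auto
      also have "\<dots> = (U1 * A) * (w n / \<gamma> n * \<Delta>_size n)"
        by simp
      also have "\<dots> \<le> B * (w n / \<gamma> n * \<Delta>_size n)"
        by (intro mult_right_mono B mult_nonneg_nonneg p_pos less_imp_le[OF \<Delta>_size_pos] n)
      finally show "\<bar>u n\<bar> * mean_abs (\<Delta> n) \<le> B * (w n / \<gamma> n * \<Delta>_size n)" .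
      have "mean_abs S \<le> (\<Sum>k=2..n. \<bar>u k - u (k - 1)\<bar> * mean_abs (\<Delta> (k - 1)))"
        unfolding S_def by (rule abs_moment_Sum_\<Delta>)
      also have "\<dots> \<le> (\<Sum>k=2..n. (U2 * (w k / \<gamma> k / real k)) * (A * \<Delta>_size k))"
      proof (rule sum_mono)
        fix k assume "k \<in> {2..n}"
        then have k: "1 \<le> k"
          by simp
        show "\<bar>u k - u (k - 1)\<bar> * mean_abs (\<Delta> (k - 1)) \<le> (U2 * (w k / \<gamma> k / real k)) * (A * \<Delta>_size k)"
          by (intro mult_mono u_incr A(3) k mult_nonneg_nonneg[OF U(2)] divide_nonneg_nonneg[OF p_pos]) auto
      qed
      also have "\<dots> = (U2 * A) * (\<Sum>k=2..n. w k / \<gamma> k / real k * \<Delta>_size k)"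
        by (simp add: sum_distrib_left mult.assoc mult.left_commute)
      also have "\<dots> \<le> B * (\<Sum>k=1..n. w k / \<gamma> k / real k * \<Delta>_size k)"
      proof (rule mult_mono)
        show "(\<Sum>k=2..n. w k / \<gamma> k / real k * \<Delta>_size k) \<le> (\<Sum>k=1..n. w k / \<gamma> k / real k * \<Delta>_size k)"
          by (rule sum_mono2) (use term_nonneg in auto)
        show "0 \<le> (\<Sum>k=2..n. w k / \<gamma> k / real k * \<Delta>_size k)"
          by (intro sum_nonneg term_nonneg) auto
      qed (use B in auto)
      finally show "mean_abs S \<le> B * (\<Sum>k=1..n. w k / \<gamma> k / real k * \<Delta>_size k)" .
    qed
    finally show ?thesis
      by (simp add: distrib_left)
  qed
  with B(4) show thesis
    by (rule that)
qed

text \<open>Two sums remain, one with the summands \<open>w k * noise_size k\<close> and one with \<open>w k * (h k)\<^sup>2\<close>, both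
  multiplied by null sequences; each is compared with the corresponding part of \<open>error_size\<close>.\<close>

lemma telescoping_negligible:
  "(\<lambda>n. mean_abs (telescoping_part n) / (Q n * error_size n)) \<longlonglongrightarrow> 0"
proof -
  obtain B where B: "0 \<le> B" "\<And>n. 1 \<le> n \<Longrightarrow> mean_abs (telescoping_part n)
    \<le> B * (1 + w n / \<gamma> n * \<Delta>_size n + (\<Sum>k=1..n. w k / \<gamma> k / real k * \<Delta>_size k))"
    using telescoping_bound by blast
  define e where "e n = n\<gamma>_size n" for n
  define S1 where "S1 n = (\<Sum>k=1..n. w k * noise_size k * e k)" for n
  define S2 where "S2 n = (\<Sum>k=1..n. w k * (h k)\<^sup>2 * (e k)\<^sup>2)" for n
  define G where "G n = B * (inverse (Q n * noise_size n) + real n * w n / Q n * (e n + (e n)\<^sup>2)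
      + S1 n / (Q n * noise_size n) + S2 n / (Q n * (h n)\<^sup>2))" for n
  have e_lim: "e \<longlonglongrightarrow> 0"
    using n\<gamma>_size_lim by (simp add: e_def[abs_def])
  have e2_lim: "(\<lambda>n. (e n)\<^sup>2) \<longlonglongrightarrow> 0"
    using tendsto_power[OF e_lim, of 2] by simp
  have "(\<lambda>n. inverse (Q n * noise_size n)) \<longlonglongrightarrow> 0"
  proof -
    have "(\<lambda>n. real n * (w n * noise_size n)) \<in> GS (1 + (- q + - ((1 - a) / 2)))"
      by (intro GS_mult GS_real w noise_size_GS)
    then have "filterlim (\<lambda>n. real n * (w n * noise_size n)) at_top sequentially"
      by (rule GS_tendsto_infinity) (use exponents in \<open>simp add: field_simps\<close>)
    then have "(\<lambda>n. inverse (real n * (w n * noise_size n))) \<longlonglongrightarrow> 0"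
      by (rule tendsto_inverse_0_at_top)
    from tendsto_mult[OF this Q_lim'] have "(\<lambda>n. inverse (real n * (w n * noise_size n)) * (real n * w n / Q n)) \<longlonglongrightarrow> 0"
      by simp
    moreover have "eventually (\<lambda>n. inverse (real n * (w n * noise_size n)) * (real n * w n / Q n) = inverse (Q n * noise_size n)) sequentially"
      using eventually_ge_at_top[of 1]
    proof eventually_elim
      case (elim n)
      then show ?case
        using w_pos[OF elim] Q_pos[OF elim] noise_size_pos[OF elim] by (simp add: field_simps)
    qed
    ultimately show ?thesis
      by (rule Lim_transform_eventually)
  qed
  moreover have "(\<lambda>n. real n * w n / Q n * (e n + (e n)\<^sup>2)) \<longlonglongrightarrow> (1 - q) * (0 + 0)"
    by (intro tendsto_intros Q_lim' e_lim e2_lim)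
  moreover have "(\<lambda>n. S1 n / (Q n * noise_size n)) \<longlonglongrightarrow> 0 * ((1 - q) / (1 - q + - ((1 - a) / 2)))"
    unfolding S1_def by (rule weighted_average_lim[OF noise_size_GS _ e_lim]) (use exponents in \<open>simp add: field_simps\<close>)
  moreover have "(\<lambda>n. S2 n / (Q n * (h n)\<^sup>2)) \<longlonglongrightarrow> 0 * ((1 - q) / (1 - q + (- 2 * a)))"
    unfolding S2_def by (rule weighted_average_lim[OF h2_GS _ e2_lim]) (use exponents in simp)
  ultimately have "G \<longlonglongrightarrow> B * (0 + (1 - q) * (0 + 0) + 0 * ((1 - q) / (1 - q + - ((1 - a) / 2)))
      + 0 * ((1 - q) / (1 - q + (- 2 * a))))"
    unfolding G_def by (intro tendsto_add tendsto_mult_left)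
  then have G_lim: "G \<longlonglongrightarrow> 0"
    by simp
  have "eventually (\<lambda>n. norm (mean_abs (telescoping_part n) / (Q n * error_size n)) \<le> G n) sequentially"
    using eventually_ge_at_top[of 1]
  proof eventually_elim
    case (elim n)
    have pos: "0 < Q n" "0 < noise_size n" "0 < error_size n" "0 < (h n)\<^sup>2" "0 < w n"
      using elim Q_pos noise_size_pos error_size_pos h_pos[OF elim] w_pos by auto
    have e_nonneg: "0 \<le> e k" if "1 \<le> k" for k
      using \<gamma>_pos[OF that] by (simp add: e_def n\<gamma>_size_def)
    have ge: "noise_size n \<le> error_size n" "(h n)\<^sup>2 \<le> error_size n"
      using error_size_ge elim by auto
    have weaken: "x / (Q n * error_size n) \<le> x / (Q n * y)" if "0 \<le> x" "0 < y" "y \<le> error_size n" for x y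
      using that pos by (intro divide_left_mono mult_left_mono mult_pos_pos) auto
    have S_nonneg: "0 \<le> S1 n" "0 \<le> S2 n"
      using w_pos noise_size_pos e_nonneg
      by (auto simp: S1_def S2_def intro!: sum_nonneg mult_nonneg_nonneg intro: less_imp_le)
    have sum_eq: "(\<Sum>k=1..n. w k / \<gamma> k / real k * \<Delta>_size k) = S1 n + S2 n"
      unfolding S1_def S2_def e_def sum.distrib[symmetric]
      by (intro sum.cong refl, subst \<Delta>_size_eq) (auto simp: distrib_left mult.assoc)
    have last_eq: "w n / \<gamma> n * \<Delta>_size n = real n * w n * (noise_size n * e n + (h n)\<^sup>2 * (e n)\<^sup>2)"
    proof -
      have "w n / \<gamma> n * \<Delta>_size n = real n * (w n / \<gamma> n / real n * \<Delta>_size n)"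
        using elim by simp
      then show ?thesis
        unfolding \<Delta>_size_eq[OF elim] by (simp add: e_def)
    qed
    have "real n * w n * (noise_size n * e n + (h n)\<^sup>2 * (e n)\<^sup>2) \<le> real n * w n * (error_size n * e n + error_size n * (e n)\<^sup>2)"
      using ge pos e_nonneg[OF elim] by (intro mult_left_mono add_mono mult_right_mono) auto
    then have last: "real n * w n * (noise_size n * e n + (h n)\<^sup>2 * (e n)\<^sup>2) / (Q n * error_size n)
        \<le> real n * w n / Q n * (e n + (e n)\<^sup>2)"
    proof -
      assume le: "real n * w n * (noise_size n * e n + (h n)\<^sup>2 * (e n)\<^sup>2)
          \<le> real n * w n * (error_size n * e n + error_size n * (e n)\<^sup>2)"
      have "real n * w n * (error_size n * e n + error_size n * (e n)\<^sup>2) / (Q n * error_size n)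
          = real n * w n / Q n * (e n + (e n)\<^sup>2)"
        using pos(1,3) by (simp add: field_simps)
      then show ?thesis
        using divide_right_mono[OF le, of "Q n * error_size n"] pos(1,3) by simp
    qed
    have "mean_abs (telescoping_part n) / (Q n * error_size n)
        \<le> B * (1 + w n / \<gamma> n * \<Delta>_size n + (\<Sum>k=1..n. w k / \<gamma> k / real k * \<Delta>_size k)) / (Q n * error_size n)"
      using B(2)[OF elim] pos by (intro divide_right_mono) auto
    also have "\<dots> = B * (1 / (Q n * error_size n)
        + real n * w n * (noise_size n * e n + (h n)\<^sup>2 * (e n)\<^sup>2) / (Q n * error_size n)
        + S1 n / (Q n * error_size n) + S2 n / (Q n * error_size n))"
      unfolding sum_eq last_eq by (simp add: add_divide_distrib distrib_left)
    also have "\<dots> \<le> G n"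
      unfolding G_def inverse_eq_divide
      by (intro mult_left_mono add_mono weaken last B(1) S_nonneg pos ge) auto
    finally show ?case
      using pos by simp
  qed
  then show ?thesis
    by (rule Lim_null_comparison) (rule G_lim)
qed

text \<open>The bias \<open>(h k)\<^sup>2\<close> of \<open>Z k\<close> alone is of the admissible order, and \<open>\<Delta>\<close> tends to \<open>0\<close> in \<open>L\<^sup>1\<close>.\<close>

lemma bias_negligible:
  "(\<lambda>n. mean_abs (bias_part n) / (Q n * error_size n)) \<longlonglongrightarrow> 0"
proof -
  obtain A where A: "0 \<le> A" "\<And>n. 1 \<le> n \<Longrightarrow> mean_abs (\<Delta> (n - 1)) \<le> A * \<Delta>_size n"
    by (rule abs_moment_\<Delta>_bound) (rule that)
  define S where "S n = (\<Sum>k=1..n. w k * (h k)\<^sup>2 * \<Delta>_size k)" for n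
  have "(\<lambda>n. S n / (Q n * (h n)\<^sup>2)) \<longlonglongrightarrow> 0 * ((1 - q) / (1 - q + (- 2 * a)))"
    unfolding S_def by (rule weighted_average_lim[OF h2_GS _ \<Delta>_size_lim]) (use exponents in simp)
  then have lim: "(\<lambda>n. C * A * (S n / (Q n * (h n)\<^sup>2))) \<longlonglongrightarrow> 0"
    using tendsto_mult_right_zero by force
  have "eventually (\<lambda>n. norm (mean_abs (bias_part n) / (Q n * error_size n))
      \<le> C * A * (S n / (Q n * (h n)\<^sup>2))) sequentially"
    using eventually_ge_at_top[of 1]
  proof eventually_elim
    case (elim n)
    have pos: "0 < Q n" "0 < error_size n" "0 < (h n)\<^sup>2"
      using elim Q_pos error_size_pos h_pos[OF elim] by auto
    have "mean_abs (bias_part n)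
        \<le> (\<Sum>k=1..n. \<bar>w k * (f - expectation (Z k))\<bar> * mean_abs (\<Delta> (k - 1)))"
      unfolding bias_part_def by (rule abs_moment_Sum_\<Delta>)
    also have "\<dots> \<le> (\<Sum>k=1..n. (w k * (C * (h k)\<^sup>2)) * (A * \<Delta>_size k))"
    proof (intro sum_mono mult_mono A)
      fix k assume "k \<in> {1..n}"
      then have k: "1 \<le> k"
        by simp
      have "\<bar>f - expectation (Z k)\<bar> \<le> C * (h k)\<^sup>2"
        using mean_Z[OF k] by (simp add: abs_minus_commute)
      then show "\<bar>w k * (f - expectation (Z k))\<bar> \<le> w k * (C * (h k)\<^sup>2)"
        using w_pos[OF k] by (simp add: abs_mult mult_left_mono)
      show "0 \<le> w k * (C * (h k)\<^sup>2)"
        using w_pos[OF k] C_nonneg by simp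
    qed auto
    also have "\<dots> = C * A * S n"
      unfolding S_def sum_distrib_left by (intro sum.cong refl) simp
    finally have le: "mean_abs (bias_part n) \<le> C * A * S n" .
    have "0 \<le> C * A * S n"
      by (rule order_trans[OF _ le]) simp
    have "mean_abs (bias_part n) / (Q n * error_size n) \<le> C * A * S n / (Q n * error_size n)"
      using le pos by (intro divide_right_mono) auto
    also have "\<dots> \<le> C * A * S n / (Q n * (h n)\<^sup>2)"
      using pos error_size_ge(2)[OF elim] \<open>0 \<le> C * A * S n\<close>
      by (intro divide_left_mono mult_left_mono mult_pos_pos) linarith+
    finally show ?case
      using pos by simp
  qed
  then show ?thesis
    by (rule Lim_null_comparison) (rule lim)
qed

text \<open>Both the main term and the martingale part of the remainder are sums of orthogonal
  increments whose variances are at most of order \<open>(w k)\<^sup>2 / h k\<close>.\<close>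

lemma weighted_variance_lim:
  assumes "y \<longlonglongrightarrow> l"
  shows "(\<lambda>n. (\<Sum>k=1..n. (w k)\<^sup>2 / h k * y k) / (Q n * noise_size n)\<^sup>2) \<longlonglongrightarrow> (1 - q)\<^sup>2 / (1 + a - 2 * q) * l"
proof -
  have GS: "(\<lambda>n. (w n)\<^sup>2 / h n) \<in> GS (2 * (- q) - (- a))"
    by (intro GS_divide GS_power2 w h)
  have "(\<lambda>n. (\<Sum>k=1..n. (w k)\<^sup>2 / h k * y k) / (real n * ((w n)\<^sup>2 / h n)) * (real n * w n / Q n)\<^sup>2)
      \<longlonglongrightarrow> l / (1 + (2 * (- q) - (- a))) * (1 - q)\<^sup>2"
    by (intro tendsto_intros GS_sum[OF GS _ assms] Q_lim') (use exponents in simp)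
  moreover have "eventually (\<lambda>n. (\<Sum>k=1..n. (w k)\<^sup>2 / h k * y k) / (real n * ((w n)\<^sup>2 / h n)) * (real n * w n / Q n)\<^sup>2
      = (\<Sum>k=1..n. (w k)\<^sup>2 / h k * y k) / (Q n * noise_size n)\<^sup>2) sequentially"
    using eventually_ge_at_top[of 1]
  proof eventually_elim
    case (elim n)
    have pos: "0 < real n" "0 < h n" "0 < w n" "0 < Q n"
      using elim h_pos w_pos Q_pos by auto
    have noise: "(noise_size n)\<^sup>2 = inverse (real n * h n)"
      using pos by (simp add: noise_size_def power_inverse)
    have "s / (real n * ((w n)\<^sup>2 / h n)) * (real n * w n / Q n)\<^sup>2 = s / (Q n * noise_size n)\<^sup>2" for s
      unfolding power_mult_distrib[of "Q n"] noise
      using pos by (simp add: power_mult_distrib power_divide field_simps) (simp add: power2_eq_square)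
    then show ?case
      by simp
  qed
  ultimately have "(\<lambda>n. (\<Sum>k=1..n. (w k)\<^sup>2 / h k * y k) / (Q n * noise_size n)\<^sup>2)
      \<longlonglongrightarrow> l / (1 + (2 * (- q) - (- a))) * (1 - q)\<^sup>2"
    by (rule Lim_transform_eventually)
  then show ?thesis
    by (rule tendsto_eq_rhs) (simp add: algebra_simps)
qed

lemma abs_moment_le_noise_size:
  assumes meas: "\<And>n. S n \<in> borel_measurable M" and int: "\<And>n. integrable M (\<lambda>\<omega>. (S n \<omega>)\<^sup>2)"
    and bound: "\<And>n. mean_square (S n) \<le> (\<Sum>k=1..n. (w k)\<^sup>2 / h k * y k)"
    and y: "y \<longlonglongrightarrow> l"
  obtains e where "\<And>n. 1 \<le> n \<Longrightarrow> mean_abs (S n) / (Q n * noise_size n) \<le> e n"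
    "e \<longlonglongrightarrow> sqrt ((1 - q)\<^sup>2 / (1 + a - 2 * q) * l)"
proof
  let ?e = "\<lambda>n. sqrt ((\<Sum>k=1..n. (w k)\<^sup>2 / h k * y k) / (Q n * noise_size n)\<^sup>2)"
  show "?e \<longlonglongrightarrow> sqrt ((1 - q)\<^sup>2 / (1 + a - 2 * q) * l)"
    by (intro tendsto_intros weighted_variance_lim y)
  fix n :: nat assume n: "1 \<le> n"
  have pos: "0 < Q n * noise_size n"
    using Q_pos[OF n] noise_size_pos[OF n] by simp
  have "mean_abs (S n) \<le> sqrt (\<Sum>k=1..n. (w k)\<^sup>2 / h k * y k)"
    by (rule order_trans[OF abs_expectation_le_sqrt[OF meas int] real_sqrt_le_mono[OF bound]])
  then have "mean_abs (S n) / (Q n * noise_size n) \<le> sqrt (\<Sum>k=1..n. (w k)\<^sup>2 / h k * y k) / (Q n * noise_size n)"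
    using pos by (intro divide_right_mono) auto
  also have "\<dots> = ?e n"
    using pos by (simp add: real_sqrt_divide)
  finally show "mean_abs (S n) / (Q n * noise_size n) \<le> ?e n" .
qed

text \<open>The variances of the increments are of the order of those of the main term times the second
  moment of \<open>\<Delta>\<close>, which tends to \<open>0\<close>.\<close>

lemma martingale_negligible:
  "(\<lambda>n. mean_abs (martingale_part n) / (Q n * error_size n)) \<longlonglongrightarrow> 0"
    and int_martingale_part: "integrable M (martingale_part n)"
proof -
  obtain A where A: "0 \<le> A"
    "\<And>n. 1 \<le> n \<Longrightarrow> mean_square (\<Delta> (n - 1)) \<le> A * (\<gamma> n / h n + h n ^ 4)"
    by (rule second_moment_\<Delta>_bound) (rule that)
  define \<phi> where "\<phi> k p = w k * (expectation (Z k) - fst p)" for k and p :: "real \<times> real"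
  have \<phi>: "\<phi> k \<in> borel_measurable borel" for k
    unfolding \<phi>_def by (intro borel_measurable_continuous_onI continuous_intros)
  have \<phi>_sq: "(\<phi> k (Z k \<omega>, V k \<omega>))\<^sup>2 = (w k)\<^sup>2 * (Z k \<omega> - expectation (Z k))\<^sup>2" for k \<omega>
    by (simp add: \<phi>_def power_mult_distrib power2_commute)
  have int_var: "integrable M (\<lambda>\<omega>. (Z k \<omega> - expectation (Z k))\<^sup>2)" if "1 \<le> k" for k
    unfolding power2_diff using int_Z[OF that] int_Z2[OF that] by simp
  have centred: "expectation (\<lambda>\<omega>. \<phi> k (Z k \<omega>, V k \<omega>)) = 0" if "1 \<le> k" for k
    using int_Z[OF that] by (simp add: \<phi>_def prob_space)
  have eq: "martingale_part n \<omega> = (\<Sum>k=1..n. \<Delta> (k - 1) \<omega> * \<phi> k (Z k \<omega>, V k \<omega>))" for n \<omega>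
    by (simp add: martingale_part_def \<phi>_def)
  have int_\<phi>: "integrable M (\<lambda>\<omega>. (\<phi> k (Z k \<omega>, V k \<omega>))\<^sup>2)" if "1 \<le> k" for k
    unfolding \<phi>_sq using int_var[OF that] by simp
  note orth = second_moment_martingale[where A = \<Delta> and \<phi> = \<phi>, OF \<Delta>_past int_\<Delta>2 \<phi> int_\<phi> centred]
  have meas: "martingale_part n \<in> borel_measurable M" for n
    unfolding martingale_part_def by (intro borel_measurable_sum borel_measurable_times) auto
  have int2: "integrable M (\<lambda>\<omega>. (martingale_part n \<omega>)\<^sup>2)" for n
    unfolding eq by (rule orth(1))
  then show "integrable M (martingale_part n)"
    by (rule square_integrable_imp_integrable[OF meas])
  have second: "mean_square (martingale_part n)
      = (\<Sum>k=1..n. mean_square (\<Delta> (k - 1)) * expectation (\<lambda>\<omega>. (\<phi> k (Z k \<omega>, V k \<omega>))\<^sup>2))" for n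
    unfolding eq by (rule orth(2))
  have bound: "mean_square (martingale_part n)
      \<le> (\<Sum>k=1..n. (w k)\<^sup>2 / h k * (A * C * (\<gamma> k / h k + h k ^ 4)))" for n
    unfolding second
  proof (rule sum_mono)
    fix k assume "k \<in> {1..n}"
    then have k: "1 \<le> k"
      by simp
    have pos: "0 < \<gamma> k" "0 < h k"
      using k \<gamma>_pos h_pos by auto
    have "expectation (\<lambda>\<omega>. (Z k \<omega> - expectation (Z k))\<^sup>2) \<le> mean_square (Z k)"
      using variance_eq[OF int_Z[OF k] int_Z2[OF k]] by simp
    also have "\<dots> \<le> C / h k"
      by (rule second_Z[OF k])
    finally have "(w k)\<^sup>2 * expectation (\<lambda>\<omega>. (Z k \<omega> - expectation (Z k))\<^sup>2) \<le> (w k)\<^sup>2 * (C / h k)"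
      by (intro mult_left_mono) auto
    then have "expectation (\<lambda>\<omega>. (\<phi> k (Z k \<omega>, V k \<omega>))\<^sup>2) \<le> (w k)\<^sup>2 * (C / h k)"
      unfolding \<phi>_sq by simp
    then have "mean_square (\<Delta> (k - 1)) * expectation (\<lambda>\<omega>. (\<phi> k (Z k \<omega>, V k \<omega>))\<^sup>2)
        \<le> (A * (\<gamma> k / h k + h k ^ 4)) * ((w k)\<^sup>2 * (C / h k))"
      using A(1) pos by (intro mult_mono A(2)[OF k]) auto
    also have "\<dots> = (w k)\<^sup>2 / h k * (A * C * (\<gamma> k / h k + h k ^ 4))"
      by simp
    finally show "mean_square (\<Delta> (k - 1)) * expectation (\<lambda>\<omega>. (\<phi> k (Z k \<omega>, V k \<omega>))\<^sup>2)
        \<le> (w k)\<^sup>2 / h k * (A * C * (\<gamma> k / h k + h k ^ 4))" .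
  qed
  have "(\<lambda>n. A * C * (\<gamma> n / h n + h n ^ 4)) \<longlonglongrightarrow> A * C * (0 + 0 ^ 4)"
    by (intro tendsto_intros \<gamma>_over_h_lim h_lim)
  then have "(\<lambda>n. A * C * (\<gamma> n / h n + h n ^ 4)) \<longlonglongrightarrow> 0"
    by simp
  from abs_moment_le_noise_size[OF meas int2 bound this] obtain e
    where e: "\<And>n. 1 \<le> n \<Longrightarrow> mean_abs (martingale_part n) / (Q n * noise_size n) \<le> e n"
      "e \<longlonglongrightarrow> sqrt ((1 - q)\<^sup>2 / (1 + a - 2 * q) * 0)" by blast
  have "eventually (\<lambda>n. norm (mean_abs (martingale_part n) / (Q n * error_size n)) \<le> e n) sequentially"
    using eventually_ge_at_top[of 1]
  proof eventually_elim
    case (elim n)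
    have pos: "0 < Q n" "0 < error_size n" "0 < noise_size n"
      using elim Q_pos error_size_pos noise_size_pos by auto
    have "mean_abs (martingale_part n) / (Q n * error_size n)
        \<le> mean_abs (martingale_part n) / (Q n * noise_size n)"
      using pos error_size_ge(1)[OF elim] by (intro divide_left_mono mult_left_mono mult_pos_pos) auto
    also have "\<dots> \<le> e n"
      by (rule e(1)[OF elim])
    finally show ?case
      using pos by simp
  qed
  then show "(\<lambda>n. mean_abs (martingale_part n) / (Q n * error_size n)) \<longlonglongrightarrow> 0"
    by (rule Lim_null_comparison) (use e(2) in simp)
qed

lemma int_remainder: "integrable M (remainder n)"
  unfolding remainder_def
  by (intro integrable_arith int_\<Delta> int_V) auto

lemma remainder_negligible:
  "(\<lambda>n. mean_abs (remainder n) / (Q n * error_size n)) \<longlonglongrightarrow> 0"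
proof -
  have ints: "integrable M (telescoping_part n)" "integrable M (bias_part n)" for n
    unfolding telescoping_part_def bias_part_def
    by (intro integrable_arith int_\<Delta>)+
  have le: "mean_abs (remainder n) \<le> mean_abs (telescoping_part n)
      + mean_abs (bias_part n) + mean_abs (martingale_part n)" for n
  proof -
    have "mean_abs (remainder n)
        \<le> expectation (\<lambda>\<omega>. \<bar>telescoping_part n \<omega>\<bar> + \<bar>bias_part n \<omega>\<bar> + \<bar>martingale_part n \<omega>\<bar>)"
      using ints int_martingale_part int_remainder
      by (intro integral_mono integrable_arith) (auto simp: remainder_decomposition)
    then show ?thesis
      using ints[of n] int_martingale_part[of n] by simp
  qed
  have "(\<lambda>n. mean_abs (telescoping_part n) / (Q n * error_size n)
      + mean_abs (bias_part n) / (Q n * error_size n)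
      + mean_abs (martingale_part n) / (Q n * error_size n)) \<longlonglongrightarrow> 0 + 0 + 0"
    by (intro tendsto_add telescoping_negligible bias_negligible martingale_negligible)
  then have lim: "(\<lambda>n. (mean_abs (telescoping_part n) + mean_abs (bias_part n)
      + mean_abs (martingale_part n)) / (Q n * error_size n)) \<longlonglongrightarrow> 0"
    by (simp add: add_divide_distrib)
  have "eventually (\<lambda>n. norm (mean_abs (remainder n) / (Q n * error_size n))
    \<le> (mean_abs (telescoping_part n) + mean_abs (bias_part n)
      + mean_abs (martingale_part n)) / (Q n * error_size n)) sequentially"
    using eventually_ge_at_top[of 1]
  proof eventually_elim
    case (elim n)
    have pos: "0 < Q n" "0 < error_size n"
      using elim Q_pos error_size_pos by auto
    then have "mean_abs (remainder n) / (Q n * error_size n)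
      \<le> (mean_abs (telescoping_part n) + mean_abs (bias_part n)
        + mean_abs (martingale_part n)) / (Q n * error_size n)"
      using le[of n] by (intro divide_right_mono) auto
    then show ?case
      using pos by simp
  qed
  then show ?thesis
    by (rule Lim_null_comparison) (rule lim)
qed

end

section \<open>Limit theorems for the averaged recursion\<close>

lemma abs_diff_cube_le: "\<bar>x - y\<bar> ^ 3 \<le> 4 * (\<bar>x\<bar> ^ 3 + \<bar>y\<bar> ^ 3)" for x y :: real
proof -
  have "\<bar>x - y\<bar> ^ 3 \<le> (\<bar>x\<bar> + \<bar>y\<bar>) ^ 3"
    by (intro power_mono abs_triangle_ineq4) simp
  moreover have "4 * (\<bar>x\<bar> ^ 3 + \<bar>y\<bar> ^ 3) - (\<bar>x\<bar> + \<bar>y\<bar>) ^ 3 = 3 * ((\<bar>x\<bar> + \<bar>y\<bar>) * (\<bar>x\<bar> - \<bar>y\<bar>)\<^sup>2)"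
    by (simp add: power3_eq_cube power2_eq_square algebra_simps del: abs_mult_self_eq)
  moreover have "0 \<le> (\<bar>x\<bar> + \<bar>y\<bar>) * (\<bar>x\<bar> - \<bar>y\<bar>)\<^sup>2"
    by simp
  ultimately show ?thesis
    by linarith
qed

context averaged_recursion
begin

definition average :: "nat \<Rightarrow> 'a \<Rightarrow> real" where
  "average n \<omega> = (\<Sum>k=1..n. w k * \<Delta> k \<omega>) / Q n"

definition mean_part :: "nat \<Rightarrow> real" where
  "mean_part n = (\<Sum>k=1..n. w k * expectation (V k))"

definition centred_sum :: "nat \<Rightarrow> 'a \<Rightarrow> real" where
  "centred_sum n \<omega> = (\<Sum>k=1..n. w k * (V k \<omega> - expectation (V k)))"

lemma average_decomposition:
  "average n \<omega> = (centred_sum n \<omega> + mean_part n + remainder n \<omega>) / (f * Q n)"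
proof -
  have "centred_sum n \<omega> + mean_part n = (\<Sum>k=1..n. w k * V k \<omega>)"
    by (simp add: centred_sum_def mean_part_def algebra_simps flip: sum.distrib)
  then have "centred_sum n \<omega> + mean_part n + remainder n \<omega> = f * (\<Sum>k=1..n. w k * \<Delta> k \<omega>)"
    by (simp add: remainder_def)
  then show ?thesis
    using f_pos by (simp add: average_def)
qed

lemma int_average: "integrable M (average n)"
  unfolding average_def by (intro integrable_arith int_\<Delta>)

lemma int_centred_sum: "integrable M (centred_sum n)"
  unfolding centred_sum_def
  by (intro integrable_arith int_V) auto

lemma mean_part_lim: "(\<lambda>n. mean_part n / (Q n * (h n)\<^sup>2)) \<longlonglongrightarrow> b * ((1 - q) / (1 - q - 2 * a))"
proof -
  have "(\<lambda>n. (\<Sum>k=1..n. w k * (h k)\<^sup>2 * (expectation (V k) / (h k)\<^sup>2)) / (Q n * (h n)\<^sup>2))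
      \<longlonglongrightarrow> b * ((1 - q) / (1 - q + (- 2 * a)))"
    by (rule weighted_average_lim[OF h2_GS _ mean_V]) (use exponents in simp)
  moreover have "(\<Sum>k=1..n. w k * (h k)\<^sup>2 * (expectation (V k) / (h k)\<^sup>2)) = mean_part n" for n
    unfolding mean_part_def
  proof (intro sum.cong refl)
    fix k assume "k \<in> {1..n}"
    then have "h k \<noteq> 0"
      using h_pos[of k] by auto
    then show "w k * (h k)\<^sup>2 * (expectation (V k) / (h k)\<^sup>2) = w k * expectation (V k)"
      by simp
  qed
  ultimately show ?thesis
    by simp
qed

definition centred_second :: "nat \<Rightarrow> real" where
  "centred_second k = expectation (\<lambda>\<omega>. (V k \<omega> - expectation (V k))\<^sup>2)"

lemma int_centred_second: "1 \<le> k \<Longrightarrow> integrable M (\<lambda>\<omega>. (V k \<omega> - expectation (V k))\<^sup>2)"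
  unfolding power2_diff using int_V[of k] int_V2[of k] by simp

lemma centred_second_lim: "(\<lambda>k. h k * centred_second k) \<longlonglongrightarrow> \<tau>"
proof -
  have "(\<lambda>k. h k * mean_square (V k) - h k ^ 5 * (expectation (V k) / (h k)\<^sup>2)\<^sup>2) \<longlonglongrightarrow> \<tau> - 0 ^ 5 * b\<^sup>2"
    by (intro tendsto_intros second_V mean_V h_lim)
  moreover have "eventually (\<lambda>k. h k * mean_square (V k) - h k ^ 5 * (expectation (V k) / (h k)\<^sup>2)\<^sup>2
      = h k * centred_second k) sequentially"
    using eventually_ge_at_top[of 1]
  proof eventually_elim
    case (elim k)
    have "h k ^ 5 * (expectation (V k) / (h k)\<^sup>2)\<^sup>2 = h k * (expectation (V k))\<^sup>2"
      using h_pos[OF elim] by (simp add: field_simps power2_eq_square eval_nat_numeral)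
    then show ?case
      using variance_eq[OF int_V[OF elim] int_V2[OF elim]] by (simp add: centred_second_def right_diff_distrib)
  qed
  ultimately show ?thesis
    using Lim_transform_eventually by fastforce
qed

lemma second_moment_centred_sum:
  "integrable M (\<lambda>\<omega>. (centred_sum n \<omega>)\<^sup>2)"
  "mean_square (centred_sum n) = (\<Sum>k=1..n. (w k)\<^sup>2 / h k * (h k * centred_second k))"
proof -
  define \<phi> where "\<phi> k p = w k * (snd p - expectation (V k))" for k and p :: "real \<times> real"
  have \<phi>: "\<phi> k \<in> borel_measurable borel" for k
    unfolding \<phi>_def by (intro borel_measurable_continuous_onI continuous_intros)
  have \<phi>_sq: "(\<phi> k (Z k \<omega>, V k \<omega>))\<^sup>2 = (w k)\<^sup>2 * (V k \<omega> - expectation (V k))\<^sup>2" for k \<omega>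
    by (simp add: \<phi>_def power_mult_distrib)
  have int_\<phi>: "integrable M (\<lambda>\<omega>. (\<phi> k (Z k \<omega>, V k \<omega>))\<^sup>2)" if "1 \<le> k" for k
    unfolding \<phi>_sq using int_centred_second[OF that] by simp
  have centred: "expectation (\<lambda>\<omega>. \<phi> k (Z k \<omega>, V k \<omega>)) = 0" if "1 \<le> k" for k
    using int_V[OF that] by (simp add: \<phi>_def prob_space)
  have one: "(\<lambda>_ :: 'a. 1 :: real) \<in> borel_measurable (past n)" "integrable M (\<lambda>_. (1::real)\<^sup>2)" for n
    by simp_all
  have eq: "centred_sum n \<omega> = (\<Sum>k=1..n. 1 * \<phi> k (Z k \<omega>, V k \<omega>))" for n \<omega>
    by (simp add: centred_sum_def \<phi>_def)
  note orth = second_moment_martingale[where A = "\<lambda>_ _. 1" and \<phi> = \<phi>, OF one \<phi> int_\<phi> centred]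
  show "integrable M (\<lambda>\<omega>. (centred_sum n \<omega>)\<^sup>2)"
    unfolding eq by (rule orth(1))
  have "mean_square (centred_sum n)
      = (\<Sum>k=1..n. expectation (\<lambda>_. 1\<^sup>2) * expectation (\<lambda>\<omega>. (\<phi> k (Z k \<omega>, V k \<omega>))\<^sup>2))"
    unfolding eq by (rule orth(2))
  also have "\<dots> = (\<Sum>k=1..n. (w k)\<^sup>2 / h k * (h k * centred_second k))"
  proof (intro sum.cong refl)
    fix k assume "k \<in> {1..n}"
    then have "h k \<noteq> 0"
      using h_pos[of k] by auto
    then show "expectation (\<lambda>_. 1\<^sup>2) * expectation (\<lambda>\<omega>. (\<phi> k (Z k \<omega>, V k \<omega>))\<^sup>2) = (w k)\<^sup>2 / h k * (h k * centred_second k)"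
      unfolding \<phi>_sq by (simp add: prob_space centred_second_def)
  qed
  finally show "mean_square (centred_sum n) = (\<Sum>k=1..n. (w k)\<^sup>2 / h k * (h k * centred_second k))" .
qed

lemma h2_over_noise_size: "(h n)\<^sup>2 / noise_size n = sqrt (real n * h n ^ 5)"
proof -
  have "real n * h n ^ 5 = (real n * h n) * ((h n)\<^sup>2)\<^sup>2"
    by (simp add: power2_eq_square eval_nat_numeral)
  then have "sqrt (real n * h n ^ 5) = sqrt (real n * h n) * (h n)\<^sup>2"
    by (simp only: real_sqrt_mult[of "real n * h n"] real_sqrt_abs abs_power2)
  then show ?thesis
    by (simp add: noise_size_def divide_inverse mult.commute)
qed

text \<open>On the scale \<open>(h n)\<^sup>2\<close> the noise has size \<open>1 / sqrt (n * h n ^ 5)\<close> and only the bias survives.\<close>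

theorem conv_in_probability_average:
  assumes nh5: "filterlim (\<lambda>n. real n * h n ^ 5) at_top sequentially"
  shows "conv_in_probability M (\<lambda>n \<omega>. 1 / (h n)\<^sup>2 * average n \<omega>) ((1 - q) / (1 - q - 2 * a) * (b / f))"
proof (rule conv_in_probabilityI)
  show "integrable M (\<lambda>\<omega>. 1 / (h n)\<^sup>2 * average n \<omega>)" for n
    by (intro integrable_mult_right int_average)
  define l where "l = b * ((1 - q) / (1 - q - 2 * a))"
  have c: "(1 - q) / (1 - q - 2 * a) * (b / f) = l / f"
    by (simp add: l_def)
  obtain e where e: "\<And>n. 1 \<le> n \<Longrightarrow> mean_abs (centred_sum n) / (Q n * noise_size n) \<le> e n"
    "e \<longlonglongrightarrow> sqrt ((1 - q)\<^sup>2 / (1 + a - 2 * q) * \<tau>)"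
    using abs_moment_le_noise_size[OF borel_measurable_integrable[OF int_centred_sum] second_moment_centred_sum(1)
        eq_refl[OF second_moment_centred_sum(2)] centred_second_lim] by blast
  define \<rho> where "\<rho> n = inverse (sqrt (real n * h n ^ 5))" for n
  have \<rho>_lim: "\<rho> \<longlonglongrightarrow> 0"
    unfolding \<rho>_def by (intro tendsto_inverse_0_at_top filterlim_compose[OF sqrt_at_top] nh5)
  have \<rho>: "noise_size n = \<rho> n * (h n)\<^sup>2" if "1 \<le> n" for n
    unfolding \<rho>_def h2_over_noise_size[symmetric] using h_pos[OF that] by simp
  define r where "r n = mean_abs (remainder n) / (Q n * error_size n)" for n
  define G where "G n = (e n * \<rho> n + \<bar>mean_part n / (Q n * (h n)\<^sup>2) - l\<bar> + r n * (\<rho> n + 1)) / f" for n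
  have "G \<longlonglongrightarrow> (sqrt ((1 - q)\<^sup>2 / (1 + a - 2 * q) * \<tau>) * 0 + \<bar>l - l\<bar> + 0 * (0 + 1)) / f"
    unfolding G_def l_def r_def
    using f_pos by (intro tendsto_intros e \<rho>_lim mean_part_lim remainder_negligible) simp
  then have G_lim: "G \<longlonglongrightarrow> 0"
    by simp
  have "eventually (\<lambda>n. norm (expectation (\<lambda>\<omega>. \<bar>1 / (h n)\<^sup>2 * average n \<omega> - l / f\<bar>)) \<le> G n) sequentially"
    using eventually_ge_at_top[of 1]
  proof eventually_elim
    case (elim n)
    have pos: "0 < Q n" "0 < h n" "0 < noise_size n" "0 < error_size n"
      using elim Q_pos h_pos noise_size_pos error_size_pos by auto
    let ?d = "Q n * (h n)\<^sup>2"
    have "0 < ?d"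
      using pos by simp
    have "1 / (h n)\<^sup>2 * average n \<omega> - l / f
        = (centred_sum n \<omega> / ?d + (mean_part n / ?d - l) + remainder n \<omega> / ?d) / f" for \<omega>
      using pos f_pos by (simp add: average_decomposition field_simps)
    then have "\<bar>1 / (h n)\<^sup>2 * average n \<omega> - l / f\<bar>
        = \<bar>centred_sum n \<omega> / ?d + (mean_part n / ?d - l) + remainder n \<omega> / ?d\<bar> / f" for \<omega>
      using f_pos by simp
    moreover have "\<bar>centred_sum n \<omega> / ?d + (mean_part n / ?d - l) + remainder n \<omega> / ?d\<bar>
        \<le> \<bar>centred_sum n \<omega>\<bar> / ?d + \<bar>mean_part n / ?d - l\<bar> + \<bar>remainder n \<omega>\<bar> / ?d" for \<omega>
      unfolding abs_div_pos[OF \<open>0 < ?d\<close>]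
      using abs_triangle_ineq[of "centred_sum n \<omega> / ?d + (mean_part n / ?d - l)" "remainder n \<omega> / ?d"]
        abs_triangle_ineq[of "centred_sum n \<omega> / ?d" "mean_part n / ?d - l"] by linarith
    ultimately have "\<bar>1 / (h n)\<^sup>2 * average n \<omega> - l / f\<bar>
        \<le> (\<bar>centred_sum n \<omega>\<bar> / ?d + \<bar>mean_part n / ?d - l\<bar> + \<bar>remainder n \<omega>\<bar> / ?d) / f" for \<omega>
      using f_pos by (simp add: divide_right_mono)
    then have "expectation (\<lambda>\<omega>. \<bar>1 / (h n)\<^sup>2 * average n \<omega> - l / f\<bar>)
        \<le> expectation (\<lambda>\<omega>. (\<bar>centred_sum n \<omega>\<bar> / ?d + \<bar>mean_part n / ?d - l\<bar> + \<bar>remainder n \<omega>\<bar> / ?d) / f)"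
      by (intro integral_mono integrable_arith int_average int_centred_sum int_remainder) auto
    also have "\<dots> = (mean_abs (centred_sum n) / ?d + \<bar>mean_part n / ?d - l\<bar>
        + mean_abs (remainder n) / ?d) / f"
      using int_centred_sum[of n] int_remainder[of n] by (simp add: prob_space)
    also have "\<dots> \<le> G n"
      unfolding G_def
    proof (intro divide_right_mono add_mono order_refl)
      have "mean_abs (centred_sum n) / ?d
          = mean_abs (centred_sum n) / (Q n * noise_size n) * \<rho> n"
      proof -
        have "\<rho> n \<noteq> 0"
          using \<rho>[OF elim] pos by auto
        then show ?thesis
          unfolding \<rho>[OF elim] by simp
      qed
      also have "\<dots> \<le> e n * \<rho> n"
        using pos by (intro mult_right_mono e elim) (simp add: \<rho>_def)
      finally show "mean_abs (centred_sum n) / ?d \<le> e n * \<rho> n" .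
      have "error_size n = (\<rho> n + 1) * (h n)\<^sup>2"
        using \<rho>[OF elim] by (simp add: error_size_def algebra_simps)
      then show "mean_abs (remainder n) / ?d \<le> r n * (\<rho> n + 1)"
        using pos unfolding r_def by (simp add: zero_less_mult_iff)
    qed (use f_pos in simp)
    finally show ?case
      by simp
  qed
  then show "(\<lambda>n. expectation (\<lambda>\<omega>. \<bar>1 / (h n)\<^sup>2 * average n \<omega> - (1 - q) / (1 - q - 2 * a) * (b / f)\<bar>)) \<longlonglongrightarrow> 0"
    unfolding c by (rule Lim_null_comparison) (rule G_lim)
qed

lemma third_moment_bound:
  obtains B where "0 \<le> B"
    "\<And>k. 1 \<le> k \<Longrightarrow> expectation (\<lambda>\<omega>. \<bar>V k \<omega> - expectation (V k)\<bar> ^ 3) \<le> B / (h k)\<^sup>2"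
    "\<And>k. 1 \<le> k \<Longrightarrow> integrable M (\<lambda>\<omega>. \<bar>V k \<omega> - expectation (V k)\<bar> ^ 3)"
proof -
  obtain B where B: "0 \<le> B" "\<And>n. 1 \<le> n \<Longrightarrow> \<bar>expectation (V n)\<bar> \<le> B * (h n)\<^sup>2"
    using mean_V_bound by blast
  obtain H where H: "0 < H" "\<And>n. \<bar>h n\<bar> \<le> H"
    using convergent_imp_Bseq[OF convergentI[OF h_lim]] by (auto simp: Bseq_def)
  have int: "integrable M (\<lambda>\<omega>. \<bar>V k \<omega> - expectation (V k)\<bar> ^ 3)" if "1 \<le> k" for k
  proof (rule Bochner_Integration.integrable_bound)
    show "integrable M (\<lambda>\<omega>. 4 * (\<bar>V k \<omega>\<bar> ^ 3 + \<bar>expectation (V k)\<bar> ^ 3))"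
      using int_V3[OF that] by simp
  qed (use that abs_diff_cube_le in \<open>auto intro!: AE_I2\<close>)
  have "expectation (\<lambda>\<omega>. \<bar>V k \<omega> - expectation (V k)\<bar> ^ 3) \<le> 4 * (C + B ^ 3 * H ^ 8) / (h k)\<^sup>2" if k: "1 \<le> k" for k
  proof -
    have "expectation (\<lambda>\<omega>. \<bar>V k \<omega> - expectation (V k)\<bar> ^ 3)
        \<le> expectation (\<lambda>\<omega>. 4 * (\<bar>V k \<omega>\<bar> ^ 3 + \<bar>expectation (V k)\<bar> ^ 3))"
      using int_V3[OF k] by (intro integral_mono int k abs_diff_cube_le) simp
    also have "\<dots> = 4 * (mean_cube (V k) + \<bar>expectation (V k)\<bar> ^ 3)"
      using int_V3[OF k] by (simp add: prob_space)
    also have "\<dots> \<le> 4 * (C / (h k)\<^sup>2 + B ^ 3 * H ^ 8 / (h k)\<^sup>2)"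
    proof (intro mult_left_mono add_mono third_V k)
      have "\<bar>expectation (V k)\<bar> ^ 3 \<le> (B * (h k)\<^sup>2) ^ 3"
        by (intro power_mono B k) simp
      also have "\<dots> = B ^ 3 * h k ^ 8 / (h k)\<^sup>2"
        using h_pos[OF k] by (simp add: power_mult_distrib power_mult[symmetric] field_simps power_add[symmetric])
      also have "\<dots> \<le> B ^ 3 * H ^ 8 / (h k)\<^sup>2"
        using H(2)[of k] h_pos[OF k] B(1) by (intro divide_right_mono mult_left_mono power_mono) auto
      finally show "\<bar>expectation (V k)\<bar> ^ 3 \<le> B ^ 3 * H ^ 8 / (h k)\<^sup>2" .
    qed simp
    also have "\<dots> = 4 * (C + B ^ 3 * H ^ 8) / (h k)\<^sup>2"
      by (simp add: add_divide_distrib)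
    finally show ?thesis .
  qed
  with int C_nonneg B(1) H(1) show thesis
    by (intro that[of "4 * (C + B ^ 3 * H ^ 8)"]) auto
qed

text \<open>Here \<open>(w k) ^ 3 / (h k)\<^sup>2\<close> is \<open>noise_size k\<close>, which tends to \<open>0\<close>, times a sequence whose sum
  is of the order of \<open>(Q n * noise_size n) ^ 3\<close>.\<close>

lemma third_moment_sum_lim:
  "(\<lambda>n. (\<Sum>k=1..n. w k ^ 3 / (h k)\<^sup>2) / (Q n * noise_size n) ^ 3) \<longlonglongrightarrow> 0"
proof -
  \<comment> \<open>Its exponent exceeds \<open>-1\<close> because \<open>q < (1 + a) / 2\<close>, whereas that of \<open>(w n) ^ 3 / (h n)\<^sup>2\<close> need not.\<close>
  define v where "v n = w n * (w n)\<^sup>2 / (h n)\<^sup>2 / noise_size n" for n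
  have GS: "v \<in> GS (- q + 2 * (- q) - (- 2 * a) - (- ((1 - a) / 2)))"
    unfolding v_def[abs_def] by (intro GS_divide GS_mult GS_power2 h2_GS noise_size_GS w)
  have "(\<lambda>n. (\<Sum>k=1..n. v k * noise_size k) / (real n * v n) * (real n * w n / Q n) ^ 3)
      \<longlonglongrightarrow> 0 / (1 + (- q + 2 * (- q) - (- 2 * a) - (- ((1 - a) / 2)))) * (1 - q) ^ 3"
    by (intro tendsto_intros GS_sum[OF GS _ noise_size_lim] Q_lim') (use exponents in \<open>simp_all add: field_simps\<close>)
  then have "(\<lambda>n. (\<Sum>k=1..n. v k * noise_size k) / (real n * v n) * (real n * w n / Q n) ^ 3) \<longlonglongrightarrow> 0"
    by simp
  moreover have "eventually (\<lambda>n. (\<Sum>k=1..n. v k * noise_size k) / (real n * v n) * (real n * w n / Q n) ^ 3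
      = (\<Sum>k=1..n. w k ^ 3 / (h k)\<^sup>2) / (Q n * noise_size n) ^ 3) sequentially"
    using eventually_ge_at_top[of 1]
  proof eventually_elim
    case (elim n)
    have pos: "0 < real n" "0 < h n" "0 < w n" "0 < Q n" "0 < noise_size n"
      using elim h_pos w_pos Q_pos noise_size_pos by auto
    have sum: "(\<Sum>k=1..n. v k * noise_size k) = (\<Sum>k=1..n. w k ^ 3 / (h k)\<^sup>2)"
    proof (intro sum.cong refl)
      fix k assume "k \<in> {1..n}"
      then have "noise_size k \<noteq> 0"
        using noise_size_pos[of k] by auto
      then show "v k * noise_size k = w k ^ 3 / (h k)\<^sup>2"
        by (simp add: v_def power3_eq_cube power2_eq_square)
    qed
    have "(noise_size n)\<^sup>2 = inverse (real n * h n)"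
      using pos by (simp add: noise_size_def power_inverse)
    then have rel: "real n * h n * (noise_size n)\<^sup>2 = 1"
      using pos by (simp add: field_simps)
    have "real n * v n * (Q n) ^ 3 * (real n * h n * (noise_size n)\<^sup>2)\<^sup>2 = (real n * w n) ^ 3 * (Q n * noise_size n) ^ 3"
      using pos by (simp add: v_def power_mult_distrib field_simps power2_eq_square power3_eq_cube)
    then have "real n * v n * (Q n) ^ 3 = (real n * w n) ^ 3 * (Q n * noise_size n) ^ 3"
      unfolding rel by simp
    moreover have "0 < v n"
      using GS_pos[OF GS elim] .
    ultimately have "s / (real n * v n) * (real n * w n / Q n) ^ 3 = s / (Q n * noise_size n) ^ 3" for s
      using pos by (simp add: power_divide divide_eq_eq eq_divide_eq)
    then show ?case
      unfolding sum by simp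
  qed
  ultimately show ?thesis
    by (rule Lim_transform_eventually)
qed

text \<open>On the scale \<open>noise_size\<close> the bias has size \<open>sqrt (n * h n ^ 5)\<close>, which tends to \<open>sqrt c\<close>; this is
  why it appears in the limit.\<close>

theorem conv_in_distribution_average:
  assumes nh5: "(\<lambda>n. real n * h n ^ 5) \<longlonglongrightarrow> c" and "0 \<le> \<tau>"
  shows "conv_in_distribution M (\<lambda>n \<omega>. sqrt (real n * h n) * average n \<omega>)
    (gaussian (sqrt c * ((1 - q) / (1 - q - 2 * a)) * (b / f)) ((1 - q)\<^sup>2 / (1 + a - 2 * q) * (\<tau> / f\<^sup>2)))"
proof -
  define d where "d n = f * (Q n * noise_size n)" for n
  define \<xi> where "\<xi> n k \<omega> = w k * (V k \<omega> - expectation (V k)) / d n" for n k \<omega>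
  define v where "v = (1 - q)\<^sup>2 / (1 + a - 2 * q) * (\<tau> / f\<^sup>2)"
  define l where "l = b * ((1 - q) / (1 - q - 2 * a))"
  define \<mu> where "\<mu> = sqrt c * ((1 - q) / (1 - q - 2 * a)) * (b / f)"
  have d_nonneg: "0 \<le> d n" for n
    using Q_pos[of n] noise_size_pos[of n] f_pos by (cases "1 \<le> n") (auto simp: d_def Q_def)
  have \<xi>_sum: "(\<Sum>k=1..n. \<xi> n k \<omega>) = centred_sum n \<omega> / d n" for n \<omega>
    by (simp add: \<xi>_def centred_sum_def sum_divide_distrib)
  obtain B where B: "0 \<le> B"
    "\<And>k. 1 \<le> k \<Longrightarrow> expectation (\<lambda>\<omega>. \<bar>V k \<omega> - expectation (V k)\<bar> ^ 3) \<le> B / (h k)\<^sup>2"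
    "\<And>k. 1 \<le> k \<Longrightarrow> integrable M (\<lambda>\<omega>. \<bar>V k \<omega> - expectation (V k)\<bar> ^ 3)"
    using third_moment_bound by blast
  have \<xi>3: "\<bar>\<xi> n k \<omega>\<bar> ^ 3 = w k ^ 3 / d n ^ 3 * \<bar>V k \<omega> - expectation (V k)\<bar> ^ 3" if "1 \<le> k" for n k \<omega>
    using w_pos[OF that] d_nonneg[of n] by (simp add: \<xi>_def abs_mult abs_divide power_mult_distrib power_divide)
  have clt: "(\<lambda>n. char (distr M borel (\<lambda>\<omega>. \<Sum>k=1..n. \<xi> n k \<omega>)) t) \<longlonglongrightarrow> complex_of_real (exp (- (t\<^sup>2 * v / 2)))" for t
  proof (rule lyapunov_char)
    show "indep_vars (\<lambda>_. borel) (\<xi> n) {1..n}" for n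
    proof -
      have "indep_vars (\<lambda>_. borel) (\<lambda>k \<omega>. w k * (snd (Z k \<omega>, V k \<omega>) - expectation (V k)) / d n) {1..n}"
        by (rule indep_vars_compose2[OF indep_vars_subset[OF indep], of "{1..n}" "\<lambda>k p. w k * (snd p - expectation (V k)) / d n"])
           (auto intro!: borel_measurable_continuous_onI continuous_intros simp: divide_inverse)
      then show ?thesis
        by (simp add: \<xi>_def[abs_def])
    qed
    show "integrable M (\<lambda>\<omega>. \<bar>\<xi> n k \<omega>\<bar> ^ 3)" if "k \<in> {1..n}" for n k
      using that B(3)[of k] by (simp add: \<xi>3)
    show "expectation (\<xi> n k) = 0" if "k \<in> {1..n}" for n k
      using that int_V[of k] by (simp add: \<xi>_def[abs_def] prob_space)
    have "(\<Sum>k=1..n. mean_square (\<xi> n k))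
        = (\<Sum>k=1..n. (w k)\<^sup>2 / h k * (h k * centred_second k)) / (Q n * noise_size n)\<^sup>2 / f\<^sup>2" for n
    proof -
      have "(\<xi> n k \<omega>)\<^sup>2 = (w k)\<^sup>2 / (d n)\<^sup>2 * (V k \<omega> - expectation (V k))\<^sup>2" for k \<omega>
        by (simp add: \<xi>_def power_mult_distrib power_divide)
      then have "(\<Sum>k=1..n. mean_square (\<xi> n k)) = (\<Sum>k=1..n. (w k)\<^sup>2 / (d n)\<^sup>2 * centred_second k)"
        by (simp add: centred_second_def)
      also have "\<dots> = (\<Sum>k=1..n. (w k)\<^sup>2 / h k * (h k * centred_second k) / (d n)\<^sup>2)"
      proof (intro sum.cong refl)
        fix k assume "k \<in> {1..n}"
        then have "h k \<noteq> 0"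
          using h_pos[of k] by auto
        then show "(w k)\<^sup>2 / (d n)\<^sup>2 * centred_second k = (w k)\<^sup>2 / h k * (h k * centred_second k) / (d n)\<^sup>2"
          by simp
      qed
      finally show ?thesis
        by (simp add: d_def power_mult_distrib sum_divide_distrib mult.commute)
    qed
    moreover have "(\<lambda>n. (\<Sum>k=1..n. (w k)\<^sup>2 / h k * (h k * centred_second k)) / (Q n * noise_size n)\<^sup>2 / f\<^sup>2)
        \<longlonglongrightarrow> (1 - q)\<^sup>2 / (1 + a - 2 * q) * \<tau> / f\<^sup>2"
      using f_pos by (intro tendsto_divide weighted_variance_lim centred_second_lim tendsto_const) simp
    ultimately show "(\<lambda>n. \<Sum>k=1..n. mean_square (\<xi> n k)) \<longlonglongrightarrow> v"
      by (simp add: v_def)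
    have le: "(\<Sum>k=1..n. mean_cube (\<xi> n k))
        \<le> B / f ^ 3 * ((\<Sum>k=1..n. w k ^ 3 / (h k)\<^sup>2) / (Q n * noise_size n) ^ 3)" for n
    proof -
      have "(\<Sum>k=1..n. mean_cube (\<xi> n k)) \<le> (\<Sum>k=1..n. w k ^ 3 / d n ^ 3 * (B / (h k)\<^sup>2))"
      proof (rule sum_mono)
        fix k assume "k \<in> {1..n}"
        then have k: "1 \<le> k"
          by simp
        then show "mean_cube (\<xi> n k) \<le> w k ^ 3 / d n ^ 3 * (B / (h k)\<^sup>2)"
          unfolding \<xi>3[OF k] integral_mult_right_zero
          using w_pos[OF k] d_nonneg[of n] by (intro mult_left_mono B) auto
      qed
      also have "\<dots> = B / f ^ 3 * ((\<Sum>k=1..n. w k ^ 3 / (h k)\<^sup>2) / (Q n * noise_size n) ^ 3)"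
        by (simp add: d_def sum_distrib_left sum_divide_distrib power_mult_distrib mult.commute mult.left_commute)
      finally show ?thesis .
    qed
    have "(\<lambda>n. B / f ^ 3 * ((\<Sum>k=1..n. w k ^ 3 / (h k)\<^sup>2) / (Q n * noise_size n) ^ 3)) \<longlonglongrightarrow> B / f ^ 3 * 0"
      by (intro tendsto_intros third_moment_sum_lim)
    then show "(\<lambda>n. \<Sum>k=1..n. mean_cube (\<xi> n k)) \<longlonglongrightarrow> 0"
      by (intro tendsto_sandwich[OF always_eventually[OF allI] always_eventually[OF allI[OF le]] tendsto_const])
         (auto intro!: sum_nonneg)
  qed
  define r where "r n = mean_abs (remainder n) / (Q n * error_size n)" for n
  define m where "m n = mean_part n / (Q n * (h n)\<^sup>2)" for n
  define \<sigma> where "\<sigma> n = sqrt (real n * h n ^ 5)" for n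
  have \<sigma>_lim: "\<sigma> \<longlonglongrightarrow> sqrt c"
    unfolding \<sigma>_def by (intro tendsto_intros nh5)
  have diff: "sqrt (real n * h n) * average n \<omega> - (\<Sum>k=1..n. \<xi> n k \<omega>) = (mean_part n + remainder n \<omega>) / d n" for n \<omega>
  proof -
    have "sqrt (real n * h n) = inverse (noise_size n)"
      by (simp add: noise_size_def)
    then have "sqrt (real n * h n) * average n \<omega> = (centred_sum n \<omega> + mean_part n + remainder n \<omega>) / d n"
      by (simp add: average_decomposition d_def divide_inverse mult.commute mult.left_commute)
    then show ?thesis
      unfolding \<xi>_sum by (simp add: add_divide_distrib)
  qed
  define G where "G n = \<bar>m n * \<sigma> n / f - \<mu>\<bar> + r n * (1 + \<sigma> n) / f" for n
  have \<mu>: "\<mu> = l * sqrt c / f"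
    by (simp add: \<mu>_def l_def)
  have "G \<longlonglongrightarrow> \<bar>l * sqrt c / f - \<mu>\<bar> + 0 * (1 + sqrt c) / f"
    unfolding G_def m_def l_def r_def
    using f_pos by (intro tendsto_intros \<sigma>_lim mean_part_lim remainder_negligible) auto
  then have G_lim: "G \<longlonglongrightarrow> 0"
    by (simp add: \<mu>)
  have "conv_in_distribution M (\<lambda>n \<omega>. sqrt (real n * h n) * average n \<omega>) (gaussian \<mu> v)"
  proof (rule conv_in_distribution_gaussianI[OF _ _ _ clt])
    show "random_variable borel (\<lambda>\<omega>. \<Sum>k=1..n. \<xi> n k \<omega>)" for n
      unfolding \<xi>_sum using int_centred_sum[of n] by auto
    show "random_variable borel (\<lambda>\<omega>. sqrt (real n * h n) * average n \<omega>)" for n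
      using int_average[of n] by auto
    show "0 \<le> v"
      using \<open>0 \<le> \<tau>\<close> exponents by (auto simp: v_def intro!: mult_nonneg_nonneg divide_nonneg_nonneg)
    show "integrable M (\<lambda>\<omega>. sqrt (real n * h n) * average n \<omega> - (\<Sum>k=1..n. \<xi> n k \<omega>))" for n
      unfolding diff by (intro integrable_arith int_remainder) simp
    have "eventually (\<lambda>n. norm (expectation (\<lambda>\<omega>. \<bar>sqrt (real n * h n) * average n \<omega> - (\<Sum>k=1..n. \<xi> n k \<omega>) - \<mu>\<bar>)) \<le> G n) sequentially"
      using eventually_ge_at_top[of 1]
    proof eventually_elim
      case (elim n)
      have pos: "0 < Q n" "0 < h n" "0 < noise_size n" "0 < error_size n"
        using elim Q_pos h_pos noise_size_pos error_size_pos by auto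
      then have "0 < d n"
        using f_pos by (simp add: d_def)
      have \<sigma>: "(h n)\<^sup>2 = \<sigma> n * noise_size n"
        using h2_over_noise_size[of n] pos by (simp add: \<sigma>_def field_simps)
      have "(mean_part n + remainder n \<omega>) / d n - \<mu> = (mean_part n / d n - \<mu>) + remainder n \<omega> / d n" for \<omega>
        by (simp add: add_divide_distrib)
      then have "\<bar>(mean_part n + remainder n \<omega>) / d n - \<mu>\<bar> \<le> \<bar>mean_part n / d n - \<mu>\<bar> + \<bar>remainder n \<omega>\<bar> / d n" for \<omega>
        using abs_triangle_ineq[of "mean_part n / d n - \<mu>" "remainder n \<omega> / d n"] \<open>0 < d n\<close> by simp
      then have "expectation (\<lambda>\<omega>. \<bar>sqrt (real n * h n) * average n \<omega> - (\<Sum>k=1..n. \<xi> n k \<omega>) - \<mu>\<bar>)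
          \<le> expectation (\<lambda>\<omega>. \<bar>mean_part n / d n - \<mu>\<bar> + \<bar>remainder n \<omega>\<bar> / d n)"
        unfolding diff
        by (intro integral_mono integrable_arith int_remainder) auto
      also have "\<dots> = \<bar>mean_part n / d n - \<mu>\<bar> + mean_abs (remainder n) / d n"
        using int_remainder[of n] by (simp add: prob_space)
      also have "mean_part n / d n = m n * \<sigma> n / f"
      proof -
        have "\<sigma> n \<noteq> 0"
          using \<sigma> pos by auto
        then show ?thesis
          unfolding m_def d_def \<sigma> using pos f_pos by simp
      qed
      also have "mean_abs (remainder n) / d n = r n * (1 + \<sigma> n) / f"
      proof -
        have err: "error_size n = (1 + \<sigma> n) * noise_size n"
          using \<sigma> by (simp add: error_size_def algebra_simps)
        then have "1 + \<sigma> n \<noteq> 0"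
          using pos by auto
        then show ?thesis
          unfolding r_def d_def err using pos f_pos by simp
      qed
      finally show ?case
        by (simp add: G_def)
    qed
    then show "(\<lambda>n. expectation (\<lambda>\<omega>. \<bar>sqrt (real n * h n) * average n \<omega> - (\<Sum>k=1..n. \<xi> n k \<omega>) - \<mu>\<bar>)) \<longlonglongrightarrow> 0"
      by (rule Lim_null_comparison) (rule G_lim)
  qed
  then show ?thesis
    by (simp add: \<mu>_def v_def)
qed

end

section \<open>Taylor expansion of integrals with a parameter\<close>

text \<open>The kernel of the integral remainder of second order at \<open>x\<close>, for \<open>s\<close> on either side of \<open>x\<close>.\<close>

definition taylor_weight :: "real \<Rightarrow> real \<Rightarrow> real \<Rightarrow> real" where
  "taylor_weight x s u = indicator {min x s..max x s} u * \<bar>s - u\<bar>"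

lemma taylor_weight_nonneg: "0 \<le> taylor_weight x s u"
  by (simp add: taylor_weight_def)

lemma taylor_weight_measurable [measurable]: "taylor_weight x s \<in> borel_measurable borel"
  unfolding taylor_weight_def[abs_def] by measurable

lemma has_bochner_integral_FTC:
  fixes F f :: "real \<Rightarrow> real"
  assumes "a \<le> b" and F: "\<And>u. (F has_real_derivative f u) (at u)" and f: "continuous_on UNIV f"
  shows "has_bochner_integral lborel (\<lambda>u. indicator {a..b} u * f u) (F b - F a)"
proof -
  have f': "continuous_on {a..b} f"
    using f by (rule continuous_on_subset) simp
  have "integral\<^sup>L lborel (\<lambda>u. indicator {a..b} u *\<^sub>R f u) = F b - F a"
    using F by (intro integral_FTC_atLeastAtMost[OF \<open>a \<le> b\<close> _ f'])
      (auto simp: has_real_derivative_iff_has_vector_derivative intro: has_vector_derivative_at_within)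
  moreover have "integrable lborel (\<lambda>u. indicator {a..b} u *\<^sub>R f u)"
    using borel_integrable_atLeastAtMost'[OF f'] by (simp add: set_integrable_def)
  ultimately show ?thesis
    by (simp add: has_bochner_integral_iff)
qed

lemma taylor_remainder:
  fixes \<phi> \<phi>1 \<phi>2 :: "real \<Rightarrow> real"
  assumes d1: "\<And>u. (\<phi> has_real_derivative \<phi>1 u) (at u)" and d2: "\<And>u. (\<phi>1 has_real_derivative \<phi>2 u) (at u)"
    and cont: "continuous_on UNIV \<phi>2"
  shows "has_bochner_integral lborel (\<lambda>u. taylor_weight x s u * \<phi>2 u) (\<phi> s - \<phi> x - (s - x) * \<phi>1 x)"
proof -
  let ?F = "\<lambda>u. \<phi> u + (s - u) * \<phi>1 u" and ?f = "\<lambda>u. (s - u) * \<phi>2 u"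
  have F: "(?F has_real_derivative ?f u) (at u)" for u
    by (auto intro!: derivative_eq_intros d1 d2)
  have f: "continuous_on UNIV ?f"
    by (intro continuous_intros cont)
  show ?thesis
  proof (cases "x \<le> s")
    case True
    from has_bochner_integral_FTC[OF True F f]
    have "has_bochner_integral lborel (\<lambda>u. indicator {x..s} u * ?f u) (\<phi> s - \<phi> x - (s - x) * \<phi>1 x)"
      by (simp add: algebra_simps)
    moreover have "(\<lambda>u. indicator {x..s} u * ?f u) = (\<lambda>u. taylor_weight x s u * \<phi>2 u)"
      using True by (auto simp: taylor_weight_def fun_eq_iff split: split_indicator)
    ultimately show ?thesis
      by simp
  next
    case False
    then have "s \<le> x"
      by simp
    from has_bochner_integral_minus[OF has_bochner_integral_FTC[OF this F f]]
    have "has_bochner_integral lborel (\<lambda>u. - (indicator {s..x} u * ?f u)) (\<phi> s - \<phi> x - (s - x) * \<phi>1 x)"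
      by (simp add: algebra_simps)
    moreover have "(\<lambda>u. - (indicator {s..x} u * ?f u)) = (\<lambda>u. taylor_weight x s u * \<phi>2 u)"
      using False by (auto simp: taylor_weight_def fun_eq_iff algebra_simps split: split_indicator)
    ultimately show ?thesis
      by simp
  qed
qed

lemma taylor_weight_total: "has_bochner_integral lborel (taylor_weight x s) ((s - x)\<^sup>2 / 2)"
proof -
  have "has_bochner_integral lborel (\<lambda>u. taylor_weight x s u * 1)
      ((s - x)\<^sup>2 / 2 - (x - x)\<^sup>2 / 2 - (s - x) * (x - x))"
    by (rule taylor_remainder[where \<phi> = "\<lambda>u. (u - x)\<^sup>2 / 2"]) (auto intro!: derivative_eq_intros)
  then show ?thesis
    by simp
qed

lemma taylor_weight_deviation:
  assumes int: "integrable lborel (\<lambda>u. taylor_weight x s u * G u)"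
    and dev: "\<And>u. u \<in> {min x s..max x s} \<Longrightarrow> \<bar>G u - g0\<bar> \<le> e"
  shows "\<bar>(\<integral>u. taylor_weight x s u * G u \<partial>lborel) - g0 * ((s - x)\<^sup>2 / 2)\<bar> \<le> e * ((s - x)\<^sup>2 / 2)"
proof -
  note total = taylor_weight_total[of x s, unfolded has_bochner_integral_iff]
  have "(\<integral>u. taylor_weight x s u * G u \<partial>lborel) - g0 * ((s - x)\<^sup>2 / 2)
      = (\<integral>u. taylor_weight x s u * G u - g0 * taylor_weight x s u \<partial>lborel)"
    using int total by simp
  also have "\<bar>\<dots>\<bar> \<le> (\<integral>u. \<bar>taylor_weight x s u * G u - g0 * taylor_weight x s u\<bar> \<partial>lborel)"
    by (rule integral_abs_bound)
  also have "\<dots> \<le> (\<integral>u. e * taylor_weight x s u \<partial>lborel)"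
  proof (rule integral_mono)
    fix u
    have "taylor_weight x s u * \<bar>G u - g0\<bar> \<le> taylor_weight x s u * e"
    proof (cases "u \<in> {min x s..max x s}")
      case True
      then show ?thesis
        by (intro mult_left_mono dev taylor_weight_nonneg)
    qed (simp add: taylor_weight_def)
    then show "\<bar>taylor_weight x s u * G u - g0 * taylor_weight x s u\<bar> \<le> e * taylor_weight x s u"
      using taylor_weight_nonneg[of x s u]
      by (simp add: mult.commute[of g0] mult.commute[of e] abs_mult flip: right_diff_distrib)
  qed (use int total in auto)
  also have "\<dots> = e * ((s - x)\<^sup>2 / 2)"
    using total by simp
  finally show ?thesis .
qed

text \<open>The remainder of the expansion of each \<open>F s t\<close> is integrated over \<open>t\<close>; by Fubini's theorem
  on the strip around \<open>x\<close> it is the integral of \<open>u \<mapsto> \<integral>t. F2 u t\<close> against the Taylor weight. Away from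
  \<open>x\<close> the boundedness of \<open>s \<mapsto> \<integral>t. F s t\<close> suffices.\<close>

lemma second_order_expansion:
  fixes F F1 F2 :: "real \<Rightarrow> real \<Rightarrow> real"
  assumes d1: "\<And>u t. ((\<lambda>u. F u t) has_real_derivative F1 u t) (at u)"
    and d2: "\<And>u t. ((\<lambda>u. F1 u t) has_real_derivative F2 u t) (at u)"
    and cont2: "\<And>t. continuous_on UNIV (\<lambda>u. F2 u t)"
    and F: "bounded_integral F" and F2: "bounded_integral F2" and F1: "integrable lborel (F1 x)"
    and near: "integrable_near x F2" and cont: "isCont (\<lambda>s. \<integral>t. F2 s t \<partial>lborel) x"
  defines "N \<equiv> \<lambda>s. \<integral>t. F s t \<partial>lborel"
  defines "\<rho> \<equiv> \<lambda>s. (N s - N x - (s - x) * (\<integral>t. F1 x t \<partial>lborel)) / (s - x)\<^sup>2"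
  shows "bounded (range \<rho>)" and "(\<rho> \<longlongrightarrow> (\<integral>t. F2 x t \<partial>lborel) / 2) (at x)"
proof -
  define D where "D = (\<integral>t. F1 x t \<partial>lborel)"
  define G where "G s = (\<integral>t. F2 s t \<partial>lborel)" for s
  obtain \<delta> where \<delta>: "0 < \<delta>" "set_integrable lborel ({x - \<delta>..x + \<delta>} \<times> UNIV) (\<lambda>(s, t). F2 s t)"
    using near by (auto simp: integrable_near_def)
  obtain B0 where B0: "\<And>s. \<bar>N s\<bar> \<le> B0"
    using F by (auto simp: bounded_integral_def bounded_iff N_def)
  obtain B2 where B2: "\<And>s. \<bar>G s\<bar> \<le> B2"
    using F2 by (auto simp: bounded_integral_def bounded_iff G_def)
  have int_F: "integrable lborel (F s)" for s
    using F by (simp add: bounded_integral_def)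
  let ?S = "{x - \<delta>..x + \<delta>} \<times> UNIV :: (real \<times> real) set"
  have strip: "integrable (lborel \<Otimes>\<^sub>M lborel) (\<lambda>p. indicator ?S p * F2 (fst p) (snd p))"
    using \<delta>(2) by (simp add: set_integrable_def case_prod_beta lborel_prod)
  have remainder: "integrable lborel (\<lambda>u. taylor_weight x s u * G u)
      \<and> N s - N x - (s - x) * D = (\<integral>u. taylor_weight x s u * G u \<partial>lborel)" if s: "\<bar>s - x\<bar> \<le> \<delta>" for s
  proof -
    have weight_in: "u \<in> {x - \<delta>..x + \<delta>}" if "u \<in> {min x s..max x s}" for u
      using that s by (auto simp: abs_le_iff min_def max_def split: if_splits)
    have eq: "taylor_weight x s u * F2 u t = taylor_weight x s u * (indicator ?S (u, t) * F2 u t)" for u t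
      using weight_in[of u] by (auto simp: taylor_weight_def split: split_indicator)
    have weight_le: "taylor_weight x s u \<le> \<delta>" for u
      using s \<delta>(1) by (auto simp: taylor_weight_def abs_le_iff min_def max_def split: split_indicator if_splits)
    have prod: "integrable (lborel \<Otimes>\<^sub>M lborel) (\<lambda>(u, t). taylor_weight x s u * F2 u t)"
    proof (rule Bochner_Integration.integrable_bound)
      show "integrable (lborel \<Otimes>\<^sub>M lborel) (\<lambda>p. \<delta> * (indicator ?S p * F2 (fst p) (snd p)))"
        by (intro integrable_mult_right strip)
      have "(\<lambda>p. taylor_weight x s (fst p) * (indicator ?S p * F2 (fst p) (snd p))) \<in> borel_measurable (lborel \<Otimes>\<^sub>M lborel)"
        using borel_measurable_integrable[OF strip] by measurable
      then show "(\<lambda>(u, t). taylor_weight x s u * F2 u t) \<in> borel_measurable (lborel \<Otimes>\<^sub>M lborel)"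
        unfolding case_prod_beta by (subst eq) (simp add: case_prod_beta)
      show "AE p in lborel \<Otimes>\<^sub>M lborel. norm (case p of (u, t) \<Rightarrow> taylor_weight x s u * F2 u t)
          \<le> norm (\<delta> * (indicator ?S p * F2 (fst p) (snd p)))"
        unfolding case_prod_beta
        by (subst eq, rule AE_I2)
           (use taylor_weight_nonneg[of x s] weight_le \<delta>(1) in \<open>auto simp: abs_mult intro!: mult_right_mono\<close>)
    qed
    have "N s - N x - (s - x) * D = (\<integral>t. F s t - F x t - (s - x) * F1 x t \<partial>lborel)"
      using int_F F1 by (simp add: N_def D_def)
    also have "\<dots> = (\<integral>t. (\<integral>u. taylor_weight x s u * F2 u t \<partial>lborel) \<partial>lborel)"
      using taylor_remainder[OF d1 d2 cont2, of x s] by (simp add: has_bochner_integral_iff)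
    also have "\<dots> = (\<integral>u. (\<integral>t. taylor_weight x s u * F2 u t \<partial>lborel) \<partial>lborel)"
      by (rule lborel_pair.Fubini_integral[OF prod])
    also have "\<dots> = (\<integral>u. taylor_weight x s u * G u \<partial>lborel)"
      by (simp add: G_def)
    finally show ?thesis
      using lborel_pair.integrable_fst'[OF prod] by (simp add: G_def)
  qed
  have \<rho>_near: "\<bar>\<rho> s - g0 / 2\<bar> \<le> e / 2"
    if s: "\<bar>s - x\<bar> \<le> \<delta>" "s \<noteq> x" and dev: "\<And>u. u \<in> {min x s..max x s} \<Longrightarrow> \<bar>G u - g0\<bar> \<le> e" for s g0 e
  proof -
    have "0 < (s - x)\<^sup>2"
      using s by simp
    then have "\<rho> s - g0 / 2 = ((\<integral>u. taylor_weight x s u * G u \<partial>lborel) - g0 * ((s - x)\<^sup>2 / 2)) / (s - x)\<^sup>2"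
      unfolding \<rho>_def D_def[symmetric] remainder[OF s(1), THEN conjunct2] by (simp add: diff_divide_distrib)
    also have "\<bar>\<dots>\<bar> = \<bar>(\<integral>u. taylor_weight x s u * G u \<partial>lborel) - g0 * ((s - x)\<^sup>2 / 2)\<bar> / (s - x)\<^sup>2"
      by simp
    also have "\<dots> \<le> e * ((s - x)\<^sup>2 / 2) / (s - x)\<^sup>2"
      using remainder[OF s(1)] dev by (intro divide_right_mono taylor_weight_deviation) auto
    also have "\<dots> = e / 2"
      using \<open>0 < (s - x)\<^sup>2\<close> by simp
    finally show ?thesis .
  qed
  show "bounded (range \<rho>)"
  proof -
    have "0 \<le> B0" "0 \<le> B2"
      using order_trans[OF abs_ge_zero B0[of x]] order_trans[OF abs_ge_zero B2[of x]] by auto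
    have "\<bar>\<rho> s\<bar> \<le> B2 + (2 * B0 / \<delta>\<^sup>2 + \<bar>D\<bar> / \<delta>)" for s
    proof (cases "\<bar>s - x\<bar> \<le> \<delta>")
      case True
      have "\<bar>\<rho> s\<bar> \<le> B2"
      proof (cases "s = x")
        case False
        have "\<bar>\<rho> s - 0 / 2\<bar> \<le> B2 / 2"
          by (rule \<rho>_near[OF True False]) (simp add: B2)
        then show ?thesis
          using \<open>0 \<le> B2\<close> by simp
      qed (simp add: \<rho>_def \<open>0 \<le> B2\<close>)
      moreover have "0 \<le> 2 * B0 / \<delta>\<^sup>2 + \<bar>D\<bar> / \<delta>"
        using \<open>0 \<le> B0\<close> \<delta>(1) by simp
      ultimately show ?thesis
        by linarith
    next
      case False
      then have far: "\<delta> \<le> \<bar>s - x\<bar>"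
        by simp
      then have pos: "0 < \<bar>s - x\<bar>"
        using \<delta>(1) by linarith
      have "\<bar>N s - N x - (s - x) * D\<bar> \<le> \<bar>N s\<bar> + \<bar>N x\<bar> + \<bar>s - x\<bar> * \<bar>D\<bar>"
        unfolding abs_mult[symmetric] by linarith
      also have "\<dots> \<le> 2 * B0 + \<bar>s - x\<bar> * \<bar>D\<bar>"
        using B0[of s] B0[of x] by simp
      finally have "\<bar>\<rho> s\<bar> \<le> (2 * B0 + \<bar>s - x\<bar> * \<bar>D\<bar>) / \<bar>s - x\<bar>\<^sup>2"
        unfolding \<rho>_def D_def[symmetric] by (simp add: divide_right_mono)
      also have "\<dots> = 2 * B0 / \<bar>s - x\<bar>\<^sup>2 + \<bar>D\<bar> / \<bar>s - x\<bar>"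
        using pos unfolding power2_eq_square by (simp add: add_divide_distrib del: abs_mult_self_eq)
      also have "\<dots> \<le> 2 * B0 / \<delta>\<^sup>2 + \<bar>D\<bar> / \<delta>"
        using far pos \<delta>(1) \<open>0 \<le> B0\<close>
        by (intro add_mono divide_left_mono power_mono mult_pos_pos zero_less_power) auto
      finally show ?thesis
        using \<open>0 \<le> B2\<close> by linarith
    qed
    then show ?thesis
      by (auto simp: bounded_iff)
  qed
  show "(\<rho> \<longlongrightarrow> (\<integral>t. F2 x t \<partial>lborel) / 2) (at x)"
    unfolding LIM_eq
  proof (intro allI impI)
    fix r :: real assume "0 < r"
    have "isCont G x"
      using cont by (simp add: G_def[abs_def])
    then obtain d where d: "0 < d" "\<And>u. \<bar>u - x\<bar> < d \<Longrightarrow> \<bar>G u - G x\<bar> < r"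
      using \<open>0 < r\<close> unfolding continuous_at_eps_delta dist_real_def by blast
    have "\<bar>\<rho> s - G x / 2\<bar> < r" if "s \<noteq> x" "\<bar>s - x\<bar> < min d \<delta>" for s
    proof -
      have "\<bar>\<rho> s - G x / 2\<bar> \<le> r / 2"
      proof (rule \<rho>_near)
        fix u assume "u \<in> {min x s..max x s}"
        then have "\<bar>u - x\<bar> < d"
          using that by (auto simp: min_def max_def abs_less_iff split: if_splits)
        then show "\<bar>G u - G x\<bar> \<le> r"
          using d(2) less_imp_le by blast
      qed (use that in auto)
      then show ?thesis
        using \<open>0 < r\<close> by simp
    qed
    then show "\<exists>sa>0. \<forall>xa. xa \<noteq> x \<and> norm (xa - x) < sa \<longrightarrow> norm (\<rho> xa - (\<integral>t. F2 x t \<partial>lborel) / 2) < r"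
      using d(1) \<delta>(1) by (intro exI[of _ "min d \<delta>"]) (auto simp: G_def)
  qed
qed

section \<open>Moments of kernel estimates\<close>

text \<open>The value at \<open>z = 0\<close> is excluded because the remainder in a Taylor expansion at \<open>x\<close> is only known
  to converge along punctured neighbourhoods.\<close>

lemma kernel_smoothing_limit:
  fixes k S :: "real \<Rightarrow> real" and h :: "nat \<Rightarrow> real"
  assumes k: "integrable lborel k" and S [measurable]: "S \<in> borel_measurable borel"
    and bound: "\<And>s. \<bar>S s\<bar> \<le> B" and cont: "\<And>z. z \<noteq> 0 \<Longrightarrow> (\<lambda>n. S (x - h n * z)) \<longlonglongrightarrow> l"
  shows "(\<lambda>n. \<integral>z. k z * S (x - h n * z) \<partial>lborel) \<longlonglongrightarrow> l * (\<integral>z. k z \<partial>lborel)"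
proof -
  have [measurable]: "k \<in> borel_measurable lborel"
    using k by simp
  have "(\<lambda>n. \<integral>z. k z * S (x - h n * z) \<partial>lborel) \<longlonglongrightarrow> (\<integral>z. k z * l \<partial>lborel)"
  proof (rule integral_dominated_convergence[where w = "\<lambda>z. \<bar>k z\<bar> * B"])
    show "integrable lborel (\<lambda>z. \<bar>k z\<bar> * B)"
      using k by simp
    have "AE z in lborel. z \<noteq> (0::real)"
      by (rule AE_lborel_singleton)
    then show "AE z in lborel. (\<lambda>n. k z * S (x - h n * z)) \<longlonglongrightarrow> k z * l"
      by eventually_elim (intro tendsto_intros cont)
    show "AE z in lborel. norm (k z * S (x - h n * z)) \<le> \<bar>k z\<bar> * B" for n
      by (rule AE_I2) (simp add: abs_mult mult_left_mono bound)
  qed measurable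
  then show ?thesis
    by (simp add: mult.commute)
qed

text \<open>The term of first order in \<open>h\<close> vanishes because the first moment of \<open>K\<close> does.\<close>

lemma kernel_smoothing_second_order:
  fixes K N :: "real \<Rightarrow> real" and x D g0 :: real
  assumes K: "has_bochner_integral lborel K 1" "has_bochner_integral lborel (\<lambda>z. z * K z) 0"
      "integrable lborel (\<lambda>z. z\<^sup>2 * K z)" and K_nonneg: "\<And>z. 0 \<le> K z"
    and N [measurable]: "N \<in> borel_measurable borel"
  defines "\<rho> \<equiv> \<lambda>s. (N s - N x - (s - x) * D) / (s - x)\<^sup>2"
  assumes bounded: "bounded (range \<rho>)" and lim: "(\<rho> \<longlongrightarrow> g0 / 2) (at x)"
  obtains C where "0 \<le> C" "\<And>h. \<bar>(\<integral>z. K z * N (x - h * z) \<partial>lborel) - N x\<bar> \<le> C * h\<^sup>2"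
    "\<And>h. h \<longlonglongrightarrow> 0 \<Longrightarrow> (\<And>n. 1 \<le> n \<Longrightarrow> 0 < h n) \<Longrightarrow>
      (\<lambda>n. ((\<integral>z. K z * N (x - h n * z) \<partial>lborel) - N x) / (h n)\<^sup>2) \<longlonglongrightarrow> g0 / 2 * (\<integral>z. z\<^sup>2 * K z \<partial>lborel)"
proof -
  have \<rho>_meas [measurable]: "\<rho> \<in> borel_measurable borel"
    unfolding \<rho>_def by measurable
  obtain B where B: "\<And>s. \<bar>\<rho> s\<bar> \<le> B"
    using bounded by (auto simp: bounded_iff)
  have [measurable]: "K \<in> borel_measurable lborel"
    using K(1) by (auto simp: has_bochner_integral_iff)
  have expansion: "N s = N x + (s - x) * D + (s - x)\<^sup>2 * \<rho> s" for s
    by (cases "s = x") (simp_all add: \<rho>_def)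
  have int_\<rho>: "integrable lborel (\<lambda>z. z\<^sup>2 * K z * \<rho> (x - h * z))" for h
  proof (rule Bochner_Integration.integrable_bound)
    show "integrable lborel (\<lambda>z. B * (z\<^sup>2 * K z))"
      using K(3) by simp
    show "AE z in lborel. norm (z\<^sup>2 * K z * \<rho> (x - h * z)) \<le> norm (B * (z\<^sup>2 * K z))"
      using order_trans[OF abs_ge_zero B] K_nonneg B
      by (intro AE_I2) (auto simp: abs_mult mult.commute[of B] intro!: mult_left_mono)
  qed measurable
  have smooth: "(\<integral>z. K z * N (x - h * z) \<partial>lborel) - N x = h\<^sup>2 * (\<integral>z. z\<^sup>2 * K z * \<rho> (x - h * z) \<partial>lborel)" for h
  proof -
    have "(\<lambda>z. K z * N (x - h * z)) = (\<lambda>z. N x * K z - h * D * (z * K z) + h\<^sup>2 * (z\<^sup>2 * K z * \<rho> (x - h * z)))"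
      unfolding fun_eq_iff by (subst expansion) (simp add: algebra_simps power2_eq_square)
    then show ?thesis
      using K(1,2) int_\<rho>[of h] by (simp add: has_bochner_integral_iff)
  qed
  show thesis
  proof (rule that)
    show "0 \<le> B * (\<integral>z. z\<^sup>2 * K z \<partial>lborel)"
      using order_trans[OF abs_ge_zero B] K_nonneg by (intro mult_nonneg_nonneg integral_nonneg_AE) auto
    show "\<bar>(\<integral>z. K z * N (x - h * z) \<partial>lborel) - N x\<bar> \<le> B * (\<integral>z. z\<^sup>2 * K z \<partial>lborel) * h\<^sup>2" for h
    proof -
      have "\<bar>\<integral>z. z\<^sup>2 * K z * \<rho> (x - h * z) \<partial>lborel\<bar> \<le> (\<integral>z. \<bar>z\<^sup>2 * K z * \<rho> (x - h * z)\<bar> \<partial>lborel)"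
        by (rule integral_abs_bound)
      also have "\<dots> \<le> (\<integral>z. B * (z\<^sup>2 * K z) \<partial>lborel)"
        using K_nonneg B
        by (intro integral_mono integrable_abs int_\<rho> integrable_mult_right K(3))
           (auto simp: abs_mult mult.commute[of B] intro!: mult_left_mono)
      finally show ?thesis
        unfolding smooth by (simp add: abs_mult mult_left_mono mult.commute)
    qed
    fix h :: "nat \<Rightarrow> real" assume h: "h \<longlonglongrightarrow> 0" "\<And>n. 1 \<le> n \<Longrightarrow> 0 < h n"
    have "(\<lambda>n. \<integral>z. z\<^sup>2 * K z * \<rho> (x - h n * z) \<partial>lborel) \<longlonglongrightarrow> g0 / 2 * (\<integral>z. z\<^sup>2 * K z \<partial>lborel)"
    proof (rule kernel_smoothing_limit[OF K(3) \<rho>_meas B])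
      fix z :: real assume "z \<noteq> 0"
      have "(\<lambda>n. x - h n * z) \<longlonglongrightarrow> x - 0 * z"
        by (intro tendsto_intros h)
      moreover have "eventually (\<lambda>n. x - h n * z \<noteq> x) sequentially"
        using eventually_ge_at_top[of 1]
      proof eventually_elim
        case (elim n)
        then show ?case
          using h(2)[OF elim] \<open>z \<noteq> 0\<close> by auto
      qed
      ultimately have "filterlim (\<lambda>n. x - h n * z) (at x) sequentially"
        by (simp add: filterlim_at)
      with lim show "(\<lambda>n. \<rho> (x - h n * z)) \<longlonglongrightarrow> g0 / 2"
        by (rule filterlim_compose)
    qed
    moreover have "eventually (\<lambda>n. (\<integral>z. z\<^sup>2 * K z * \<rho> (x - h n * z) \<partial>lborel)
        = ((\<integral>z. K z * N (x - h n * z) \<partial>lborel) - N x) / (h n)\<^sup>2) sequentially"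
      using eventually_ge_at_top[of 1]
    proof eventually_elim
      case (elim n)
      then show ?case
        using h(2)[OF elim] by (simp add: smooth)
    qed
    ultimately show "(\<lambda>n. ((\<integral>z. K z * N (x - h n * z) \<partial>lborel) - N x) / (h n)\<^sup>2)
        \<longlonglongrightarrow> g0 / 2 * (\<integral>z. z\<^sup>2 * K z \<partial>lborel)"
      by (rule Lim_transform_eventually)
  qed
qed

text \<open>Fubini's theorem and the substitution \<open>s = x - h * z\<close>.\<close>

lemma (in prob_space) kernel_expectation:
  fixes X Y :: "'a \<Rightarrow> real" and g :: "real \<Rightarrow> real \<Rightarrow> real" and k \<psi> :: "real \<Rightarrow> real"
  assumes dens: "distributed M lborel (\<lambda>\<omega>. (X \<omega>, Y \<omega>)) (\<lambda>(s, t). ennreal (g s t))"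
    and g: "\<And>s t. 0 \<le> g s t" and k: "integrable lborel k"
    and \<psi> [measurable]: "\<psi> \<in> borel_measurable borel"
    and int: "\<And>s. integrable lborel (\<lambda>t. \<psi> t * g s t)"
    and bound: "\<And>s. (\<integral>t. \<bar>\<psi> t\<bar> * g s t \<partial>lborel) \<le> B" and "0 < h"
  shows "integrable M (\<lambda>\<omega>. k ((x - X \<omega>) / h) * \<psi> (Y \<omega>))"
    and "expectation (\<lambda>\<omega>. k ((x - X \<omega>) / h) * \<psi> (Y \<omega>)) = h * (\<integral>z. k z * (\<integral>t. \<psi> t * g (x - h * z) t \<partial>lborel) \<partial>lborel)"
    and "\<bar>expectation (\<lambda>\<omega>. k ((x - X \<omega>) / h) * \<psi> (Y \<omega>))\<bar> \<le> h * (B * (\<integral>z. \<bar>k z\<bar> \<partial>lborel))"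
proof -
  let ?G = "\<lambda>p. g (fst p) (snd p)"
  let ?\<phi> = "\<lambda>p. k ((x - fst p) / h) * \<psi> (snd p)"
  have [measurable]: "k \<in> borel_measurable borel"
    using borel_measurable_integrable[OF k] by simp
  have dens': "distributed M lborel (\<lambda>\<omega>. (X \<omega>, Y \<omega>)) (\<lambda>p. ennreal (?G p))"
    using dens by (simp add: case_prod_beta')
  have "?G \<in> borel_measurable lborel"
    by (rule distributed_real_measurable[OF _ dens']) (simp add: g)
  then have G [measurable]: "?G \<in> borel_measurable (lborel \<Otimes>\<^sub>M lborel)"
    by (simp add: lborel_prod)
  have \<phi>_pair: "?\<phi> \<in> borel_measurable (lborel \<Otimes>\<^sub>M lborel)"
    by measurable
  then have \<phi>: "?\<phi> \<in> borel_measurable lborel"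
    by (simp add: lborel_prod)
  have k_affine: "integrable lborel (\<lambda>s. k ((x - s) / h))"
    using lborel_integrable_real_affine[OF k, of "- 1 / h" "x / h"] \<open>0 < h\<close>
    by (simp add: diff_divide_distrib)
  have int_abs: "integrable lborel (\<lambda>t. \<bar>\<psi> t\<bar> * g s t)" for s
    using integrable_abs[OF int[of s]] g by (simp add: abs_mult)
  have S_meas: "(\<lambda>s. \<integral>t. \<bar>\<psi> t\<bar> * g s t \<partial>lborel) \<in> borel_measurable lborel"
  proof -
    have "(\<lambda>(s, t). \<bar>\<psi> t\<bar> * g s t) \<in> borel_measurable (lborel \<Otimes>\<^sub>M lborel)"
      using G unfolding case_prod_beta' by measurable
    then show ?thesis
      by (rule lborel.borel_measurable_lebesgue_integral)
  qed
  have prod: "integrable (lborel \<Otimes>\<^sub>M lborel) (\<lambda>p. ?G p * ?\<phi> p)"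
  proof (rule lborel_pair.Fubini_integrable)
    show "(\<lambda>p. ?G p * ?\<phi> p) \<in> borel_measurable (lborel \<Otimes>\<^sub>M lborel)"
      using \<phi>_pair by measurable
    have "(\<integral>t. norm (?G (s, t) * ?\<phi> (s, t)) \<partial>lborel) = \<bar>k ((x - s) / h)\<bar> * (\<integral>t. \<bar>\<psi> t\<bar> * g s t \<partial>lborel)" for s
      using g by (simp add: abs_mult mult_ac flip: integral_mult_right_zero)
    moreover have "integrable lborel (\<lambda>s. \<bar>k ((x - s) / h)\<bar> * (\<integral>t. \<bar>\<psi> t\<bar> * g s t \<partial>lborel))"
    proof (rule Bochner_Integration.integrable_bound)
      show "integrable lborel (\<lambda>s. B * \<bar>k ((x - s) / h)\<bar>)"
        by (intro integrable_mult_right integrable_abs k_affine)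
      show "(\<lambda>s. \<bar>k ((x - s) / h)\<bar> * (\<integral>t. \<bar>\<psi> t\<bar> * g s t \<partial>lborel)) \<in> borel_measurable lborel"
        using S_meas by measurable
      have "\<bar>\<integral>t. \<bar>\<psi> t\<bar> * g s t \<partial>lborel\<bar> \<le> \<bar>B\<bar>" for s
      proof -
        have "0 \<le> (\<integral>t. \<bar>\<psi> t\<bar> * g s t \<partial>lborel)"
          using g by (intro integral_nonneg_AE AE_I2) simp
        then show ?thesis
          using bound[of s] by linarith
      qed
      then show "AE s in lborel. norm (\<bar>k ((x - s) / h)\<bar> * (\<integral>t. \<bar>\<psi> t\<bar> * g s t \<partial>lborel)) \<le> norm (B * \<bar>k ((x - s) / h)\<bar>)"
        by (intro AE_I2) (simp add: abs_mult mult.commute[of "\<bar>B\<bar>"] mult_left_mono)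
    qed
    ultimately show "integrable lborel (\<lambda>s. \<integral>t. norm (?G (s, t) * ?\<phi> (s, t)) \<partial>lborel)"
      by simp
    show "AE s in lborel. integrable lborel (\<lambda>t. ?G (s, t) * ?\<phi> (s, t))"
    proof (rule AE_I2)
      fix s
      have "(\<lambda>t. ?G (s, t) * ?\<phi> (s, t)) = (\<lambda>t. k ((x - s) / h) * (\<psi> t * g s t))"
        by (simp add: mult_ac)
      then show "integrable lborel (\<lambda>t. ?G (s, t) * ?\<phi> (s, t))"
        using integrable_mult_right[OF int] by metis
    qed
  qed
  then have "integrable lborel (\<lambda>p. ?G p * ?\<phi> p)"
    by (simp add: lborel_prod)
  then have int_M: "integrable M (\<lambda>\<omega>. ?\<phi> (X \<omega>, Y \<omega>))"
    using distributed_integrable[OF dens' \<phi>] g by simp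
  then show "integrable M (\<lambda>\<omega>. k ((x - X \<omega>) / h) * \<psi> (Y \<omega>))"
    by simp
  have "expectation (\<lambda>\<omega>. k ((x - X \<omega>) / h) * \<psi> (Y \<omega>)) = (\<integral>p. ?G p * ?\<phi> p \<partial>lborel)"
    using distributed_integral[OF dens' \<phi>] g by simp
  also have "\<dots> = (\<integral>s. (\<integral>t. ?G (s, t) * ?\<phi> (s, t) \<partial>lborel) \<partial>lborel)"
    using lborel_pair.integral_fst'[OF prod] by (simp add: lborel_prod)
  also have "\<dots> = (\<integral>s. k ((x - s) / h) * (\<integral>t. \<psi> t * g s t \<partial>lborel) \<partial>lborel)"
    by (simp add: mult_ac flip: integral_mult_right_zero)
  also have "\<dots> = h * (\<integral>z. k z * (\<integral>t. \<psi> t * g (x - h * z) t \<partial>lborel) \<partial>lborel)"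
    using \<open>0 < h\<close>
    by (subst lborel_integral_real_affine[of "- h" _ x]) simp_all
  finally show E: "expectation (\<lambda>\<omega>. k ((x - X \<omega>) / h) * \<psi> (Y \<omega>)) = h * (\<integral>z. k z * (\<integral>t. \<psi> t * g (x - h * z) t \<partial>lborel) \<partial>lborel)" .
  have "\<bar>\<integral>z. k z * (\<integral>t. \<psi> t * g (x - h * z) t \<partial>lborel) \<partial>lborel\<bar> \<le> B * (\<integral>z. \<bar>k z\<bar> \<partial>lborel)"
  proof -
    have inner: "\<bar>\<integral>t. \<psi> t * g s t \<partial>lborel\<bar> \<le> B" for s
    proof -
      have "\<bar>\<integral>t. \<psi> t * g s t \<partial>lborel\<bar> \<le> (\<integral>t. \<bar>\<psi> t * g s t\<bar> \<partial>lborel)"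
        by (rule integral_abs_bound)
      then show ?thesis
        using bound[of s] g by (simp add: abs_mult)
    qed
    have "\<bar>\<integral>z. k z * (\<integral>t. \<psi> t * g (x - h * z) t \<partial>lborel) \<partial>lborel\<bar>
        \<le> (\<integral>z. \<bar>k z * (\<integral>t. \<psi> t * g (x - h * z) t \<partial>lborel)\<bar> \<partial>lborel)"
      by (rule integral_abs_bound)
    also have "\<dots> \<le> (\<integral>z. B * \<bar>k z\<bar> \<partial>lborel)"
    proof (rule integral_mono')
      show "integrable lborel (\<lambda>z. B * \<bar>k z\<bar>)"
        using k by simp
      show "\<bar>k z * (\<integral>t. \<psi> t * g (x - h * z) t \<partial>lborel)\<bar> \<le> B * \<bar>k z\<bar>" for z
        using inner[of "x - h * z"] by (simp add: abs_mult mult.commute[of B] mult_left_mono)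
      show "0 \<le> B * \<bar>k z\<bar>" for z
        using order_trans[OF abs_ge_zero inner] by (intro mult_nonneg_nonneg) auto
    qed
    finally show ?thesis
      by simp
  qed
  then show "\<bar>expectation (\<lambda>\<omega>. k ((x - X \<omega>) / h) * \<psi> (Y \<omega>))\<bar> \<le> h * (B * (\<integral>z. \<bar>k z\<bar> \<partial>lborel))"
    unfolding E using \<open>0 < h\<close> by (simp add: abs_mult mult_left_mono)
qed

section \<open>Regression estimates from a joint density\<close>

lemma bounded_integral_linear:
  assumes "bounded_integral F" "bounded_integral G"
  shows "bounded_integral (\<lambda>s t. c1 * F s t + c0 * G s t)"
proof -
  from assms have int: "integrable lborel (F s)" "integrable lborel (G s)" for s
    by (auto simp: bounded_integral_def)
  obtain B1 B0 where B: "\<And>s. \<bar>\<integral>t. F s t \<partial>lborel\<bar> \<le> B1" "\<And>s. \<bar>\<integral>t. G s t \<partial>lborel\<bar> \<le> B0"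
    using assms by (auto simp: bounded_integral_def bounded_iff)
  have "\<bar>\<integral>t. c1 * F s t + c0 * G s t \<partial>lborel\<bar> \<le> \<bar>c1\<bar> * B1 + \<bar>c0\<bar> * B0" for s
  proof -
    have "\<bar>\<integral>t. c1 * F s t + c0 * G s t \<partial>lborel\<bar> \<le> \<bar>c1\<bar> * \<bar>\<integral>t. F s t \<partial>lborel\<bar> + \<bar>c0\<bar> * \<bar>\<integral>t. G s t \<partial>lborel\<bar>"
      using int[of s] by (simp flip: abs_mult)
    also have "\<dots> \<le> \<bar>c1\<bar> * B1 + \<bar>c0\<bar> * B0"
      by (intro add_mono mult_left_mono B) auto
    finally show ?thesis .
  qed
  then show ?thesis
    using int by (auto simp: bounded_integral_def bounded_iff)
qed

lemma integrable_near_linear: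
  assumes "integrable_near x F" "integrable_near x G"
  shows "integrable_near x (\<lambda>s t. c1 * F s t + c0 * G s t)"
proof -
  obtain d e where d: "0 < d" "set_integrable lborel ({x - d..x + d} \<times> UNIV) (\<lambda>(s, t). F s t)"
    and e: "0 < e" "set_integrable lborel ({x - e..x + e} \<times> UNIV) (\<lambda>(s, t). G s t)"
    using assms by (auto simp: integrable_near_def)
  have sub: "set_integrable lborel ({x - min d e..x + min d e} \<times> UNIV) f"
    if "set_integrable lborel ({x - c..x + c} \<times> UNIV) f" "min d e \<le> c" for f :: "real \<times> real \<Rightarrow> real" and c
  proof (rule set_integrable_subset[OF that(1)])
    show "{x - min d e..x + min d e} \<times> (UNIV :: real set) \<in> sets lborel"
      by (auto intro!: borel_closed closed_Times)
  qed (use that(2) in auto)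
  have "set_integrable lborel ({x - min d e..x + min d e} \<times> UNIV)
      (\<lambda>p. c1 * (case p of (s, t) \<Rightarrow> F s t) + c0 * (case p of (s, t) \<Rightarrow> G s t))"
    by (intro set_integral_add set_integrable_mult_right sub[OF d(2)] sub[OF e(2)]) auto
  then show ?thesis
    unfolding integrable_near_def case_prod_beta' using d(1) e(1) by (intro exI[of _ "min d e"]) simp
qed

locale regression_density =
  fixes g :: "real \<Rightarrow> real \<Rightarrow> real" and K :: "real \<Rightarrow> real" and x :: real
  assumes g_nonneg: "\<And>s t. 0 \<le> g s t" and g_meas: "(\<lambda>(s, t). g s t) \<in> borel_measurable (lborel \<Otimes>\<^sub>M lborel)"
    and dens_nonzero: "marg_dens g x \<noteq> 0"
    and K_nonneg: "\<And>z. 0 \<le> K z" and K_cont: "continuous_on UNIV K" and K_bounded: "bounded (range K)"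
    and K_moments: "has_bochner_integral lborel K 1" "has_bochner_integral lborel (\<lambda>z. z * K z) 0"
      "integrable lborel (\<lambda>z. z\<^sup>2 * K z)"
    and g_C2: "C2_fst g"
    and g_moments: "\<And>p::nat. p \<in> {0, 1, 2} \<Longrightarrow> bounded_integral (\<lambda>s t. t ^ p * g s t)"
      "\<And>p::nat. p \<in> {0, 1, 2} \<Longrightarrow> isCont (\<lambda>s. \<integral>t. t ^ p * g s t \<partial>lborel) x"
    and g_third: "bounded_integral (\<lambda>s t. \<bar>t\<bar> ^ 3 * g s t)"
    and g_first_deriv: "\<And>p::nat. p \<in> {0, 1} \<Longrightarrow> integrable lborel (\<lambda>t. \<bar>t\<bar> ^ p * \<bar>ds g x t\<bar>)"
    and g_second_deriv: "\<And>p::nat. p \<in> {0, 1} \<Longrightarrow> bounded_integral (\<lambda>s t. t ^ p * ds (ds g) s t)"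
      "\<And>p::nat. p \<in> {0, 1} \<Longrightarrow> isCont (\<lambda>s. \<integral>t. t ^ p * ds (ds g) s t \<partial>lborel) x"
      "\<And>p::nat. p \<in> {0, 1} \<Longrightarrow> integrable_near x (\<lambda>s t. t ^ p * ds (ds g) s t)"
begin

abbreviation r :: real where "r \<equiv> cond_mean g x"

lemma K_measurable [measurable]: "K \<in> borel_measurable borel"
  by (rule borel_measurable_continuous_onI[OF K_cont])

lemma K_power_integrable: "integrable lborel (\<lambda>z. K z ^ Suc j)"
proof -
  obtain B where B: "\<And>z. K z \<le> B"
    using K_bounded by (auto simp: bounded_iff intro: abs_le_D1)
  show ?thesis
  proof (rule Bochner_Integration.integrable_bound)
    show "integrable lborel (\<lambda>z. B ^ j * K z)"
      using K_moments(1) by (auto simp: has_bochner_integral_iff)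
    have "K z ^ j * K z \<le> B ^ j * K z" for z
      using K_nonneg B by (intro mult_right_mono power_mono) auto
    then show "AE z in lborel. norm (K z ^ Suc j) \<le> norm (B ^ j * K z)"
      using K_nonneg order_trans[OF K_nonneg B] by (intro AE_I2) (simp add: abs_mult power_abs mult.commute)
  qed measurable
qed

lemma polynomial_moment:
  assumes "p \<in> {0, 1, 2}"
  shows "integrable lborel (\<lambda>t. t ^ p * g s t)"
  using g_moments(1)[OF assms] by (simp add: bounded_integral_def)

lemma parametric_integral_measurable:
  assumes [measurable]: "\<psi> \<in> borel_measurable borel"
  shows "(\<lambda>s. \<integral>t. \<psi> t * g s t \<partial>lborel) \<in> borel_measurable borel"
proof -
  have "(\<lambda>(s, t). \<psi> t * g s t) \<in> borel_measurable (lborel \<Otimes>\<^sub>M lborel)"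
    using g_meas unfolding case_prod_beta' by measurable
  from lborel.borel_measurable_lebesgue_integral[OF this] show ?thesis
    by simp
qed

lemma deriv_g: "((\<lambda>u. g u t) has_real_derivative ds g u t) (at u)"
  and deriv2_g: "((\<lambda>u. ds g u t) has_real_derivative ds (ds g) u t) (at u)"
  and cont2_g: "continuous_on UNIV (\<lambda>u. ds (ds g) u t)"
  using g_C2 unfolding C2_fst_def ds_def[of g] ds_def[of "\<lambda>u t. deriv (\<lambda>u. g u t) u"]
  by (auto simp: DERIV_deriv_iff_real_differentiable)

text \<open>A limit of difference quotients.\<close>

lemma deriv_g_measurable [measurable]: "ds g x \<in> borel_measurable borel"
proof (rule borel_measurable_LIMSEQ_real)
  fix t :: real
  have "((\<lambda>d. (g (x + d) t - g x t) / d) \<longlongrightarrow> ds g x t) (at 0)"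
    using deriv_g[of t x] by (simp add: DERIV_def)
  moreover have "filterlim (\<lambda>n. inverse (real (Suc n))) (at 0) sequentially"
    using LIMSEQ_inverse_real_of_nat by (simp add: filterlim_at)
  ultimately show "(\<lambda>n. (g (x + inverse (real (Suc n))) t - g x t) / inverse (real (Suc n))) \<longlonglongrightarrow> ds g x t"
    by (rule filterlim_compose)
next
  fix n :: nat
  have [measurable]: "g s \<in> borel_measurable borel" for s
    using borel_measurable_integrable[OF polynomial_moment[of 0 s]] by simp
  show "(\<lambda>t. (g (x + inverse (real (Suc n))) t - g x t) / inverse (real (Suc n))) \<in> borel_measurable borel"
    by measurable
qed

lemma deriv_g_moment:
  assumes "p \<in> {0, 1::nat}"
  shows "integrable lborel (\<lambda>t. t ^ p * ds g x t)"
  by (rule Bochner_Integration.integrable_bound[OF g_first_deriv[OF assms]])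
     (auto simp: abs_mult power_abs)

text \<open>Weights that are affine in \<open>t\<close> cover both the density of \<open>X\<close> and the numerator of the
  regression function recentred at \<open>r\<close>.\<close>

lemma affine_smoothing:
  fixes c0 c1 :: real
  defines "N \<equiv> \<lambda>s. \<integral>t. (c1 * t + c0) * g s t \<partial>lborel"
  obtains C where "0 \<le> C" "\<And>h. \<bar>(\<integral>z. K z * N (x - h * z) \<partial>lborel) - N x\<bar> \<le> C * h\<^sup>2"
    "\<And>h. h \<longlonglongrightarrow> 0 \<Longrightarrow> (\<And>n. 1 \<le> n \<Longrightarrow> 0 < h n) \<Longrightarrow>
      (\<lambda>n. ((\<integral>z. K z * N (x - h n * z) \<partial>lborel) - N x) / (h n)\<^sup>2)
        \<longlonglongrightarrow> (\<integral>t. (c1 * t + c0) * ds (ds g) x t \<partial>lborel) / 2 * (\<integral>z. z\<^sup>2 * K z \<partial>lborel)"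
proof -
  have split: "(\<lambda>s t. (c1 * t + c0) * F s t) = (\<lambda>s t. c1 * (t ^ 1 * F s t) + c0 * (t ^ 0 * F s t))"
    for F :: "real \<Rightarrow> real \<Rightarrow> real"
    by (simp add: fun_eq_iff algebra_simps)
  let ?F = "\<lambda>s t. (c1 * t + c0) * g s t" and ?F1 = "\<lambda>s t. (c1 * t + c0) * ds g s t"
    and ?F2 = "\<lambda>s t. (c1 * t + c0) * ds (ds g) s t"
  have F: "bounded_integral ?F" and F2: "bounded_integral ?F2"
    unfolding split by (intro bounded_integral_linear g_moments(1) g_second_deriv(1); simp)+
  have near: "integrable_near x ?F2"
    unfolding split by (intro integrable_near_linear g_second_deriv(3)) simp_all
  have "integrable lborel (\<lambda>t. c1 * (t ^ 1 * ds g x t) + c0 * (t ^ 0 * ds g x t))"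
    by (intro integrable_arith deriv_g_moment) simp_all
  then have F1: "integrable lborel (?F1 x)"
    by (simp add: algebra_simps)
  have int2: "integrable lborel (\<lambda>t. t ^ p * ds (ds g) s t)" if "p \<in> {0, 1}" for s and p :: nat
    using g_second_deriv(1)[OF that] by (simp add: bounded_integral_def)
  have "(\<integral>t. ?F2 s t \<partial>lborel) = c1 * (\<integral>t. t ^ 1 * ds (ds g) s t \<partial>lborel) + c0 * (\<integral>t. t ^ 0 * ds (ds g) s t \<partial>lborel)" for s
    using fun_cong[OF split[of "ds (ds g)"], of s] int2[of 0 s] int2[of 1 s] by simp
  then have cont: "isCont (\<lambda>s. \<integral>t. ?F2 s t \<partial>lborel) x"
    by (simp only:) (intro continuous_intros g_second_deriv(2); simp)
  have d1: "((\<lambda>u. ?F u t) has_real_derivative ?F1 u t) (at u)"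
    and d2: "((\<lambda>u. ?F1 u t) has_real_derivative ?F2 u t) (at u)" for u t
    by (intro DERIV_cmult deriv_g deriv2_g)+
  have cont2: "continuous_on UNIV (\<lambda>u. ?F2 u t)" for t
    by (intro continuous_intros cont2_g)
  have N_meas: "N \<in> borel_measurable borel"
    unfolding N_def by (rule parametric_integral_measurable) measurable
  show thesis
    by (rule kernel_smoothing_second_order[where N = "\<lambda>s. \<integral>t. (c1 * t + c0) * g s t \<partial>lborel",
        OF K_moments K_nonneg N_meas[unfolded N_def] second_order_expansion[OF d1 d2 cont2 F F2 F1 near cont]])
       (rule that[unfolded N_def]; blast)
qed

lemma dens_pos: "0 < marg_dens g x"
proof -
  have "0 \<le> marg_dens g x"
    unfolding marg_dens_def using g_nonneg by (intro integral_nonneg_AE AE_I2) simp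
  with dens_nonzero show ?thesis
    by simp
qed

text \<open>The second moment of \<open>Y - r\<close> given \<open>X = s\<close>, times the density of \<open>X\<close> at \<open>s\<close>.\<close>

definition second :: "real \<Rightarrow> real" where
  "second s = (\<integral>t. (t - r)\<^sup>2 * g s t \<partial>lborel)"

lemma second_eq: "second s = (\<integral>t. t ^ 2 * g s t \<partial>lborel) - 2 * r * (\<integral>t. t ^ 1 * g s t \<partial>lborel)
    + r\<^sup>2 * (\<integral>t. t ^ 0 * g s t \<partial>lborel)"
  and int_second: "integrable lborel (\<lambda>t. (t - r)\<^sup>2 * g s t)"
proof -
  have eq: "(t - r)\<^sup>2 * g s t = t ^ 2 * g s t - 2 * r * (t ^ 1 * g s t) + r\<^sup>2 * (t ^ 0 * g s t)" for t
    by (simp add: power2_eq_square algebra_simps)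
  have int: "integrable lborel (\<lambda>t. t ^ 2 * g s t)" "integrable lborel (\<lambda>t. t ^ 1 * g s t)"
      "integrable lborel (\<lambda>t. t ^ 0 * g s t)"
    by (intro polynomial_moment; simp)+
  show "integrable lborel (\<lambda>t. (t - r)\<^sup>2 * g s t)"
    unfolding eq by (intro integrable_arith int)
  show "second s = (\<integral>t. t ^ 2 * g s t \<partial>lborel) - 2 * r * (\<integral>t. t ^ 1 * g s t \<partial>lborel)
    + r\<^sup>2 * (\<integral>t. t ^ 0 * g s t \<partial>lborel)"
    unfolding second_def eq using int
    by (simp only: Bochner_Integration.integral_add Bochner_Integration.integral_diff integral_mult_right_zero
        Bochner_Integration.integrable_diff integrable_mult_right)
qed

lemma second_cont: "isCont second x"
  unfolding second_eq[abs_def] by (intro continuous_intros g_moments(2); simp)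

lemma moment_bound:
  assumes "p \<in> {0, 1, 2::nat}"
  obtains B where "\<And>s. \<bar>\<integral>t. t ^ p * g s t \<partial>lborel\<bar> \<le> B"
  using g_moments(1)[OF assms] by (auto simp: bounded_integral_def bounded_iff)

lemma second_bound: obtains B where "\<And>s. \<bar>second s\<bar> \<le> B"
proof -
  obtain B0 where B0: "\<And>s. \<bar>\<integral>t. t ^ 0 * g s t \<partial>lborel\<bar> \<le> B0"
    using moment_bound[of 0] by blast
  obtain B1 where B1: "\<And>s. \<bar>\<integral>t. t ^ 1 * g s t \<partial>lborel\<bar> \<le> B1"
    using moment_bound[of 1] by blast
  obtain B2 where B2: "\<And>s. \<bar>\<integral>t. t ^ 2 * g s t \<partial>lborel\<bar> \<le> B2"
    using moment_bound[of 2] by blast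
  have "\<bar>second s\<bar> \<le> B2 + \<bar>2 * r\<bar> * B1 + r\<^sup>2 * B0" for s
  proof -
    have "\<bar>second s\<bar> \<le> \<bar>\<integral>t. t ^ 2 * g s t \<partial>lborel\<bar> + \<bar>2 * r * (\<integral>t. t ^ 1 * g s t \<partial>lborel)\<bar>
        + \<bar>r\<^sup>2 * (\<integral>t. t ^ 0 * g s t \<partial>lborel)\<bar>"
      unfolding second_eq by linarith
    also have "\<dots> = \<bar>\<integral>t. t ^ 2 * g s t \<partial>lborel\<bar> + \<bar>2 * r\<bar> * \<bar>\<integral>t. t ^ 1 * g s t \<partial>lborel\<bar>
        + r\<^sup>2 * \<bar>\<integral>t. t ^ 0 * g s t \<partial>lborel\<bar>"
      by (simp only: abs_mult abs_power2)
    also have "\<dots> \<le> B2 + \<bar>2 * r\<bar> * B1 + r\<^sup>2 * B0"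
      by (intro add_mono mult_left_mono B0 B1 B2) auto
    finally show ?thesis .
  qed
  then show thesis
    by (rule that)
qed

lemma third_bound:
  obtains B where "\<And>s. (\<integral>t. \<bar>\<bar>t - r\<bar> ^ 3\<bar> * g s t \<partial>lborel) \<le> B"
    "\<And>s. integrable lborel (\<lambda>t. \<bar>t - r\<bar> ^ 3 * g s t)"
proof -
  have int3: "integrable lborel (\<lambda>t. \<bar>t\<bar> ^ 3 * g s t)" for s
    using g_third by (simp add: bounded_integral_def)
  have int0: "integrable lborel (g s)" for s
    using polynomial_moment[of 0 s] by simp
  obtain B3 where B3: "\<And>s. \<bar>\<integral>t. \<bar>t\<bar> ^ 3 * g s t \<partial>lborel\<bar> \<le> B3"
    using g_third by (auto simp: bounded_integral_def bounded_iff)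
  obtain B0 where B0: "\<And>s. \<bar>\<integral>t. t ^ 0 * g s t \<partial>lborel\<bar> \<le> B0"
    using moment_bound[of 0] by blast
  have le: "\<bar>t - r\<bar> ^ 3 * g s t \<le> 4 * (\<bar>t\<bar> ^ 3 * g s t) + 4 * \<bar>r\<bar> ^ 3 * g s t" for s t
    using mult_right_mono[OF abs_diff_cube_le g_nonneg, of t r s t] by (simp add: algebra_simps)
  have dom: "integrable lborel (\<lambda>t. 4 * (\<bar>t\<bar> ^ 3 * g s t) + 4 * \<bar>r\<bar> ^ 3 * g s t)" for s
    using int3 int0 by simp
  have [measurable]: "g s \<in> borel_measurable borel" for s
    using borel_measurable_integrable[OF int0[of s]] by simp
  have int: "integrable lborel (\<lambda>t. \<bar>t - r\<bar> ^ 3 * g s t)" for s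
    using le g_nonneg by (intro Bochner_Integration.integrable_bound[OF dom[of s]]) (auto intro!: AE_I2 intro: order_trans[OF le abs_ge_self])
  have "(\<integral>t. \<bar>\<bar>t - r\<bar> ^ 3\<bar> * g s t \<partial>lborel) \<le> 4 * B3 + 4 * \<bar>r\<bar> ^ 3 * B0" for s
  proof -
    have "(\<integral>t. \<bar>\<bar>t - r\<bar> ^ 3\<bar> * g s t \<partial>lborel) \<le> (\<integral>t. 4 * (\<bar>t\<bar> ^ 3 * g s t) + 4 * \<bar>r\<bar> ^ 3 * g s t \<partial>lborel)"
      using int[of s] le by (intro integral_mono dom) simp_all
    also have "\<dots> = 4 * (\<integral>t. \<bar>t\<bar> ^ 3 * g s t \<partial>lborel) + 4 * \<bar>r\<bar> ^ 3 * (\<integral>t. t ^ 0 * g s t \<partial>lborel)"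
      using int3[of s] int0[of s] by simp
    also have "\<dots> \<le> 4 * B3 + 4 * \<bar>r\<bar> ^ 3 * B0"
      by (intro add_mono mult_left_mono abs_le_D1[OF B3] abs_le_D1[OF B0]) auto
    finally show ?thesis .
  qed
  with int show thesis
    by (intro that)
qed

end

locale regression_sample = prob_space M + regression_density g K x
  for M :: "'a measure" and g K x +
  fixes X Y :: "nat \<Rightarrow> 'a \<Rightarrow> real" and h :: "nat \<Rightarrow> real"
  assumes dens: "\<And>n. 1 \<le> n \<Longrightarrow> distributed M lborel (\<lambda>\<omega>. (X n \<omega>, Y n \<omega>)) (\<lambda>(s, t). ennreal (g s t))"
    and h_pos: "\<And>n. 1 \<le> n \<Longrightarrow> 0 < h n" and h_lim: "h \<longlonglongrightarrow> 0"
begin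

definition centred :: "nat \<Rightarrow> 'a \<Rightarrow> real" where
  "centred n \<omega> = W K h X Y x n \<omega> - r * Z K h X x n \<omega>"

lemma Z_eq: "Z K h X x n \<omega> = inverse (h n) * (K ((x - X n \<omega>) / h n) * (0 * Y n \<omega> + 1))"
  by (simp add: Z_def)

lemma centred_eq: "centred n \<omega> = inverse (h n) * (K ((x - X n \<omega>) / h n) * (1 * Y n \<omega> + - r))"
  by (simp add: centred_def Z_def W_def algebra_simps)

text \<open>The absolute first moment, which Fubini's theorem asks for, is bounded through
  \<open>\<bar>t\<bar> \<le> 1 + t\<^sup>2\<close>.\<close>

lemma affine_kernel_mean:
  fixes c0 c1 :: real
  assumes n: "1 \<le> n"
  shows "expectation (\<lambda>\<omega>. inverse (h n) * (K ((x - X n \<omega>) / h n) * (c1 * Y n \<omega> + c0)))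
    = (\<integral>z. K z * (\<integral>t. (c1 * t + c0) * g (x - h n * z) t \<partial>lborel) \<partial>lborel)"
proof -
  have int: "integrable lborel (\<lambda>t. t ^ p * g s t)" if "p \<in> {0, 1, 2::nat}" for p s
    by (rule polynomial_moment[OF that])
  have int_\<psi>: "integrable lborel (\<lambda>t. (c1 * t + c0) * g s t)" for s
    using int[of 0 s] int[of 1 s] by (simp add: distrib_right mult.assoc)
  obtain B0 where B0: "\<And>s. \<bar>\<integral>t. t ^ 0 * g s t \<partial>lborel\<bar> \<le> B0"
    using moment_bound[of 0] by blast
  obtain B2 where B2: "\<And>s. \<bar>\<integral>t. t ^ 2 * g s t \<partial>lborel\<bar> \<le> B2"
    using moment_bound[of 2] by blast
  let ?d = "\<bar>c1\<bar> + \<bar>c0\<bar>"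
  have "(\<integral>t. \<bar>c1 * t + c0\<bar> * g s t \<partial>lborel) \<le> \<bar>c1\<bar> * B2 + ?d * B0" for s
  proof -
    have weight_le: "\<bar>c1 * t + c0\<bar> \<le> \<bar>c1\<bar> * t\<^sup>2 + ?d" for t
    proof -
      have "\<bar>c1 * t + c0\<bar> \<le> \<bar>c1\<bar> * \<bar>t\<bar> + \<bar>c0\<bar>"
        by (rule order_trans[OF abs_triangle_ineq]) (simp add: abs_mult)
      also have "\<bar>c1\<bar> * \<bar>t\<bar> \<le> \<bar>c1\<bar> * (1 + t\<^sup>2)"
        by (intro mult_left_mono abs_le_one_plus_square) simp
      finally show ?thesis
        by (simp add: algebra_simps)
    qed
    have le: "\<bar>c1 * t + c0\<bar> * g s t \<le> \<bar>c1\<bar> * (t ^ 2 * g s t) + ?d * (t ^ 0 * g s t)" for t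
      using mult_right_mono[OF weight_le[of t] g_nonneg[of s t]] by (simp add: algebra_simps)
    have "(\<integral>t. \<bar>c1 * t + c0\<bar> * g s t \<partial>lborel) \<le> (\<integral>t. \<bar>c1\<bar> * (t ^ 2 * g s t) + ?d * (t ^ 0 * g s t) \<partial>lborel)"
    proof (intro integral_mono le integrable_arith int)
      show "integrable lborel (\<lambda>t. \<bar>c1 * t + c0\<bar> * g s t)"
        using integrable_abs[OF int_\<psi>[of s]] g_nonneg by (simp add: abs_mult)
    qed auto
    also have "\<dots> = \<bar>c1\<bar> * (\<integral>t. t ^ 2 * g s t \<partial>lborel) + ?d * (\<integral>t. t ^ 0 * g s t \<partial>lborel)"
      using int[of 2 s] int[of 0 s] by simp
    also have "\<dots> \<le> \<bar>c1\<bar> * B2 + ?d * B0"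
      by (intro add_mono mult_left_mono abs_le_D1[OF B2] abs_le_D1[OF B0]) auto
    finally show ?thesis .
  qed
  note mean = kernel_expectation(2)[OF dens[OF n] g_nonneg _ _ int_\<psi> this h_pos[OF n], of K x]
  have "integrable lborel K"
    using K_moments(1) by (simp add: has_bochner_integral_iff)
  then have "expectation (\<lambda>\<omega>. K ((x - X n \<omega>) / h n) * (c1 * Y n \<omega> + c0))
      = h n * (\<integral>z. K z * (\<integral>t. (c1 * t + c0) * g (x - h n * z) t \<partial>lborel) \<partial>lborel)"
    by (intro mean) measurable
  then show ?thesis
    using h_pos[OF n] by simp
qed

lemma mean_Z_bound:
  obtains C where "0 \<le> C" "\<And>n. 1 \<le> n \<Longrightarrow> \<bar>expectation (Z K h X x n) - marg_dens g x\<bar> \<le> C * (h n)\<^sup>2"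
proof -
  obtain C where C: "0 \<le> C" "\<And>h. \<bar>(\<integral>z. K z * (\<integral>t. (0 * t + 1) * g (x - h * z) t \<partial>lborel) \<partial>lborel)
      - (\<integral>t. (0 * t + 1) * g x t \<partial>lborel)\<bar> \<le> C * h\<^sup>2"
    by (rule affine_smoothing[of 0 1]) blast
  have "\<bar>expectation (Z K h X x n) - marg_dens g x\<bar> \<le> C * (h n)\<^sup>2" if "1 \<le> n" for n
  proof -
    have "expectation (Z K h X x n) = (\<integral>z. K z * (\<integral>t. (0 * t + 1) * g (x - h n * z) t \<partial>lborel) \<partial>lborel)"
      unfolding affine_kernel_mean[OF that, symmetric] Z_eq[symmetric] ..
    with C(2)[of "h n"] show ?thesis
      by (simp add: marg_dens_def)
  qed
  with C(1) show thesis
    by (rule that)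
qed

text \<open>Recentring at \<open>r\<close> removes the term of order \<open>0\<close> of the expansion at \<open>x\<close>; hence the mean of
  \<open>centred n\<close> is of order \<open>(h n)\<^sup>2\<close>.\<close>

lemma mean_numerator: "(\<integral>t. (1 * t + - r) * g x t \<partial>lborel) = 0"
proof -
  have "(\<integral>t. (1 * t + - r) * g x t \<partial>lborel) = (\<integral>t. t * g x t \<partial>lborel) - r * marg_dens g x"
    using polynomial_moment[of 0 x] polynomial_moment[of 1 x] by (simp add: left_diff_distrib marg_dens_def)
  then show ?thesis
    using dens_nonzero by (simp add: cond_mean_def)
qed

lemma mean_centred_lim: "(\<lambda>n. expectation (centred n) / (h n)\<^sup>2) \<longlonglongrightarrow> marg_dens g x * m2 K g x"
proof -
  have "(\<lambda>n. ((\<integral>z. K z * (\<integral>t. (1 * t + - r) * g (x - h n * z) t \<partial>lborel) \<partial>lborel) - 0) / (h n)\<^sup>2)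
      \<longlonglongrightarrow> (\<integral>t. (1 * t + - r) * ds (ds g) x t \<partial>lborel) / 2 * (\<integral>z. z\<^sup>2 * K z \<partial>lborel)"
    unfolding mean_numerator[symmetric]
    by (rule affine_smoothing[of 1 "- r"]) (use h_lim h_pos in blast)
  moreover have "eventually (\<lambda>n. ((\<integral>z. K z * (\<integral>t. (1 * t + - r) * g (x - h n * z) t \<partial>lborel) \<partial>lborel) - 0) / (h n)\<^sup>2
      = expectation (centred n) / (h n)\<^sup>2) sequentially"
    using eventually_ge_at_top[of 1]
  proof eventually_elim
    case (elim n)
    show ?case
      unfolding affine_kernel_mean[OF elim, symmetric] centred_eq[symmetric] by simp
  qed
  ultimately have "(\<lambda>n. expectation (centred n) / (h n)\<^sup>2)
      \<longlonglongrightarrow> (\<integral>t. (1 * t + - r) * ds (ds g) x t \<partial>lborel) / 2 * (\<integral>z. z\<^sup>2 * K z \<partial>lborel)"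
    by (rule Lim_transform_eventually)
  moreover have "(\<integral>t. (1 * t + - r) * ds (ds g) x t \<partial>lborel)
      = (\<integral>t. t * ds (ds g) x t \<partial>lborel) - r * (\<integral>t. ds (ds g) x t \<partial>lborel)"
    using g_second_deriv(1)[of 0] g_second_deriv(1)[of 1]
    by (simp add: left_diff_distrib bounded_integral_def)
  ultimately show ?thesis
    using dens_nonzero by (simp add: m2_def)
qed

lemma second_Z_bound:
  obtains C where "0 \<le> C" "\<And>n. 1 \<le> n \<Longrightarrow> mean_square (Z K h X x n) \<le> C / h n"
    "\<And>n. 1 \<le> n \<Longrightarrow> integrable M (\<lambda>\<omega>. (Z K h X x n \<omega>)\<^sup>2)"
proof -
  obtain B where B: "\<And>s. \<bar>\<integral>t. t ^ 0 * g s t \<partial>lborel\<bar> \<le> B"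
    using moment_bound[of 0] by blast
  have "0 \<le> B"
    by (rule order_trans[OF abs_ge_zero B])
  have K2: "integrable lborel (\<lambda>z. (K z)\<^sup>2)"
    using K_power_integrable[of 1] by (simp add: power2_eq_square)
  have Z_sq: "(Z K h X x n \<omega>)\<^sup>2 = inverse ((h n)\<^sup>2) * ((K ((x - X n \<omega>) / h n))\<^sup>2 * 1)" for n \<omega>
    by (simp add: Z_def power_mult_distrib power_inverse)
  have int: "integrable lborel (\<lambda>t. 1 * g s t)" for s
    using polynomial_moment[of 0 s] by simp
  have bound: "(\<integral>t. \<bar>1\<bar> * g s t \<partial>lborel) \<le> B" for s
    using abs_le_D1[OF B[of s]] by simp
  note ke = kernel_expectation[OF dens g_nonneg K2 borel_measurable_const int bound h_pos]
  let ?C = "B * (\<integral>z. \<bar>(K z)\<^sup>2\<bar> \<partial>lborel)"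
  show thesis
  proof (rule that)
    show "0 \<le> ?C"
      using \<open>0 \<le> B\<close> by simp
    fix n :: nat assume n: "1 \<le> n"
    show "integrable M (\<lambda>\<omega>. (Z K h X x n \<omega>)\<^sup>2)"
      unfolding Z_sq by (intro integrable_mult_right ke(1)[OF n n])
    have "mean_square (Z K h X x n) = inverse ((h n)\<^sup>2) * expectation (\<lambda>\<omega>. (K ((x - X n \<omega>) / h n))\<^sup>2 * 1)"
      unfolding Z_sq by (rule integral_mult_right_zero)
    also have "\<dots> \<le> inverse ((h n)\<^sup>2) * (h n * ?C)"
      by (intro mult_left_mono abs_le_D1[OF ke(3)[OF n n]]) simp
    also have "\<dots> = ?C / h n"
      using h_pos[OF n] by (simp add: field_simps power2_eq_square)
    finally show "mean_square (Z K h X x n) \<le> ?C / h n" .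
  qed
qed

lemma second_centred_lim:
  "(\<lambda>n. h n * mean_square (centred n)) \<longlonglongrightarrow> second x * (\<integral>z. (K z)\<^sup>2 \<partial>lborel)"
proof -
  obtain B where B: "\<And>s. \<bar>second s\<bar> \<le> B"
    using second_bound by blast
  have K2: "integrable lborel (\<lambda>z. (K z)\<^sup>2)"
    using K_power_integrable[of 1] by (simp add: power2_eq_square)
  have sq: "(centred n \<omega>)\<^sup>2 = inverse ((h n)\<^sup>2) * ((K ((x - X n \<omega>) / h n))\<^sup>2 * (Y n \<omega> - r)\<^sup>2)" for n \<omega>
    by (simp add: centred_eq power_mult_distrib power_inverse)
  have "(\<integral>t. \<bar>(t - r)\<^sup>2\<bar> * g s t \<partial>lborel) \<le> B" for s
    using abs_le_D1[OF B[of s]] by (simp add: second_def)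
  note ke = kernel_expectation(2)[OF dens g_nonneg K2 _ int_second this h_pos, folded second_def]
  have "(\<lambda>n. \<integral>z. (K z)\<^sup>2 * second (x - h n * z) \<partial>lborel) \<longlonglongrightarrow> second x * (\<integral>z. (K z)\<^sup>2 \<partial>lborel)"
  proof (rule kernel_smoothing_limit[OF K2 _ B])
    show "second \<in> borel_measurable borel"
      unfolding second_def by (rule parametric_integral_measurable) measurable
    fix z :: real
    have "(\<lambda>n. x - h n * z) \<longlonglongrightarrow> x - 0 * z"
      by (intro tendsto_intros h_lim)
    then show "(\<lambda>n. second (x - h n * z)) \<longlonglongrightarrow> second x"
      using isCont_tendsto_compose[OF second_cont] by simp
  qed
  moreover have "eventually (\<lambda>n. (\<integral>z. (K z)\<^sup>2 * second (x - h n * z) \<partial>lborel)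
      = h n * mean_square (centred n)) sequentially"
    using eventually_ge_at_top[of 1]
  proof eventually_elim
    case (elim n)
    have "mean_square (centred n)
        = inverse ((h n)\<^sup>2) * expectation (\<lambda>\<omega>. (K ((x - X n \<omega>) / h n))\<^sup>2 * (Y n \<omega> - r)\<^sup>2)"
      unfolding sq by (rule integral_mult_right_zero)
    also have "expectation (\<lambda>\<omega>. (K ((x - X n \<omega>) / h n))\<^sup>2 * (Y n \<omega> - r)\<^sup>2)
        = h n * (\<integral>z. (K z)\<^sup>2 * second (x - h n * z) \<partial>lborel)"
      by (rule ke) (use elim in measurable)
    finally show ?case
      using h_pos[OF elim] by (simp add: field_simps power2_eq_square)
  qed
  ultimately show ?thesis
    by (rule Lim_transform_eventually)
qed

lemma third_centred_bound:
  obtains C where "0 \<le> C" "\<And>n. 1 \<le> n \<Longrightarrow> mean_cube (centred n) \<le> C / (h n)\<^sup>2"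
    "\<And>n. 1 \<le> n \<Longrightarrow> integrable M (\<lambda>\<omega>. \<bar>centred n \<omega>\<bar> ^ 3)"
proof -
  obtain B where B: "\<And>s. (\<integral>t. \<bar>\<bar>t - r\<bar> ^ 3\<bar> * g s t \<partial>lborel) \<le> B"
    "\<And>s. integrable lborel (\<lambda>t. \<bar>t - r\<bar> ^ 3 * g s t)"
    using third_bound by blast
  have "0 \<le> (\<integral>t. \<bar>\<bar>t - r\<bar> ^ 3\<bar> * g x t \<partial>lborel)"
    using g_nonneg by (intro integral_nonneg_AE AE_I2) simp
  then have "0 \<le> B"
    using B(1)[of x] by linarith
  have K3: "integrable lborel (\<lambda>z. K z ^ 3)"
    using K_power_integrable[of 2] by (simp add: eval_nat_numeral)
  have cube: "\<bar>centred n \<omega>\<bar> ^ 3 = inverse (h n ^ 3) * (K ((x - X n \<omega>) / h n) ^ 3 * \<bar>Y n \<omega> - r\<bar> ^ 3)" if "1 \<le> n" for n \<omega>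
    using h_pos[OF that] K_nonneg by (simp add: centred_eq abs_mult power_mult_distrib power_inverse)
  have meas: "(\<lambda>t. \<bar>t - r\<bar> ^ 3) \<in> borel_measurable borel"
    by measurable
  note ke = kernel_expectation[OF dens g_nonneg K3 meas B(2) B(1) h_pos]
  let ?C = "B * (\<integral>z. \<bar>K z ^ 3\<bar> \<partial>lborel)"
  show thesis
  proof (rule that)
    show "0 \<le> ?C"
      using \<open>0 \<le> B\<close> by simp
    fix n :: nat assume n: "1 \<le> n"
    show "integrable M (\<lambda>\<omega>. \<bar>centred n \<omega>\<bar> ^ 3)"
      unfolding cube[OF n] by (intro integrable_mult_right ke(1)[OF n n])
    have "mean_cube (centred n)
        = inverse (h n ^ 3) * expectation (\<lambda>\<omega>. K ((x - X n \<omega>) / h n) ^ 3 * \<bar>Y n \<omega> - r\<bar> ^ 3)"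
      unfolding cube[OF n] by (rule integral_mult_right_zero)
    also have "\<dots> \<le> inverse (h n ^ 3) * (h n * ?C)"
      using h_pos[OF n] by (intro mult_left_mono abs_le_D1[OF ke(3)[OF n n]]) simp
    also have "\<dots> = ?C / (h n)\<^sup>2"
      using h_pos[OF n] by (simp add: field_simps power2_eq_square power3_eq_cube)
    finally show "mean_cube (centred n) \<le> ?C / (h n)\<^sup>2" .
  qed
qed

lemma cond_var_eq: "cond_var g x = second x / marg_dens g x"
  by (simp add: cond_var_def second_def divide_inverse mult.commute)

lemma second_nonneg: "0 \<le> second x"
  unfolding second_def using g_nonneg by (intro integral_nonneg_AE AE_I2) simp

end

section \<open>The averaged estimator\<close>

theorem theorem4:
  fixes M :: "'a measure"
    and X Y :: "nat \<Rightarrow> 'a \<Rightarrow> real"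
    and g :: "real \<Rightarrow> real \<Rightarrow> real"
    and K :: "real \<Rightarrow> real"
    and \<gamma> h w :: "nat \<Rightarrow> real"
    and r0 :: "real \<Rightarrow> real"
    and x \<alpha> a q :: real
  assumes "prob_space M"
    and "\<And>s t. 0 \<le> g s t"
    and "\<And>n. 1 \<le> n \<Longrightarrow>
           distributed M lborel (\<lambda>\<omega>. (X n \<omega>, Y n \<omega>)) (\<lambda>(s, t). ennreal (g s t))"
    and "prob_space.indep_vars M (\<lambda>_. borel) (\<lambda>n \<omega>. (X n \<omega>, Y n \<omega>)) {1..}"
    and "marg_dens g x \<noteq> 0"
    and "\<And>z. 0 \<le> K z" and "continuous_on UNIV K" and "bounded (range K)"
    and "has_bochner_integral lborel K 1"
    and "has_bochner_integral lborel (\<lambda>z. z * K z) 0"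
    and "integrable lborel (\<lambda>z. z\<^sup>2 * K z)"
    and "\<gamma> \<longlonglongrightarrow> 0" and "h \<longlonglongrightarrow> 0"
    and "\<gamma> \<in> GS (- \<alpha>)" and "\<alpha> \<in> {3/4<..1}"
    and "convergent (\<lambda>n. inverse (real n * \<gamma> n))"
    and "h \<in> GS (- a)" and "a \<in> {(1 - \<alpha>) / 4<..<\<alpha> / 3}"
    and "C2_fst g"
    and "\<And>p::nat. p \<in> {0, 1, 2} \<Longrightarrow>
           bounded_integral (\<lambda>s t. t ^ p * g s t) \<and>
           isCont (\<lambda>s. \<integral>t. t ^ p * g s t \<partial>lborel) x"
    and "\<And>p::real. p \<in> {2..3} \<Longrightarrow> bounded_integral (\<lambda>s t. \<bar>t\<bar> powr p * g s t)"
    and "\<And>p::nat. p \<in> {0, 1} \<Longrightarrow> integrable lborel (\<lambda>t. \<bar>t\<bar> ^ p * \<bar>ds g x t\<bar>)"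
    and "\<And>p::nat. p \<in> {0, 1} \<Longrightarrow>
           bounded_integral (\<lambda>s t. t ^ p * ds (ds g) s t) \<and>
           isCont (\<lambda>s. \<integral>t. t ^ p * ds (ds g) s t \<partial>lborel) x \<and>
           integrable_near x (\<lambda>s t. t ^ p * ds (ds g) s t)"
    and "filterlim (\<lambda>n. real n * \<gamma> n * inverse (ln (\<Sum>k=1..n. \<gamma> k))) at_top sequentially"
    and "a \<in> {1 - \<alpha><..<(4 * \<alpha> - 3) / 2}"
    and "filterlim (\<lambda>n. \<Sum>k=1..n. w k) at_top sequentially"
    and "w \<in> GS (- q)" and "q < min (1 - 2 * a) ((1 + a) / 2)"
  shows "(\<forall>c\<ge>0. (\<lambda>n. real n * h n ^ 5) \<longlonglongrightarrow> c \<longrightarrow>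
            conv_in_distribution M
              (\<lambda>n \<omega>. sqrt (real n * h n) * (avg_revesz K h \<gamma> w r0 X Y x n \<omega> - cond_mean g x))
              (gaussian (sqrt c * ((1 - q) / (1 - q - 2 * a)) * m2 K g x)
                 ((1 - q)\<^sup>2 / (1 + a - 2 * q) * (cond_var g x / marg_dens g x)
                    * (\<integral>z. (K z)\<^sup>2 \<partial>lborel)))) \<and>
         (filterlim (\<lambda>n. real n * h n ^ 5) at_top sequentially \<longrightarrow>
            conv_in_probability M
              (\<lambda>n \<omega>. 1 / (h n)\<^sup>2 * (avg_revesz K h \<gamma> w r0 X Y x n \<omega> - cond_mean g x))
              ((1 - q) / (1 - q - 2 * a) * m2 K g x))"
proof -
  interpret prob_space M
    by fact
  have h_pos: "0 < h n" if "1 \<le> n" for n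
    using GS_pos[OF \<open>h \<in> GS (- a)\<close> that] .
  have "distributed M lborel (\<lambda>\<omega>. (X 1 \<omega>, Y 1 \<omega>)) (\<lambda>p. ennreal (g (fst p) (snd p)))"
    using assms(3)[of 1] by (simp add: case_prod_beta')
  from distributed_real_measurable[OF _ this]
  have g_meas: "(\<lambda>(s, t). g s t) \<in> borel_measurable (lborel \<Otimes>\<^sub>M lborel)"
    using assms(2) by (simp add: case_prod_beta' lborel_prod)
  have third: "bounded_integral (\<lambda>s t. \<bar>t\<bar> ^ 3 * g s t)"
  proof -
    have "\<bar>t\<bar> powr 3 = \<bar>t\<bar> ^ 3" for t :: real
      by simp
    then show ?thesis
      using assms(21)[of 3] by simp
  qed
  interpret regression_sample M g K x X Y h
    by unfold_locales (use assms g_meas third h_pos in auto)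
  let ?Z = "Z K h X x" and ?f = "marg_dens g x" and ?K2 = "\<integral>z. (K z)\<^sup>2 \<partial>lborel"
  define \<Delta> where "\<Delta> n \<omega> = revesz K h \<gamma> r0 X Y x n \<omega> - r" for n \<omega>
  have indep: "indep_vars (\<lambda>_. borel) (\<lambda>n \<omega>. (?Z n \<omega>, centred n \<omega>)) {1..}"
  proof -
    let ?\<phi> = "\<lambda>n p. (inverse (h n) * K ((x - fst p) * inverse (h n)),
        inverse (h n) * (K ((x - fst p) * inverse (h n)) * (snd p - r))) :: real \<times> real"
    have "indep_vars (\<lambda>_. borel) (\<lambda>n \<omega>. ?\<phi> n (X n \<omega>, Y n \<omega>)) {1..}"
      by (rule indep_vars_compose2[OF assms(4)])
         (auto intro!: borel_measurable_continuous_onI continuous_intros continuous_on_compose2[OF K_cont])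
    moreover have "?\<phi> n (X n \<omega>, Y n \<omega>) = (?Z n \<omega>, centred n \<omega>)" for n \<omega>
      by (simp add: Z_def centred_eq divide_inverse)
    ultimately show ?thesis
      by simp
  qed
  \<comment> \<open>Once the quotient is positive, so is the logarithm of the sum of the \<open>\<gamma> k\<close>, which increases and
    therefore stays bounded away from \<open>0\<close>.\<close>
  have n\<gamma>: "filterlim (\<lambda>n. real n * \<gamma> n) at_top sequentially"
  proof -
    define S where "S n = (\<Sum>k=1..n. \<gamma> k)" for n
    have \<gamma>_pos: "0 < \<gamma> n" if "1 \<le> n" for n
      using GS_pos[OF \<open>\<gamma> \<in> GS (- \<alpha>)\<close> that] .
    have ratio: "filterlim (\<lambda>n. real n * \<gamma> n * inverse (ln (S n))) at_top sequentially"
      using assms(24) by (simp add: S_def)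
    have "eventually (\<lambda>n. 1 \<le> real n * \<gamma> n * inverse (ln (S n))) sequentially"
      using ratio unfolding filterlim_at_top by blast
    then obtain N where N: "1 \<le> N" "1 \<le> real N * \<gamma> N * inverse (ln (S N))"
      using eventually_ge_at_top[of 1] unfolding eventually_sequentially by (metis le_cases order_trans)
    define c where "c = ln (S N)"
    have "0 < c"
    proof (rule ccontr)
      assume "\<not> 0 < c"
      then have "real N * \<gamma> N * inverse (ln (S N)) \<le> 0"
        using \<gamma>_pos[OF N(1)] N(1) by (intro mult_nonneg_nonpos) (auto simp: c_def)
      then show False
        using N(2) by simp
    qed
    have "eventually (\<lambda>n. c * (real n * \<gamma> n * inverse (ln (S n))) \<le> real n * \<gamma> n) sequentially"
      using eventually_ge_at_top[of N]
    proof eventually_elim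
      case (elim n)
      have "0 < S N"
        unfolding S_def using N(1) \<gamma>_pos by (intro sum_pos) auto
      have "S N \<le> S n"
        unfolding S_def using elim \<gamma>_pos by (intro sum_mono2) (auto intro: less_imp_le)
      then have "c \<le> ln (S n)"
        using \<open>0 < S N\<close> by (simp add: c_def)
      then have "c * inverse (ln (S n)) \<le> 1"
        using \<open>0 < c\<close> by (simp add: field_simps)
      then have "(real n * \<gamma> n) * (c * inverse (ln (S n))) \<le> (real n * \<gamma> n) * 1"
        using \<gamma>_pos[of n] N(1) elim by (intro mult_left_mono) auto
      then show ?case
        by (simp add: mult_ac)
    qed
    then show ?thesis
      by (rule filterlim_at_top_mono[OF filterlim_tendsto_pos_mult_at_top[OF tendsto_const \<open>0 < c\<close> ratio]])
  qed
  obtain C1 where C1: "0 \<le> C1" "\<And>n. 1 \<le> n \<Longrightarrow> \<bar>expectation (?Z n) - ?f\<bar> \<le> C1 * (h n)\<^sup>2"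
    using mean_Z_bound by blast
  obtain C2 where C2: "0 \<le> C2" "\<And>n. 1 \<le> n \<Longrightarrow> expectation (\<lambda>\<omega>. (?Z n \<omega>)\<^sup>2) \<le> C2 / h n"
    "\<And>n. 1 \<le> n \<Longrightarrow> integrable M (\<lambda>\<omega>. (?Z n \<omega>)\<^sup>2)"
    using second_Z_bound by blast
  obtain C3 where C3: "0 \<le> C3" "\<And>n. 1 \<le> n \<Longrightarrow> mean_cube (centred n) \<le> C3 / (h n)\<^sup>2"
    "\<And>n. 1 \<le> n \<Longrightarrow> integrable M (\<lambda>\<omega>. \<bar>centred n \<omega>\<bar> ^ 3)"
    using third_centred_bound by blast
  define C where "C = C1 + C2 + C3"
  interpret rec: averaged_recursion M ?Z centred \<Delta> \<gamma> h w "r0 x - r" ?f "?f * m2 K g x" "second x * ?K2" C \<alpha> a q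
  proof unfold_locales
    show "\<Delta> 0 \<omega> = r0 x - r" for \<omega>
      by (simp add: \<Delta>_def)
    show "\<Delta> (Suc n) \<omega> = \<Delta> n \<omega> + \<gamma> (Suc n) * (centred (Suc n) \<omega> - ?Z (Suc n) \<omega> * \<Delta> n \<omega>)" for n \<omega>
      by (simp add: \<Delta>_def centred_def algebra_simps)
    show "\<bar>expectation (?Z n) - ?f\<bar> \<le> C * (h n)\<^sup>2" if "1 \<le> n" for n
      by (rule order_trans[OF C1(2)[OF that]]) (use C2(1) C3(1) in \<open>auto simp: C_def intro!: mult_right_mono\<close>)
    show "expectation (\<lambda>\<omega>. (?Z n \<omega>)\<^sup>2) \<le> C / h n" if "1 \<le> n" for n
      by (rule order_trans[OF C2(2)[OF that]])
         (use C1(1) C3(1) h_pos[OF that] in \<open>auto simp: C_def intro!: divide_right_mono\<close>)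
    show "mean_cube (centred n) \<le> C / (h n)\<^sup>2" if "1 \<le> n" for n
      by (rule order_trans[OF C3(2)[OF that]]) (use C1(1) C2(1) in \<open>auto simp: C_def intro!: divide_right_mono\<close>)
    show "0 \<le> C"
      using C1(1) C2(1) C3(1) by (simp add: C_def)
  qed (use indep C2(3) C3(3) dens_pos mean_centred_lim second_centred_lim n\<gamma> assms in auto)
  have average: "rec.average n \<omega> = avg_revesz K h \<gamma> w r0 X Y x n \<omega> - r" if "1 \<le> n" for n \<omega>
  proof -
    have "(\<Sum>k=1..n. w k * \<Delta> k \<omega>) = (\<Sum>k=1..n. w k * revesz K h \<gamma> r0 X Y x k \<omega>) - rec.Q n * r"
      by (simp add: \<Delta>_def rec.Q_def right_diff_distrib sum_subtractf sum_distrib_right)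
    then show ?thesis
      using rec.Q_pos[OF that] by (simp add: rec.average_def avg_revesz_def rec.Q_def diff_divide_distrib)
  qed
  have bias: "?f * m2 K g x / ?f = m2 K g x"
    using dens_nonzero by simp
  have variance: "second x * ?K2 / ?f\<^sup>2 = cond_var g x / ?f * ?K2"
    by (simp add: cond_var_eq power2_eq_square)
  have "0 \<le> second x * ?K2"
    using second_nonneg by (intro mult_nonneg_nonneg integral_nonneg_AE) auto
  show ?thesis
  proof (intro conjI allI impI)
    fix c :: real
    assume "(\<lambda>n. real n * h n ^ 5) \<longlonglongrightarrow> c"
    from rec.conv_in_distribution_average[OF this \<open>0 \<le> second x * ?K2\<close>]
    have "conv_in_distribution M (\<lambda>n \<omega>. sqrt (real n * h n) * rec.average n \<omega>)
        (gaussian (sqrt c * ((1 - q) / (1 - q - 2 * a)) * m2 K g x)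
          ((1 - q)\<^sup>2 / (1 + a - 2 * q) * (cond_var g x / ?f) * ?K2))"
      unfolding bias variance by (simp add: mult.assoc)
    moreover have "sqrt (real n * h n) * rec.average n \<omega>
        = sqrt (real n * h n) * (avg_revesz K h \<gamma> w r0 X Y x n \<omega> - r)" for n \<omega>
      \<comment> \<open>For \<open>n = 0\<close> the factor vanishes; the average of no terms does not enter.\<close>
      by (cases "n = 0") (simp_all add: average)
    ultimately show "conv_in_distribution M
        (\<lambda>n \<omega>. sqrt (real n * h n) * (avg_revesz K h \<gamma> w r0 X Y x n \<omega> - r))
        (gaussian (sqrt c * ((1 - q) / (1 - q - 2 * a)) * m2 K g x)
          ((1 - q)\<^sup>2 / (1 + a - 2 * q) * (cond_var g x / ?f) * ?K2))"
      by simp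
  next
    assume "filterlim (\<lambda>n. real n * h n ^ 5) at_top sequentially"
    from rec.conv_in_probability_average[OF this]
    have lim: "conv_in_probability M (\<lambda>n \<omega>. 1 / (h n)\<^sup>2 * rec.average n \<omega>) ((1 - q) / (1 - q - 2 * a) * m2 K g x)"
      unfolding bias .
    show "conv_in_probability M (\<lambda>n \<omega>. 1 / (h n)\<^sup>2 * (avg_revesz K h \<gamma> w r0 X Y x n \<omega> - r))
        ((1 - q) / (1 - q - 2 * a) * m2 K g x)"
      unfolding conv_in_probability_def
    proof (intro allI impI)
      fix e :: real assume "0 < e"
      show "(\<lambda>n. prob {\<omega> \<in> space M. \<bar>1 / (h n)\<^sup>2 * (avg_revesz K h \<gamma> w r0 X Y x n \<omega> - r)
          - (1 - q) / (1 - q - 2 * a) * m2 K g x\<bar> > e}) \<longlonglongrightarrow> 0"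
      proof (rule Lim_transform_eventually)
        show "(\<lambda>n. prob {\<omega> \<in> space M. \<bar>1 / (h n)\<^sup>2 * rec.average n \<omega>
            - (1 - q) / (1 - q - 2 * a) * m2 K g x\<bar> > e}) \<longlonglongrightarrow> 0"
          using lim \<open>0 < e\<close> unfolding conv_in_probability_def by blast
      qed (use eventually_ge_at_top[of 1] in eventually_elim, simp add: average)
    qed
  qed
qed

end
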